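(* Let $M$ be a finite-dimensional compact manifold, $A$ the Leibniz algebroid of cotangent paths over $M$, and $I\subset A$ the subbundle (Leibniz subalgebroid) of those $(X_t,\alpha_t)$ with $X_1=0$ and $\int_0^1\alpha_s\,ds=0$. The map $$\varphi=\Big(\mathrm{ev}_1,\int_0^1(-)\,dt\Big):A\to TM\oplus T^*M,\qquad (X_t,\alpha_t)\mapsto\Big(X_1,\int_0^1\alpha_t\,dt\Big)$$ induces an isomorphism of Leibniz algebroids from $A/I$ to the standard Courant algebroid $TM\oplus T^*M$.
   Context: A (left) Leibniz algebra is a vector space with a bilinear bracket satisfying $[x,[y,z]]=[[x,y],z]+[y,[x,z]]$; a Leibniz algebroid is a vector bundle over $M$ with an anchor map to $TM$ and a Leibniz bracket on its sections. $A$ is the (infinite-dimensional) vector bundle over $M$ whose fiber $A_m$ is the space of smooth paths $t\mapsto(X_t,\alpha_t)\in T_mM\oplus T_m^*M$, $t\in[0,1]$, with $X_0=0$. Its anchor is $(X_t,\alpha_t)\mapsto X_1$. Its sections are pairs $(X_t,\alpha_t)$ of a smooth $1$-parameter family of vector fields with $X_0=0$ and a smooth $1$-parameter family of $1$-forms on $M$, with bracket $$[(X_t,\alpha_t),(Y_t,\beta_t)]=\Big([X_1,Y_t],\ L_{X_1}\beta_t-i_{\dot Y_t}\,d\int_0^1\alpha_s\,ds\Big),\qquad \dot Y_t=\tfrac{d}{dt}Y_t.$$ The standard Courant algebroid $TM\oplus T^*M$ is considered as a Leibniz algebroid with anchor the projection to $TM$ and with the Dorfman bracket $[(X,\alpha),(Y,\beta)]=([X,Y],L_X\beta-i_Yd\alpha)$.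 *)

theory Defs
  imports "HOL-Analysis.Analysis" "HOL-Algebra.AbelCoset" "HOL-Algebra.Module"
begin

section \<open>Smooth functions and smooth manifolds\<close>

text \<open>
  Functions of class $C^k$ on a set \<open>D\<close> lying in the linear subspace \<open>S\<close>. It is used for \<open>D\<close> open in
  \<open>S\<close>, for \<open>D = W \<times> [0,1]\<close> with \<open>W\<close> open, and for \<open>D = [0,1]\<close>; there the derivative within \<open>D\<close>
  (one-sided at the boundary) is unique in the directions of \<open>S\<close>.
\<close>

primrec Ck_on :: "nat \<Rightarrow> 'a::real_normed_vector set \<Rightarrow> 'a set \<Rightarrow> ('a \<Rightarrow> 'b::real_normed_vector) \<Rightarrow> bool" where
  "Ck_on 0 S D f = continuous_on D f"
| "Ck_on (Suc k) S D f =
    ((\<forall>x\<in>D. f differentiable (at x within D)) \<and>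
     (\<forall>v\<in>S. Ck_on k S D (\<lambda>x. frechet_derivative f (at x within D) v)))"

definition smooth_on :: "'a::real_normed_vector set \<Rightarrow> 'a set \<Rightarrow> ('a \<Rightarrow> 'b::real_normed_vector) \<Rightarrow> bool" where
  "smooth_on S D f \<longleftrightarrow> (\<forall>k. Ck_on k S D f)"

text \<open>
  The manifold is the whole type \<open>'m\<close>. Charts take values in a linear subspace \<open>model\<close> of a Euclidean
  space, whose dimension is the dimension of the manifold; a proper subspace is allowed because types
  of class \<open>euclidean_space\<close> have positive dimension, so that manifolds of dimension 0 are included.
\<close>

record ('m, 'e) manifold =
  model :: "'e set"
  atlas :: "('m set \<times> ('m \<Rightarrow> 'e)) set"

definition smooth_manifold ::
    "('m::{t2_space,second_countable_topology}, 'e::euclidean_space) manifold \<Rightarrow> bool" where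
  "smooth_manifold M \<longleftrightarrow>
     subspace (model M) \<and>
     (\<Union>(U, c)\<in>atlas M. U) = UNIV \<and>
     (\<forall>(U, c)\<in>atlas M. open U \<and> openin (top_of_set (model M)) (c ` U) \<and>
        homeomorphism U (c ` U) c (inv_into U c)) \<and>
     (\<forall>(U, c)\<in>atlas M. \<forall>(V, d)\<in>atlas M.
        smooth_on (model M) (c ` (U \<inter> V)) (d \<circ> inv_into U c))"

definition smooth_fun_on ::
    "('m, 'e::euclidean_space) manifold \<Rightarrow> 'm set \<Rightarrow> ('m \<Rightarrow> real) \<Rightarrow> bool" where
  "smooth_fun_on M V f \<longleftrightarrow>
     (\<forall>(U, c)\<in>atlas M. smooth_on (model M) (c ` (U \<inter> V)) (f \<circ> inv_into U c))"

text \<open>Smoothness of \<open>(p, t) \<mapsto> F p t\<close> on \<open>V \<times> [0,1]\<close>.\<close>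

definition smooth_family_on ::
    "('m, 'e::euclidean_space) manifold \<Rightarrow> 'm set \<Rightarrow> ('m \<Rightarrow> real \<Rightarrow> real) \<Rightarrow> bool" where
  "smooth_family_on M V F \<longleftrightarrow>
     (\<forall>(U, c)\<in>atlas M.
        smooth_on (model M \<times> UNIV) (c ` (U \<inter> V) \<times> {0..1}) (\<lambda>(x, t). F (inv_into U c x) t))"

definition Cinf :: "('m, 'e::euclidean_space) manifold \<Rightarrow> ('m \<Rightarrow> real) set" where
  "Cinf M = {f. smooth_fun_on M UNIV f}"

definition smooth_map_on ::
    "('m, 'e::euclidean_space) manifold \<Rightarrow> 'm set \<Rightarrow> ('m \<Rightarrow> 'm) \<Rightarrow> bool" where
  "smooth_map_on M U \<gamma> \<longleftrightarrow> (\<forall>f\<in>Cinf M. smooth_fun_on M U (f \<circ> \<gamma>))"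


section \<open>Tangent and cotangent vectors, Cartan calculus\<close>

text \<open>
  Tangent vectors at \<open>m\<close> are the derivations at \<open>m\<close> of the algebra of smooth functions, covectors the
  linear functionals on the tangent space. Both are total functions extended by zero, so that
  equality of (co)vectors is equality of functions.
\<close>

type_synonym 'm tvec = "('m \<Rightarrow> real) \<Rightarrow> real"
type_synonym 'm covec = "'m tvec \<Rightarrow> real"

definition tangent_space :: "('m, 'e::euclidean_space) manifold \<Rightarrow> 'm \<Rightarrow> 'm tvec set" where
  "tangent_space M m = {v.
     (\<forall>f. f \<notin> Cinf M \<longrightarrow> v f = 0) \<and>
     (\<forall>f\<in>Cinf M. \<forall>g\<in>Cinf M. \<forall>a b. v (\<lambda>p. a * f p + b * g p) = a * v f + b * v g) \<and>
     (\<forall>f\<in>Cinf M. \<forall>g\<in>Cinf M. v (\<lambda>p. f p * g p) = f m * v g + g m * v f)}"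

definition cotangent_space :: "('m, 'e::euclidean_space) manifold \<Rightarrow> 'm \<Rightarrow> 'm covec set" where
  "cotangent_space M m = {\<alpha>.
     (\<forall>v. v \<notin> tangent_space M m \<longrightarrow> \<alpha> v = 0) \<and>
     (\<forall>u\<in>tangent_space M m. \<forall>v\<in>tangent_space M m. \<forall>a b.
        \<alpha> (\<lambda>f. a * u f + b * v f) = a * \<alpha> u + b * \<alpha> v)}"

definition vector_fields :: "('m, 'e::euclidean_space) manifold \<Rightarrow> ('m \<Rightarrow> 'm tvec) set" where
  "vector_fields M = {X. (\<forall>m. X m \<in> tangent_space M m) \<and> (\<forall>f\<in>Cinf M. (\<lambda>m. X m f) \<in> Cinf M)}"

definition lie_bracket :: "('m \<Rightarrow> 'm tvec) \<Rightarrow> ('m \<Rightarrow> 'm tvec) \<Rightarrow> 'm \<Rightarrow> 'm tvec" where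
  "lie_bracket X Y m = (\<lambda>f. X m (\<lambda>p. Y p f) - Y m (\<lambda>p. X p f))"

text \<open>
  \<open>(L\<^sub>X \<alpha>)(Y) = X(\<alpha>(Y)) - \<alpha>([X,Y])\<close> and \<open>d\<alpha>(X,Y) = X(\<alpha>(Y)) - Y(\<alpha>(X)) - \<alpha>([X,Y])\<close>; both are tensorial
  in the remaining arguments, whence their values on tangent vectors are obtained by extending these
  to vector fields.
\<close>

definition lie_derivative ::
    "('m, 'e::euclidean_space) manifold \<Rightarrow> ('m \<Rightarrow> 'm tvec) \<Rightarrow> ('m \<Rightarrow> 'm covec) \<Rightarrow> 'm \<Rightarrow> 'm covec" where
  "lie_derivative M X \<alpha> m v =
     (if v \<in> tangent_space M m then
        (THE r. \<forall>Y\<in>vector_fields M. Y m = v \<longrightarrow>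
           r = X m (\<lambda>p. \<alpha> p (Y p)) - \<alpha> m (lie_bracket X Y m))
      else 0)"

definition ext_deriv ::
    "('m, 'e::euclidean_space) manifold \<Rightarrow> ('m \<Rightarrow> 'm covec) \<Rightarrow> 'm \<Rightarrow> 'm tvec \<Rightarrow> 'm tvec \<Rightarrow> real" where
  "ext_deriv M \<alpha> m u v =
     (if u \<in> tangent_space M m \<and> v \<in> tangent_space M m then
        (THE r. \<forall>X\<in>vector_fields M. \<forall>Y\<in>vector_fields M. X m = u \<longrightarrow> Y m = v \<longrightarrow>
           r = X m (\<lambda>p. \<alpha> p (Y p)) - Y m (\<lambda>p. \<alpha> p (X p)) - \<alpha> m (lie_bracket X Y m))
      else 0)"

definition interior_d ::
    "('m, 'e::euclidean_space) manifold \<Rightarrow> ('m \<Rightarrow> 'm tvec) \<Rightarrow> ('m \<Rightarrow> 'm covec) \<Rightarrow> 'm \<Rightarrow> 'm covec" where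
  "interior_d M X \<alpha> m v = ext_deriv M \<alpha> m (X m) v"


section \<open>Vector bundles and Leibniz algebroids\<close>

definition reals_ring :: "real ring" where
  "reals_ring = \<lparr>carrier = UNIV, monoid.mult = (*), one = 1, zero = 0, add = (+)\<rparr>"

definition linear_map :: "(real, 'v, 'x) module_scheme \<Rightarrow> (real, 'w, 'y) module_scheme \<Rightarrow> ('v \<Rightarrow> 'w) \<Rightarrow> bool" where
  "linear_map V W h \<longleftrightarrow>
     (\<forall>x\<in>carrier V. h x \<in> carrier W) \<and>
     (\<forall>x\<in>carrier V. \<forall>y\<in>carrier V. h (x \<oplus>\<^bsub>V\<^esub> y) = h x \<oplus>\<^bsub>W\<^esub> h y) \<and>
     (\<forall>r. \<forall>x\<in>carrier V. h (r \<odot>\<^bsub>V\<^esub> x) = r \<odot>\<^bsub>W\<^esub> h x)"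

definition linear_iso :: "(real, 'v, 'x) module_scheme \<Rightarrow> (real, 'w, 'y) module_scheme \<Rightarrow> ('v \<Rightarrow> 'w) \<Rightarrow> bool" where
  "linear_iso V W h \<longleftrightarrow> linear_map V W h \<and> bij_betw h (carrier V) (carrier W)"

text \<open>
  The fibres may be infinite-dimensional. The smooth structure of a bundle \<open>E\<close> is recorded by
  \<open>lifts E U \<gamma>\<close>, the smooth maps from an open set \<open>U\<close> of the base into the total space that cover a
  smooth map \<open>\<gamma>\<close> from \<open>U\<close> to the base: \<open>\<gamma> = id\<close> gives the smooth local sections, and a constant \<open>\<gamma>\<close>
  the smooth functions on \<open>U\<close> with values in one fibre. Only the values of a lift on \<open>U\<close> matter.
\<close>

record ('m, 'v) vbundle =
  fibre :: "'m \<Rightarrow> (real, 'v) module"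
  lifts :: "'m set \<Rightarrow> ('m \<Rightarrow> 'm) \<Rightarrow> ('m \<Rightarrow> 'v) set"

definition sections :: "('m, 'v, 'x) vbundle_scheme \<Rightarrow> ('m \<Rightarrow> 'v) set" where
  "sections E = lifts E UNIV (\<lambda>p. p)"

definition local_trivialization ::
    "('m::topological_space, 'v, 'x) vbundle_scheme \<Rightarrow> 'm \<Rightarrow> 'm set \<Rightarrow> ('m \<Rightarrow> 'v \<Rightarrow> 'v) \<Rightarrow> bool" where
  "local_trivialization E m U \<psi> \<longleftrightarrow>
     open U \<and> m \<in> U \<and>
     (\<forall>p\<in>U. linear_iso (fibre E p) (fibre E m) (\<psi> p)) \<and>
     (\<forall>V w. open V \<longrightarrow> V \<subseteq> U \<longrightarrow> (\<forall>p\<in>V. w p \<in> carrier (fibre E p)) \<longrightarrow>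
        (w \<in> lifts E V (\<lambda>p. p) \<longleftrightarrow> (\<lambda>p. \<psi> p (w p)) \<in> lifts E V (\<lambda>p. m)))"

definition vector_bundle ::
    "('m::topological_space, 'e::euclidean_space) manifold \<Rightarrow> ('m, 'v, 'x) vbundle_scheme \<Rightarrow> bool" where
  "vector_bundle M E \<longleftrightarrow>
     (\<forall>m. Module.module reals_ring (fibre E m)) \<and>
     (\<forall>U \<gamma> w. open U \<longrightarrow> w \<in> lifts E U \<gamma> \<longrightarrow>
        smooth_map_on M U \<gamma> \<and> (\<forall>p\<in>U. w p \<in> carrier (fibre E (\<gamma> p)))) \<and>
     (\<forall>U \<gamma> w. open U \<longrightarrow>
        (w \<in> lifts E U \<gamma> \<longleftrightarrow>
         (\<forall>p\<in>U. \<exists>V w'. open V \<and> p \<in> V \<and> V \<subseteq> U \<and> w' \<in> lifts E V \<gamma> \<and> (\<forall>q\<in>V. w q = w' q)))) \<and>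
     (\<forall>U m e. open U \<longrightarrow> e \<in> carrier (fibre E m) \<longrightarrow> (\<lambda>p. e) \<in> lifts E U (\<lambda>p. m)) \<and>
     (\<forall>U \<gamma> w w'. open U \<longrightarrow> w \<in> lifts E U \<gamma> \<longrightarrow> w' \<in> lifts E U \<gamma> \<longrightarrow>
        (\<lambda>p. w p \<oplus>\<^bsub>fibre E (\<gamma> p)\<^esub> w' p) \<in> lifts E U \<gamma>) \<and>
     (\<forall>U \<gamma> w f. open U \<longrightarrow> w \<in> lifts E U \<gamma> \<longrightarrow> smooth_fun_on M U f \<longrightarrow>
        (\<lambda>p. f p \<odot>\<^bsub>fibre E (\<gamma> p)\<^esub> w p) \<in> lifts E U \<gamma>) \<and>
     (\<forall>m. \<exists>U \<psi>. local_trivialization E m U \<psi>)"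

record ('m, 'v) algebroid = "('m, 'v) vbundle" +
  anchor :: "'m \<Rightarrow> 'v \<Rightarrow> 'm tvec"
  bracket :: "('m \<Rightarrow> 'v) \<Rightarrow> ('m \<Rightarrow> 'v) \<Rightarrow> 'm \<Rightarrow> 'v"

definition smooth_anchor ::
    "('m::topological_space, 'e::euclidean_space) manifold \<Rightarrow> ('m, 'v, 'x) algebroid_scheme \<Rightarrow> bool" where
  "smooth_anchor M E \<longleftrightarrow>
     (\<forall>m. (\<forall>x\<in>carrier (fibre E m). anchor E m x \<in> tangent_space M m) \<and>
        (\<forall>x\<in>carrier (fibre E m). \<forall>y\<in>carrier (fibre E m).
           anchor E m (x \<oplus>\<^bsub>fibre E m\<^esub> y) = (\<lambda>f. anchor E m x f + anchor E m y f)) \<and>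
        (\<forall>r. \<forall>x\<in>carrier (fibre E m).
           anchor E m (r \<odot>\<^bsub>fibre E m\<^esub> x) = (\<lambda>f. r * anchor E m x f))) \<and>
     (\<forall>U \<gamma> w. open U \<longrightarrow> w \<in> lifts E U \<gamma> \<longrightarrow>
        (\<forall>f\<in>Cinf M. smooth_fun_on M U (\<lambda>p. anchor E (\<gamma> p) (w p) f)))"

text \<open>
  Left Leibniz algebroids: a bilinear bracket satisfying the left Leibniz identity, and the Leibniz
  rule \<open>[a, f b] = f [a, b] + \<rho>(a)(f) b\<close>.
\<close>

definition leibniz_algebroid ::
    "('m::topological_space, 'e::euclidean_space) manifold \<Rightarrow> ('m, 'v, 'x) algebroid_scheme \<Rightarrow> bool" where
  "leibniz_algebroid M E \<longleftrightarrow>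
     vector_bundle M E \<and> smooth_anchor M E \<and>
     (\<forall>a\<in>sections E. \<forall>b\<in>sections E. bracket E a b \<in> sections E) \<and>
     (\<forall>a\<in>sections E. \<forall>b\<in>sections E. \<forall>c\<in>sections E.
        bracket E (\<lambda>p. a p \<oplus>\<^bsub>fibre E p\<^esub> b p) c
          = (\<lambda>p. bracket E a c p \<oplus>\<^bsub>fibre E p\<^esub> bracket E b c p) \<and>
        bracket E a (\<lambda>p. b p \<oplus>\<^bsub>fibre E p\<^esub> c p)
          = (\<lambda>p. bracket E a b p \<oplus>\<^bsub>fibre E p\<^esub> bracket E a c p)) \<and>
     (\<forall>r. \<forall>a\<in>sections E. \<forall>b\<in>sections E.
        bracket E (\<lambda>p. r \<odot>\<^bsub>fibre E p\<^esub> a p) b = (\<lambda>p. r \<odot>\<^bsub>fibre E p\<^esub> bracket E a b p) \<and>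
        bracket E a (\<lambda>p. r \<odot>\<^bsub>fibre E p\<^esub> b p) = (\<lambda>p. r \<odot>\<^bsub>fibre E p\<^esub> bracket E a b p)) \<and>
     (\<forall>a\<in>sections E. \<forall>b\<in>sections E. \<forall>c\<in>sections E.
        bracket E a (bracket E b c)
          = (\<lambda>p. bracket E (bracket E a b) c p \<oplus>\<^bsub>fibre E p\<^esub> bracket E b (bracket E a c) p)) \<and>
     (\<forall>a\<in>sections E. \<forall>b\<in>sections E. \<forall>f\<in>Cinf M.
        bracket E a (\<lambda>p. f p \<odot>\<^bsub>fibre E p\<^esub> b p)
          = (\<lambda>p. (f p \<odot>\<^bsub>fibre E p\<^esub> bracket E a b p) \<oplus>\<^bsub>fibre E p\<^esub>
                 (anchor E p (a p) f \<odot>\<^bsub>fibre E p\<^esub> b p)))"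

definition subbundle :: "('m::topological_space, 'v, 'x) vbundle_scheme \<Rightarrow> ('m \<Rightarrow> 'v set) \<Rightarrow> bool" where
  "subbundle E J \<longleftrightarrow>
     (\<forall>m. submodule (J m) reals_ring (fibre E m)) \<and>
     (\<forall>m. \<exists>U \<psi>. local_trivialization E m U \<psi> \<and> (\<forall>p\<in>U. \<psi> p ` J p = J m))"

definition sub_sections :: "('m, 'v, 'x) vbundle_scheme \<Rightarrow> ('m \<Rightarrow> 'v set) \<Rightarrow> ('m \<Rightarrow> 'v) set" where
  "sub_sections E J = {s \<in> sections E. \<forall>p. s p \<in> J p}"

definition leibniz_subalgebroid ::
    "('m::topological_space, 'v, 'x) algebroid_scheme \<Rightarrow> ('m \<Rightarrow> 'v set) \<Rightarrow> bool" where
  "leibniz_subalgebroid E J \<longleftrightarrow>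
     subbundle E J \<and>
     (\<forall>a\<in>sub_sections E J. \<forall>b\<in>sub_sections E J. bracket E a b \<in> sub_sections E J)"

text \<open>The condition under which the anchor and the bracket of \<open>E\<close> descend to \<open>E/J\<close>.\<close>

definition leibniz_ideal ::
    "('m::topological_space, 'v, 'x) algebroid_scheme \<Rightarrow> ('m \<Rightarrow> 'v set) \<Rightarrow> bool" where
  "leibniz_ideal E J \<longleftrightarrow>
     leibniz_subalgebroid E J \<and>
     (\<forall>m. \<forall>x\<in>J m. anchor E m x = (\<lambda>f. 0)) \<and>
     (\<forall>a\<in>sections E. \<forall>b\<in>sub_sections E J.
        bracket E a b \<in> sub_sections E J \<and> bracket E b a \<in> sub_sections E J)"

abbreviation coset :: "('m, 'v, 'x) vbundle_scheme \<Rightarrow> ('m \<Rightarrow> 'v set) \<Rightarrow> 'm \<Rightarrow> 'v \<Rightarrow> 'v set" where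
  "coset E J m x \<equiv> J m +>\<^bsub>fibre E m\<^esub> x"

text \<open>
  The scalar multiple is a union of cosets since \<open>0\<close> times the elements of a coset do not form a coset.
  The fields \<open>mult\<close> and \<open>one\<close> play no role in a module.
\<close>

definition quotient_fibre :: "(real, 'v) module \<Rightarrow> 'v set \<Rightarrow> (real, 'v set) module" where
  "quotient_fibre V J =
     \<lparr>carrier = a_rcosets\<^bsub>V\<^esub> J, monoid.mult = undefined, one = undefined,
      zero = J, add = (\<lambda>C D. C <+>\<^bsub>V\<^esub> D),
      smult = (\<lambda>r C. \<Union>x\<in>C. J +>\<^bsub>V\<^esub> (r \<odot>\<^bsub>V\<^esub> x))\<rparr>"

text \<open>Smooth maps into a quotient bundle are the maps that lift locally to smooth maps.\<close>

definition quotient_algebroid ::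
    "('m::topological_space, 'v, 'x) algebroid_scheme \<Rightarrow> ('m \<Rightarrow> 'v set) \<Rightarrow> ('m, 'v set) algebroid" where
  "quotient_algebroid E J =
     \<lparr>fibre = (\<lambda>m. quotient_fibre (fibre E m) (J m)),
      lifts = (\<lambda>U \<gamma>. {w. \<forall>p\<in>U. \<exists>V w'. open V \<and> p \<in> V \<and> V \<subseteq> U \<and> w' \<in> lifts E V \<gamma> \<and>
                 (\<forall>q\<in>V. w q = coset E J (\<gamma> q) (w' q))}),
      anchor = (\<lambda>m C. the_elem (anchor E m ` C)),
      bracket = (\<lambda>\<sigma> \<tau> m. the_elem {coset E J m (bracket E a b m) | a b.
                   a \<in> sections E \<and> b \<in> sections E \<and>
                   \<sigma> = (\<lambda>p. coset E J p (a p)) \<and> \<tau> = (\<lambda>p. coset E J p (b p))})\<rparr>"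

definition leibniz_algebroid_iso ::
    "('m::topological_space, 'e::euclidean_space) manifold \<Rightarrow> ('m, 'v, 'x) algebroid_scheme \<Rightarrow>
     ('m, 'w, 'y) algebroid_scheme \<Rightarrow> ('m \<Rightarrow> 'v \<Rightarrow> 'w) \<Rightarrow> bool" where
  "leibniz_algebroid_iso M E F \<Phi> \<longleftrightarrow>
     leibniz_algebroid M E \<and> leibniz_algebroid M F \<and>
     (\<forall>m. linear_iso (fibre E m) (fibre F m) (\<Phi> m)) \<and>
     (\<forall>U \<gamma> w. open U \<longrightarrow> (\<forall>p\<in>U. w p \<in> carrier (fibre E (\<gamma> p))) \<longrightarrow>
        (w \<in> lifts E U \<gamma> \<longleftrightarrow> (\<lambda>p. \<Phi> (\<gamma> p) (w p)) \<in> lifts F U \<gamma>)) \<and>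
     (\<forall>m. \<forall>x\<in>carrier (fibre E m). anchor F m (\<Phi> m x) = anchor E m x) \<and>
     (\<forall>a\<in>sections E. \<forall>b\<in>sections E.
        bracket F (\<lambda>p. \<Phi> p (a p)) (\<lambda>p. \<Phi> p (b p)) = (\<lambda>p. \<Phi> p (bracket E a b p)))"

definition induced_map ::
    "('m \<Rightarrow> 'v \<Rightarrow> 'w) \<Rightarrow> 'm \<Rightarrow> 'v set \<Rightarrow> 'w" where
  "induced_map \<phi> m C = the_elem (\<phi> m ` C)"


section \<open>The standard Courant algebroid and the cotangent paths\<close>

type_synonym 'm gvec = "'m tvec \<times> 'm covec"

definition gzero :: "'m gvec" where
  "gzero = (\<lambda>f. 0, \<lambda>v. 0)"

definition gadd :: "'m gvec \<Rightarrow> 'm gvec \<Rightarrow> 'm gvec" where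
  "gadd x y = (\<lambda>f. fst x f + fst y f, \<lambda>v. snd x v + snd y v)"

definition gscale :: "real \<Rightarrow> 'm gvec \<Rightarrow> 'm gvec" where
  "gscale r x = (\<lambda>f. r * fst x f, \<lambda>v. r * snd x v)"

definition courant_fibre :: "('m, 'e::euclidean_space) manifold \<Rightarrow> 'm \<Rightarrow> (real, 'm gvec) module" where
  "courant_fibre M m =
     \<lparr>carrier = tangent_space M m \<times> cotangent_space M m,
      monoid.mult = undefined, one = undefined, zero = gzero, add = gadd, smult = gscale\<rparr>"

definition dorfman_bracket ::
    "('m, 'e::euclidean_space) manifold \<Rightarrow> ('m \<Rightarrow> 'm gvec) \<Rightarrow> ('m \<Rightarrow> 'm gvec) \<Rightarrow> 'm \<Rightarrow> 'm gvec" where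
  "dorfman_bracket M a b m =
     (let X = (\<lambda>p. fst (a p)); \<alpha> = (\<lambda>p. snd (a p)); Y = (\<lambda>p. fst (b p)); \<beta> = (\<lambda>p. snd (b p))
      in (lie_bracket X Y m, \<lambda>v. lie_derivative M X \<beta> m v - interior_d M Y \<alpha> m v))"

definition courant_algebroid ::
    "('m, 'e::euclidean_space) manifold \<Rightarrow> ('m, 'm gvec) algebroid" where
  "courant_algebroid M =
     \<lparr>fibre = courant_fibre M,
      lifts = (\<lambda>U \<gamma>. {w. smooth_map_on M U \<gamma> \<and>
         (\<forall>p\<in>U. w p \<in> carrier (courant_fibre M (\<gamma> p))) \<and>
         (\<forall>f\<in>Cinf M. smooth_fun_on M U (\<lambda>p. fst (w p) f)) \<and>
         (\<forall>Y\<in>vector_fields M. smooth_fun_on M U (\<lambda>p. snd (w p) (Y (\<gamma> p))))}),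
      anchor = (\<lambda>m x. fst x),
      bracket = dorfman_bracket M\<rparr>"

text \<open>
  Paths are parametrized by \<open>[0,1]\<close> and extended by zero to the real line. A path in the
  finite-dimensional spaces \<open>T\<^sub>mM\<close> and \<open>T\<^sub>m\<^sup>*M\<close> is smooth iff its pairings with the elements of the
  dual are, the dual of \<open>T\<^sub>mM\<close> consisting of the evaluations at smooth functions.
\<close>

type_synonym 'm gpath = "real \<Rightarrow> 'm gvec"

definition path_fibre :: "('m, 'e::euclidean_space) manifold \<Rightarrow> 'm \<Rightarrow> (real, 'm gpath) module" where
  "path_fibre M m =
     \<lparr>carrier = {x. (\<forall>t. t \<notin> {0..1} \<longrightarrow> x t = gzero) \<and>
         (\<forall>t\<in>{0..1}. fst (x t) \<in> tangent_space M m \<and> snd (x t) \<in> cotangent_space M m) \<and>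
         (\<forall>f\<in>Cinf M. smooth_on UNIV {0..1} (\<lambda>t. fst (x t) f)) \<and>
         (\<forall>v\<in>tangent_space M m. smooth_on UNIV {0..1} (\<lambda>t. snd (x t) v)) \<and>
         fst (x 0) = (\<lambda>f. 0)},
      monoid.mult = undefined, one = undefined,
      zero = (\<lambda>t. gzero), add = (\<lambda>x y t. gadd (x t) (y t)), smult = (\<lambda>r x t. gscale r (x t))\<rparr>"

definition path_integral :: "(real \<Rightarrow> 'm covec) \<Rightarrow> 'm covec" where
  "path_integral \<alpha> v = integral {0..1} (\<lambda>t. \<alpha> t v)"

definition path_velocity :: "(real \<Rightarrow> 'm tvec) \<Rightarrow> real \<Rightarrow> 'm tvec" where
  "path_velocity Y t f = vector_derivative (\<lambda>s. Y s f) (at t within {0..1})"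

definition path_bracket ::
    "('m, 'e::euclidean_space) manifold \<Rightarrow> ('m \<Rightarrow> 'm gpath) \<Rightarrow> ('m \<Rightarrow> 'm gpath) \<Rightarrow> 'm \<Rightarrow> 'm gpath" where
  "path_bracket M a b m t =
     (if t \<in> {0..1} then
        let X = (\<lambda>t p. fst (a p t)); \<alpha> = (\<lambda>t p. snd (a p t));
            Y = (\<lambda>t p. fst (b p t)); \<beta> = (\<lambda>t p. snd (b p t));
            Y' = (\<lambda>t p. path_velocity (\<lambda>s. Y s p) t)
        in (lie_bracket (X 1) (Y t) m,
            \<lambda>v. lie_derivative M (X 1) (\<beta> t) m v
                 - interior_d M (Y' t) (\<lambda>p. path_integral (\<lambda>s. \<alpha> s p)) m v)
      else gzero)"

definition cotangent_paths ::
    "('m, 'e::euclidean_space) manifold \<Rightarrow> ('m, 'm gpath) algebroid" where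
  "cotangent_paths M =
     \<lparr>fibre = path_fibre M,
      lifts = (\<lambda>U \<gamma>. {w. smooth_map_on M U \<gamma> \<and>
         (\<forall>p\<in>U. w p \<in> carrier (path_fibre M (\<gamma> p))) \<and>
         (\<forall>f\<in>Cinf M. smooth_family_on M U (\<lambda>p t. fst (w p t) f)) \<and>
         (\<forall>Y\<in>vector_fields M. smooth_family_on M U (\<lambda>p t. snd (w p t) (Y (\<gamma> p))))}),
      anchor = (\<lambda>m x. fst (x 1)),
      bracket = path_bracket M\<rparr>"

definition ev1_int :: "'m \<Rightarrow> 'm gpath \<Rightarrow> 'm gvec" where
  "ev1_int m x = (fst (x 1), path_integral (\<lambda>t. snd (x t)))"

definition kernel_paths :: "('m, 'e::euclidean_space) manifold \<Rightarrow> 'm \<Rightarrow> 'm gpath set" where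
  "kernel_paths M m =
     {x \<in> carrier (path_fibre M m). fst (x 1) = (\<lambda>f. 0) \<and> path_integral (\<lambda>t. snd (x t)) = (\<lambda>v. 0)}"

end

theory Submission
  imports Defs
begin

text \<open>
  On sections the map $\varphi = (\mathrm{ev}_1, \int_0^1)$ turns the bracket of cotangent paths into the Dorfman bracket.
  For the vector parts this is evaluation at \<open>t = 1\<close>. For the covector parts, the Lie derivative along the fixed vector field
  \<open>X\<^sub>1\<close> commutes with integration in time, and the integral of the contraction of $d\int\alpha$ with the velocity of \<open>Y\<close> is its
  contraction with \<open>Y\<^sub>1 - Y\<^sub>0 = Y\<^sub>1\<close> (lemma \<open>ev1_path_bracket\<close>). Moreover, $\varphi$ has the smooth linear right inverse
  \<open>(X, \<alpha>) \<mapsto> (t X, \<alpha>)\<close>, called \<open>split_path\<close>, and its kernel is \<open>I\<close>. Hence the cosets of \<open>I\<close> are the fibres of $\varphi$, the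
  induced map is bijective on fibres and on lifts, and it respects anchors and brackets.

  That all three objects are Leibniz algebroids has to be verified only for cotangent paths, since the other two are images of
  it under maps that are surjective on sections (\<open>leibniz_algebroid_image\<close>) and their bundle structure is pulled back
  (\<open>vector_bundle_pullback\<close>). There the Leibniz identity
  (\<open>path_bracket_leibniz\<close>) reduces to the relations \<open>[L\<^sub>X, L\<^sub>Y] = L\<^sub>[\<^sub>X\<^sub>,\<^sub>Y\<^sub>]\<close>, \<open>L\<^sub>X i\<^sub>W d = i\<^sub>[\<^sub>X\<^sub>,\<^sub>W\<^sub>] d + i\<^sub>W d L\<^sub>X\<close> and
  \<open>d i\<^sub>Y d = d L\<^sub>Y\<close> of Cartan calculus, together with the fact that a vector field commutes with the derivative in time.

  Vectors are derivations of the algebra of global smooth functions, and the operations of Cartan calculus are defined by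
  extending vectors to vector fields. Both become computable through local frames that consist of globally defined functions and
  vector fields (\<open>chart_frame_exists\<close>); their existence rests on bump functions and Hadamard's lemma. A functional on vector
  fields that is linear over the smooth functions depends only on the value at the point (\<open>tensorial\<close>), which gives the usual
  formulas for the Lie derivative and the exterior derivative. The frames also trivialize the bundles: transporting paths with
  fixed components in a frame commutes with $\varphi$ and so preserves the kernel.

  The analysis behind this concerns smooth families in space and time on a product with \<open>[0,1]\<close>: the chain rule for changes of
  charts, differentiation under the integral, and the symmetry of mixed derivatives in space and time (\<open>mixed_derivative\<close>).
\<close>


section \<open>Calculus of functions of class $C^k$ on thick domains\<close>

text \<open>
  A derivative within \<open>D\<close> is determined only in the directions in which \<open>D\<close> can be entered from the
  point. Thickness says that these directions span \<open>S\<close>. Half-open directions suffice, so that boundary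
  points of the unit interval qualify; open subsets of \<open>S\<close> and their products with \<open>[0,1]\<close> are thick.
\<close>

definition thick :: "'a::real_normed_vector set \<Rightarrow> 'a set \<Rightarrow> bool" where
  "thick S D \<longleftrightarrow> (\<forall>x\<in>D. S \<subseteq> span {u. \<exists>e>0. \<forall>s. 0 < s \<and> s < e \<longrightarrow> x + s *\<^sub>R u \<in> D})"

text \<open>
  Along a direction that enters \<open>D\<close> both maps give the one-sided derivative of the same function of
  one variable; by linearity they agree on the span of these directions.
\<close>

lemma thick_derivative_unique:
  assumes "thick S D" "x \<in> D" "v \<in> S"
    and f1: "(f has_derivative f1) (at x within D)" and f2: "(f has_derivative f2) (at x within D)"
  shows "f1 v = f2 v"
proof -
  have eq: "f1 u = f2 u" if "\<exists>e>0. \<forall>s. 0 < s \<and> s < e \<longrightarrow> x + s *\<^sub>R u \<in> D" for u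
  proof -
    obtain e where e: "e > 0" "\<And>s. 0 < s \<Longrightarrow> s < e \<Longrightarrow> x + s *\<^sub>R u \<in> D" using \<open>\<exists>e>0. _\<close> by blast
    let ?I = "{0..e/2}"
    have img: "(\<lambda>s. x + s *\<^sub>R u) ` ?I \<subseteq> D"
    proof (rule image_subsetI)
      fix s assume "s \<in> ?I"
      then show "x + s *\<^sub>R u \<in> D" using e \<open>x \<in> D\<close> by (cases "s = 0") auto
    qed
    have d: "((\<lambda>s. f (x + s *\<^sub>R u)) has_vector_derivative g u) (at 0 within ?I)"
      if "(f has_derivative g) (at x within D)" for g
    proof -
      have "((\<lambda>s. x + s *\<^sub>R u) has_derivative (\<lambda>s. s *\<^sub>R u)) (at 0 within ?I)"
        by (auto intro!: derivative_eq_intros)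
      moreover have "(f has_derivative g) (at (x + 0 *\<^sub>R u) within (\<lambda>s. x + s *\<^sub>R u) ` ?I)"
        using has_derivative_subset[OF that img] by simp
      ultimately have "((\<lambda>s. f (x + s *\<^sub>R u)) has_derivative (\<lambda>s. g (s *\<^sub>R u))) (at 0 within ?I)"
        using diff_chain_within[of "\<lambda>s. x + s *\<^sub>R u" "\<lambda>s. s *\<^sub>R u" 0 ?I f g] by (simp add: o_def)
      moreover have "g (s *\<^sub>R u) = s *\<^sub>R g u" for s
        using that by (simp add: has_derivative_def bounded_linear_def linear_scale)
      ultimately show ?thesis by (simp add: has_vector_derivative_def)
    qed
    \<comment> \<open>The interval is closed at \<open>0\<close>, where the curve is at \<open>x\<close>; so only the one-sided derivative is compared.\<close>
  have "at (0::real) within ?I \<noteq> bot"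
      using e by (simp add: trivial_limit_within islimpt_Icc)
    then show ?thesis using d[OF f1] d[OF f2] by (rule vector_derivative_unique_within)
  qed
  have lin: "linear (\<lambda>u. f1 u - f2 u)"
    using f1 f2 by (intro linear_compose_sub) (auto simp: has_derivative_def bounded_linear_def)
  have "f1 v - f2 v = 0"
  proof (rule linear_eq_0_on_span[OF lin])
    show "v \<in> span {u. \<exists>e>0. \<forall>s. 0 < s \<and> s < e \<longrightarrow> x + s *\<^sub>R u \<in> D}"
      using assms by (auto simp: thick_def)
  qed (use eq in auto)
  then show ?thesis by simp
qed

lemma thick_frechet_derivative:
  assumes "thick S D" "x \<in> D" "v \<in> S" "(f has_derivative f') (at x within D)"
  shows "frechet_derivative f (at x within D) v = f' v"
  using assms thick_derivative_unique[of S D x v f] by (metis differentiableI frechet_derivative_works)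

lemma thick_openin:
  assumes "subspace S" "openin (top_of_set S) D"
  shows "thick S D"
  unfolding thick_def
proof (intro ballI subsetI)
  fix x v assume x: "x \<in> D" and v: "v \<in> S"
  obtain e where e: "e > 0" "ball x e \<inter> S \<subseteq> D" and xS: "x \<in> S"
    using assms(2) x unfolding openin_contains_ball by blast
  have "x + s *\<^sub>R v \<in> D" if "0 < s" "s < e / (norm v + 1)" for s
  proof -
    have "s * norm v \<le> s * (norm v + 1)" using that by simp
    also have "\<dots> < e" using that pos_less_divide_eq[of "norm v + 1" s e] norm_ge_zero[of v] by linarith
    finally have "x + s *\<^sub>R v \<in> ball x e" using that by (simp add: dist_norm)
    moreover have "x + s *\<^sub>R v \<in> S" using assms(1) xS v by (simp add: subspace_add subspace_scale)
    ultimately show ?thesis using e by auto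
  qed
  moreover have "e / (norm v + 1) > 0" using e by (simp add: add_nonneg_pos)
  ultimately show "v \<in> span {u. \<exists>e>0. \<forall>s. 0 < s \<and> s < e \<longrightarrow> x + s *\<^sub>R u \<in> D}"
    by (intro span_base) blast
qed

lemma thick_Times_unit:
  assumes "thick S D"
  shows "thick (S \<times> UNIV) (D \<times> {0..1::real})"
  unfolding thick_def
proof (intro ballI subsetI)
  fix y w assume y: "y \<in> D \<times> {0..1::real}" and w: "w \<in> S \<times> (UNIV::real set)"
  obtain x t where [simp]: "y = (x, t)" and x: "x \<in> D" and t: "0 \<le> t" "t \<le> 1" using y by auto
  obtain v r where [simp]: "w = (v, r)" and v: "v \<in> S" using w by auto
  let ?U = "{u. \<exists>e>0. \<forall>s. 0 < s \<and> s < e \<longrightarrow> x + s *\<^sub>R u \<in> D}"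
  let ?W = "{u. \<exists>e>0. \<forall>s. 0 < s \<and> s < e \<longrightarrow> y + s *\<^sub>R u \<in> D \<times> {0..1}}"
  have "linear (\<lambda>u::'a. (u, 0::real))" by (auto intro!: linearI)
  from linear_span_image[OF this, of ?U] have "(v, 0::real) \<in> span ((\<lambda>u. (u, 0)) ` ?U)"
    using assms x v unfolding thick_def by blast
  also have "span ((\<lambda>u. (u, 0)) ` ?U) \<subseteq> span ?W"
  proof (rule span_mono, rule image_subsetI)
    fix u assume "u \<in> ?U"
    then show "(u, 0) \<in> ?W" using t by auto
  qed
  finally have 1: "(v, 0) \<in> span ?W" .
  have "(0, 1) \<in> span ?W"
  proof (cases "t < 1")
    case True
    then have "(0, 1) \<in> ?W" using x t by (auto intro!: exI[of _ "1 - t"])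
    then show ?thesis by (rule span_base)
  next
    case False
    then have "(0, -1) \<in> ?W" using x t by (auto intro!: exI[of _ 1])
    from span_neg[OF span_base[OF this]] show ?thesis by simp
  qed
  from span_add[OF 1 span_scale[OF this, of r]] show "w \<in> span ?W" by simp
qed

lemma thick_unit: "thick UNIV {0..1::real}"
  unfolding thick_def
proof (intro ballI subsetI)
  fix t r :: real assume t: "t \<in> {0..1}"
  let ?W = "{u. \<exists>e>0. \<forall>s. 0 < s \<and> s < e \<longrightarrow> t + s *\<^sub>R u \<in> {0..1}}"
  have "1 \<in> span ?W"
  proof (cases "t < 1")
    case True
    then have "1 \<in> ?W" using t by (auto intro!: exI[of _ "1 - t"])
    then show ?thesis by (rule span_base)
  next
    case False
    then have "-1 \<in> ?W" using t by (auto intro!: exI[of _ 1])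
    from span_neg[OF span_base[OF this]] show ?thesis by simp
  qed
  from span_scale[OF this, of r] show "r \<in> span ?W" by simp
qed

lemma frechet_derivative_within_cong:
  assumes "x \<in> D" "\<And>y. y \<in> D \<Longrightarrow> f y = g y"
  shows "frechet_derivative f (at x within D) = frechet_derivative g (at x within D)"
    and "f differentiable (at x within D) \<longleftrightarrow> g differentiable (at x within D)"
proof -
  have "(f has_derivative h) (at x within D) \<longleftrightarrow> (g has_derivative h) (at x within D)" for h
    using assms has_derivative_transform[of x D] by metis
  then show "frechet_derivative f (at x within D) = frechet_derivative g (at x within D)"
    "f differentiable (at x within D) \<longleftrightarrow> g differentiable (at x within D)"
    by (simp_all add: frechet_derivative_def differentiable_def)
qed

lemma Ck_on_cong:
  assumes "\<And>x. x \<in> D \<Longrightarrow> f x = g x"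
  shows "Ck_on k S D f \<longleftrightarrow> Ck_on k S D g"
  using assms
proof (induction k arbitrary: f g)
  case 0
  then show ?case by (simp cong: continuous_on_cong)
next
  case (Suc k)
  have "Ck_on k S D (\<lambda>x. frechet_derivative f (at x within D) v) \<longleftrightarrow>
        Ck_on k S D (\<lambda>x. frechet_derivative g (at x within D) v)" for v
    using frechet_derivative_within_cong(1)[of _ D f g] Suc.prems by (intro Suc.IH) auto
  moreover have "(\<forall>x\<in>D. f differentiable (at x within D)) \<longleftrightarrow> (\<forall>x\<in>D. g differentiable (at x within D))"
    using frechet_derivative_within_cong(2)[of _ D f g] Suc.prems by auto
  ultimately show ?case by simp
qed

lemma Ck_on_Suc_imp: "Ck_on (Suc k) S D f \<Longrightarrow> Ck_on k S D f"
proof (induction k arbitrary: f)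
  case 0
  then show ?case
    by (auto simp: continuous_on_eq_continuous_within intro!: differentiable_imp_continuous_within)
next
  case (Suc k)
  have a: "f differentiable (at x within D)" if "x \<in> D" for x using Suc.prems that by auto
  have b: "Ck_on (Suc k) S D (\<lambda>x. frechet_derivative f (at x within D) v)" if "v \<in> S" for v
    using Suc.prems that unfolding Ck_on.simps(2)[of "Suc k"] by blast
  show ?case unfolding Ck_on.simps(2)[of k] using a Suc.IH[OF b] by blast
qed

text \<open>
  The recursion for \<open>Ck_on\<close> speaks of an unspecified choice of the derivative. On a thick domain any
  explicit derivative may be used instead, because it agrees with the chosen one on \<open>S\<close>.
\<close>

lemma Ck_on_SucI:
  assumes "thick S D" "\<And>x. x \<in> D \<Longrightarrow> (f has_derivative f' x) (at x within D)"
    and "\<And>v. v \<in> S \<Longrightarrow> Ck_on k S D (\<lambda>x. f' x v)"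
  shows "Ck_on (Suc k) S D f"
proof -
  have "Ck_on k S D (\<lambda>x. frechet_derivative f (at x within D) v)" if "v \<in> S" for v
  proof (rule iffD1[OF Ck_on_cong assms(3)[OF that]])
    fix x assume "x \<in> D"
    then show "f' x v = frechet_derivative f (at x within D) v"
      using thick_frechet_derivative[OF assms(1) \<open>x \<in> D\<close> that assms(2)] by simp
  qed
  then show ?thesis using assms(2) by (auto simp: differentiable_def)
qed

lemma Ck_on_SucD:
  assumes "Ck_on (Suc k) S D f"
  shows "x \<in> D \<Longrightarrow> (f has_derivative frechet_derivative f (at x within D)) (at x within D)"
    and "v \<in> S \<Longrightarrow> Ck_on k S D (\<lambda>x. frechet_derivative f (at x within D) v)"
  using assms by (auto simp: frechet_derivative_works)

lemma at_within_Int_open: "x \<in> N \<Longrightarrow> open N \<Longrightarrow> at x within (D \<inter> N) = at x within D"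
  by (rule at_within_nhd[of _ N]) auto

lemma Ck_on_Int_open:
  assumes "open N" "Ck_on k S D f"
  shows "Ck_on k S (D \<inter> N) f"
  using assms(2)
proof (induction k arbitrary: f)
  case 0
  then show ?case by (auto intro: continuous_on_subset)
next
  case (Suc k)
  have "Ck_on k S (D \<inter> N) (\<lambda>x. frechet_derivative f (at x within (D \<inter> N)) v)" if "v \<in> S" for v
  proof (rule iffD1[OF Ck_on_cong Suc.IH])
    show "Ck_on k S D (\<lambda>x. frechet_derivative f (at x within D) v)" using Suc.prems that by auto
  qed (use assms(1) in \<open>simp add: at_within_Int_open\<close>)
  then show ?case using Suc.prems assms(1) by (auto simp: at_within_Int_open)
qed

text \<open>
  Derivatives within \<open>D\<close> and within a relatively open part of \<open>D\<close> are the same, so smoothness can be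
  checked near each point.
\<close>

lemma Ck_on_local:
  assumes "\<And>x. x \<in> D \<Longrightarrow> \<exists>N. open N \<and> x \<in> N \<and> Ck_on k S (D \<inter> N) f"
  shows "Ck_on k S D f"
  using assms
proof (induction k arbitrary: f)
  case 0
  show ?case unfolding Ck_on.simps continuous_on_eq_continuous_within
  proof
    fix x assume "x \<in> D"
    then obtain N where "open N" "x \<in> N" "continuous_on (D \<inter> N) f" using 0 by force
    then show "continuous (at x within D) f" using \<open>x \<in> D\<close>
      by (metis IntI at_within_Int_open continuous_on_eq_continuous_within)
  qed
next
  case (Suc k)
  have "Ck_on k S D (\<lambda>x. frechet_derivative f (at x within D) v)" if "v \<in> S" for v
  proof (rule Suc.IH)
    fix x assume "x \<in> D"
    then obtain N where N: "open N" "x \<in> N" "Ck_on (Suc k) S (D \<inter> N) f" using Suc.prems by blast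
    have "Ck_on k S (D \<inter> N) (\<lambda>x. frechet_derivative f (at x within D) v)"
    proof (rule iffD1[OF Ck_on_cong])
      show "Ck_on k S (D \<inter> N) (\<lambda>x. frechet_derivative f (at x within (D \<inter> N)) v)"
        using N(3) that by auto
    qed (use N in \<open>simp add: at_within_Int_open\<close>)
    then show "\<exists>N. open N \<and> x \<in> N \<and> Ck_on k S (D \<inter> N) (\<lambda>x. frechet_derivative f (at x within D) v)"
      using N by blast
  qed
  moreover have "f differentiable (at x within D)" if "x \<in> D" for x
  proof -
    obtain N where N: "open N" "x \<in> N" "Ck_on (Suc k) S (D \<inter> N) f" using Suc.prems \<open>x \<in> D\<close> by blast
    then show ?thesis using that by (auto simp: at_within_Int_open)
  qed
  ultimately show ?case by auto
qed

lemma Ck_on_const: "thick S D \<Longrightarrow> Ck_on k S D (\<lambda>x. c)"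
proof (induction k arbitrary: c)
  case (Suc k)
  show ?case by (rule Ck_on_SucI[where f' = "\<lambda>_ _. 0"]) (use Suc in auto)
qed auto

lemma Ck_on_bounded_linear: "thick S D \<Longrightarrow> bounded_linear h \<Longrightarrow> Ck_on k S D h"
proof (cases k)
  case (Suc k)
  assume "thick S D" "bounded_linear h"
  then show ?thesis unfolding Suc
    by (intro Ck_on_SucI[where f' = "\<lambda>_. h"] Ck_on_const) (auto intro: bounded_linear_imp_has_derivative)
qed (auto intro: linear_continuous_on)

lemma Ck_on_bounded_linear_comp:
  "thick S D \<Longrightarrow> bounded_linear h \<Longrightarrow> Ck_on k S D f \<Longrightarrow> Ck_on k S D (\<lambda>x. h (f x))"
proof (induction k arbitrary: f)
  case (Suc k)
  show ?case
    by (rule Ck_on_SucI[where f' = "\<lambda>x v. h (frechet_derivative f (at x within D) v)"])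
      (use Suc Ck_on_SucD[OF Suc.prems(3)] in \<open>auto intro: bounded_linear.has_derivative\<close>)
qed (auto intro: bounded_linear.continuous_on)

lemma Ck_on_add:
  "thick S D \<Longrightarrow> Ck_on k S D f \<Longrightarrow> Ck_on k S D g \<Longrightarrow> Ck_on k S D (\<lambda>x. f x + g x)"
proof (induction k arbitrary: f g)
  case (Suc k)
  show ?case
    by (rule Ck_on_SucI[where f' = "\<lambda>x v. frechet_derivative f (at x within D) v + frechet_derivative g (at x within D) v"])
      (use Suc Ck_on_SucD[OF Suc.prems(2)] Ck_on_SucD[OF Suc.prems(3)] in \<open>auto intro: has_derivative_add\<close>)
qed (auto intro: continuous_on_add)

lemma Ck_on_sum:
  "thick S D \<Longrightarrow> (\<And>i. i \<in> I \<Longrightarrow> Ck_on k S D (f i)) \<Longrightarrow> Ck_on k S D (\<lambda>x. \<Sum>i\<in>I. f i x)"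
  by (induction I rule: infinite_finite_induct) (auto intro!: Ck_on_add Ck_on_const)

lemma Ck_on_Pair:
  "thick S D \<Longrightarrow> Ck_on k S D f \<Longrightarrow> Ck_on k S D g \<Longrightarrow> Ck_on k S D (\<lambda>x. (f x, g x))"
proof (induction k arbitrary: f g)
  case (Suc k)
  show ?case
    by (rule Ck_on_SucI[where f' = "\<lambda>x v. (frechet_derivative f (at x within D) v, frechet_derivative g (at x within D) v)"])
      (use Suc Ck_on_SucD[OF Suc.prems(2)] Ck_on_SucD[OF Suc.prems(3)] in \<open>auto intro: has_derivative_Pair\<close>)
qed (auto intro: continuous_on_Pair)

lemma Ck_on_scaleR:
  fixes f :: "'a::real_normed_vector \<Rightarrow> real" and g :: "'a \<Rightarrow> 'b::real_normed_vector"
  shows "thick S D \<Longrightarrow> Ck_on k S D f \<Longrightarrow> Ck_on k S D g \<Longrightarrow> Ck_on k S D (\<lambda>x. f x *\<^sub>R g x)"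
proof (induction k arbitrary: f g)
  case (Suc k)
  show ?case
    by (rule Ck_on_SucI[where f' = "\<lambda>x v. f x *\<^sub>R frechet_derivative g (at x within D) v + frechet_derivative f (at x within D) v *\<^sub>R g x"])
      (use Suc Ck_on_SucD[OF Suc.prems(2)] Ck_on_SucD[OF Suc.prems(3)]
        Ck_on_Suc_imp[OF Suc.prems(2)] Ck_on_Suc_imp[OF Suc.prems(3)]
        in \<open>auto intro!: has_derivative_scaleR Ck_on_add\<close>)
qed (auto intro: continuous_on_scaleR)

lemma Ck_on_mult:
  fixes f g :: "'a::real_normed_vector \<Rightarrow> real"
  shows "thick S D \<Longrightarrow> Ck_on k S D f \<Longrightarrow> Ck_on k S D g \<Longrightarrow> Ck_on k S D (\<lambda>x. f x * g x)"
  using Ck_on_scaleR[of S D k f g] by simp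

text \<open>
  Orthonormal bases of a linear subspace, given with the expansion of a vector in coordinates, which is
  the form in which directional derivatives are summed.
\<close>

definition onb :: "'a::euclidean_space set \<Rightarrow> 'a set \<Rightarrow> bool" where
  "onb S B \<longleftrightarrow> finite B \<and> B \<subseteq> S \<and> (\<forall>b\<in>B. \<forall>c\<in>B. b \<bullet> c = (if b = c then 1 else 0)) \<and>
     (\<forall>y\<in>S. (\<Sum>b\<in>B. (y \<bullet> b) *\<^sub>R b) = y)"

lemma onb_exists: "subspace S \<Longrightarrow> \<exists>B. onb S B"
proof -
  assume "subspace S"
  then obtain B where B: "B \<subseteq> S" "pairwise orthogonal B" "\<And>x. x \<in> B \<Longrightarrow> norm x = 1"
    "independent B" "span B = S"
    using orthonormal_basis_subspace by metis
  have "finite B" using B(4) by (rule independent_imp_finite)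
  moreover have "b \<bullet> c = (if b = c then 1 else 0)" if "b \<in> B" "c \<in> B" for b c
    using B(2,3) that by (auto simp: pairwise_def orthogonal_def norm_eq_1)
  moreover have "(\<Sum>b\<in>B. (y \<bullet> b) *\<^sub>R b) = y" if "y \<in> S" for y
    using orthonormal_basis_expand[OF B(2,3)] B(5) that \<open>finite B\<close> by auto
  ultimately show ?thesis using B(1) unfolding onb_def by blast
qed

text \<open>
  The orthogonal projection to the complement of \<open>S\<close> kills \<open>g\<close>, hence it kills the derivative of \<open>g\<close>.
\<close>

lemma thick_derivative_in_subspace:
  fixes g :: "'a::real_normed_vector \<Rightarrow> 'b::euclidean_space"
  assumes "thick T D'" "x \<in> D'" "v \<in> T" "(g has_derivative g') (at x within D')"
    and "g ` D' \<subseteq> S" "onb S B"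
  shows "(\<Sum>b\<in>B. (g' v \<bullet> b) *\<^sub>R b) = g' v"
proof -
  \<comment> \<open>The projection to the orthogonal complement of \<open>S\<close>.\<close>
  let ?h = "\<lambda>y. y - (\<Sum>b\<in>B. (y \<bullet> b) *\<^sub>R b)"
  have "bounded_linear ?h"
    by (intro bounded_linear_sub bounded_linear_ident bounded_linear_sum
        bounded_linear_compose[OF bounded_linear_scaleR_left] bounded_linear_inner_left)
  from bounded_linear.has_derivative[OF this assms(4)]
  have 1: "((\<lambda>x. ?h (g x)) has_derivative (\<lambda>v. ?h (g' v))) (at x within D')" .
  have 2: "((\<lambda>x. ?h (g x)) has_derivative (\<lambda>v. 0)) (at x within D')"
  proof (rule has_derivative_transform[where f = "\<lambda>_. 0"])
    show "?h (g y) = 0" if "y \<in> D'" for y using assms(5,6) that by (auto simp: onb_def)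
  qed (use assms in auto)
  from thick_derivative_unique[OF assms(1-3) 1 2] show ?thesis by simp
qed

text \<open>
  By the chain rule the derivative of \<open>f \<circ> g\<close> in a direction \<open>v\<close> is the sum over an orthonormal basis of
  the components of \<open>g' v\<close> times the partial derivatives of \<open>f\<close> at \<open>g\<close>; these are composites of a function of
  class $C^k$ with \<open>g\<close>, so that induction on \<open>k\<close> applies. Only derivatives of \<open>f\<close> along \<open>S\<close> are controlled, whence
  \<open>g\<close> must map into \<open>S\<close>.
\<close>

lemma Ck_on_compose:
  fixes f :: "'a::euclidean_space \<Rightarrow> 'b::real_normed_vector" and g :: "'c::real_normed_vector \<Rightarrow> 'a"
  assumes "thick T D'" "subspace S" "D \<subseteq> S" "g ` D' \<subseteq> D"
  shows "Ck_on k S D f \<Longrightarrow> Ck_on k T D' g \<Longrightarrow> Ck_on k T D' (\<lambda>x. f (g x))"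
proof (induction k arbitrary: f)
  case 0
  then show ?case using assms(4) by (auto intro: continuous_on_compose2)
next
  case (Suc k)
  obtain B where B: "onb S B" using onb_exists[OF assms(2)] by blast
  let ?g = "\<lambda>x. frechet_derivative g (at x within D')"
  let ?f = "\<lambda>x. frechet_derivative f (at x within D)"
  have chain: "((\<lambda>x. f (g x)) has_derivative (\<lambda>v. ?f (g x) (?g x v))) (at x within D')" if "x \<in> D'" for x
  proof -
    have "(f has_derivative ?f (g x)) (at (g x) within g ` D')"
      using Ck_on_SucD(1)[OF Suc.prems(1)] assms(4) that has_derivative_subset by blast
    then show ?thesis
      using diff_chain_within[OF Ck_on_SucD(1)[OF Suc.prems(2) that]] by (simp add: o_def)
  qed
  have "Ck_on k T D' (\<lambda>x. ?f (g x) (?g x v))" if "v \<in> T" for v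
  proof (rule iffD1[OF Ck_on_cong])
    show "Ck_on k T D' (\<lambda>x. \<Sum>b\<in>B. (?g x v \<bullet> b) *\<^sub>R ?f (g x) b)"
    proof (intro Ck_on_sum Ck_on_scaleR assms(1))
      fix b assume b: "b \<in> B"
      show "Ck_on k T D' (\<lambda>x. ?g x v \<bullet> b)"
        by (rule Ck_on_bounded_linear_comp[OF assms(1) bounded_linear_inner_left])
          (rule Ck_on_SucD(2)[OF Suc.prems(2) that])
      have "b \<in> S" using b B by (auto simp: onb_def)
      show "Ck_on k T D' (\<lambda>x. ?f (g x) b)"
        by (rule Suc.IH[OF Ck_on_SucD(2)[OF Suc.prems(1) \<open>b \<in> S\<close>] Ck_on_Suc_imp[OF Suc.prems(2)]])
    qed
    fix x assume x: "x \<in> D'"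
    have lin: "linear (?f (g x))"
      using Ck_on_SucD(1)[OF Suc.prems(1), of "g x"] assms(4) x has_derivative_linear by blast
    have "?g x v = (\<Sum>b\<in>B. (?g x v \<bullet> b) *\<^sub>R b)"
      using thick_derivative_in_subspace[OF assms(1) x that Ck_on_SucD(1)[OF Suc.prems(2) x] _ B]
        assms(3,4) by auto
    then have "?f (g x) (?g x v) = ?f (g x) (\<Sum>b\<in>B. (?g x v \<bullet> b) *\<^sub>R b)" by simp
    also have "\<dots> = (\<Sum>b\<in>B. (?g x v \<bullet> b) *\<^sub>R ?f (g x) b)"
      by (simp add: linear_sum[OF lin] linear_scale[OF lin])
    finally show "(\<Sum>b\<in>B. (?g x v \<bullet> b) *\<^sub>R ?f (g x) b) = ?f (g x) (?g x v)" by simp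
  qed
  then show ?case by (intro Ck_on_SucI[OF assms(1) chain])
qed

lemma smooth_on_cong: "(\<And>x. x \<in> D \<Longrightarrow> f x = g x) \<Longrightarrow> smooth_on S D f \<longleftrightarrow> smooth_on S D g"
  unfolding smooth_on_def using Ck_on_cong[of D f g] by blast

lemma smooth_on_Int_open: "open N \<Longrightarrow> smooth_on S D f \<Longrightarrow> smooth_on S (D \<inter> N) f"
  unfolding smooth_on_def using Ck_on_Int_open by blast

lemma smooth_on_local:
  assumes "\<And>x. x \<in> D \<Longrightarrow> \<exists>N. open N \<and> x \<in> N \<and> smooth_on S (D \<inter> N) f"
  shows "smooth_on S D f"
  unfolding smooth_on_def
proof
  fix k show "Ck_on k S D f" by (rule Ck_on_local) (use assms in \<open>unfold smooth_on_def, blast\<close>)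
qed

lemma smooth_on_const: "thick S D \<Longrightarrow> smooth_on S D (\<lambda>x. c)"
  by (simp add: smooth_on_def Ck_on_const)

lemma smooth_on_bounded_linear: "thick S D \<Longrightarrow> bounded_linear h \<Longrightarrow> smooth_on S D h"
  by (simp add: smooth_on_def Ck_on_bounded_linear)

lemma smooth_on_bounded_linear_comp:
  "thick S D \<Longrightarrow> bounded_linear h \<Longrightarrow> smooth_on S D f \<Longrightarrow> smooth_on S D (\<lambda>x. h (f x))"
  by (simp add: smooth_on_def Ck_on_bounded_linear_comp)

lemma smooth_on_add:
  "thick S D \<Longrightarrow> smooth_on S D f \<Longrightarrow> smooth_on S D g \<Longrightarrow> smooth_on S D (\<lambda>x. f x + g x)"
  by (simp add: smooth_on_def Ck_on_add)

lemma smooth_on_Pair: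
  "thick S D \<Longrightarrow> smooth_on S D f \<Longrightarrow> smooth_on S D g \<Longrightarrow> smooth_on S D (\<lambda>x. (f x, g x))"
  by (simp add: smooth_on_def Ck_on_Pair)

lemma smooth_on_sum:
  "thick S D \<Longrightarrow> (\<And>i. i \<in> I \<Longrightarrow> smooth_on S D (f i)) \<Longrightarrow> smooth_on S D (\<lambda>x. \<Sum>i\<in>I. f i x)"
  by (simp add: smooth_on_def Ck_on_sum)

lemma smooth_on_scaleR:
  fixes f :: "'a::real_normed_vector \<Rightarrow> real" and g :: "'a \<Rightarrow> 'b::real_normed_vector"
  shows "thick S D \<Longrightarrow> smooth_on S D f \<Longrightarrow> smooth_on S D g \<Longrightarrow> smooth_on S D (\<lambda>x. f x *\<^sub>R g x)"
  by (simp add: smooth_on_def Ck_on_scaleR)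

lemma smooth_on_mult:
  fixes f g :: "'a::real_normed_vector \<Rightarrow> real"
  shows "thick S D \<Longrightarrow> smooth_on S D f \<Longrightarrow> smooth_on S D g \<Longrightarrow> smooth_on S D (\<lambda>x. f x * g x)"
  by (simp add: smooth_on_def Ck_on_mult)

lemma smooth_on_compose:
  fixes f :: "'a::euclidean_space \<Rightarrow> 'b::real_normed_vector" and g :: "'c::real_normed_vector \<Rightarrow> 'a"
  assumes "thick T D'" "subspace S" "D \<subseteq> S" "g ` D' \<subseteq> D" "smooth_on S D f" "smooth_on T D' g"
  shows "smooth_on T D' (\<lambda>x. f (g x))"
  using Ck_on_compose[OF assms(1-4), of _ f] assms(5,6) unfolding smooth_on_def by blast

lemma smooth_on_derivative:
  assumes "smooth_on S D f"
  shows "x \<in> D \<Longrightarrow> (f has_derivative frechet_derivative f (at x within D)) (at x within D)"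
    and "v \<in> S \<Longrightarrow> smooth_on S D (\<lambda>x. frechet_derivative f (at x within D) v)"
  using assms Ck_on_SucD[of 0 S D f] Ck_on_SucD[of _ S D f] unfolding smooth_on_def by blast+

lemma smooth_on_continuous: "smooth_on S D f \<Longrightarrow> continuous_on D f"
  unfolding smooth_on_def by (metis Ck_on.simps(1))


section \<open>Smooth step functions\<close>

lemma thick_open: "open D \<Longrightarrow> thick UNIV D"
  by (rule thick_openin) (simp_all add: subspace_UNIV open_openin[symmetric])

text \<open>
  The functions $t^{-n} e^{-1/t}$, extended by zero to $t \le 0$. All \<open>n\<close> are treated at once because the
  derivative of one of them is a combination of two others.
\<close>

definition flat_exp :: "nat \<Rightarrow> real \<Rightarrow> real" where
  "flat_exp n t = (if t > 0 then (1 / t) ^ n * exp (- (1 / t)) else 0)"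

lemma flat_exp_tendsto_0: "(flat_exp n \<longlongrightarrow> 0) (at 0)"
proof -
  have "((\<lambda>x. x ^ n / exp x) \<longlongrightarrow> (0::real)) at_top" by (rule tendsto_power_div_exp_0)
  from filterlim_compose[OF this filterlim_inverse_at_top_right]
  have "((\<lambda>t. inverse t ^ n / exp (inverse t)) \<longlongrightarrow> (0::real)) (at_right 0)" .
  moreover have "\<forall>\<^sub>F t in at_right 0. inverse t ^ n / exp (inverse t) = flat_exp n t"
    using eventually_at_right_less[of "0::real"]
    by eventually_elim (simp add: flat_exp_def exp_minus field_simps)
  ultimately have "(flat_exp n \<longlongrightarrow> 0) (at_right 0)" by (rule Lim_transform_eventually)
  moreover have "\<forall>\<^sub>F t in at_left (0::real). 0 = flat_exp n t"
    by (auto simp: eventually_at_filter flat_exp_def)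
  then have "(flat_exp n \<longlongrightarrow> 0) (at_left 0)" by (rule Lim_transform_eventually[OF tendsto_const])
  ultimately show ?thesis by (simp add: filterlim_split_at)
qed

text \<open>
  At zero the difference quotient of \<open>flat_exp n\<close> is \<open>flat_exp (n + 1)\<close>, which tends to zero.
\<close>

lemma flat_exp_derivative:
  "(flat_exp n has_real_derivative flat_exp (n + 2) t - real n * flat_exp (n + 1) t) (at t)"
proof -
  consider "t > 0" | "t < 0" | "t = 0" by linarith
  then show ?thesis
  proof cases
    case 1
    have d0: "((\<lambda>t. 1 / t) has_real_derivative - (1 / t) * (1 / t)) (at t)"
      using 1 by (auto intro!: derivative_eq_intros simp: field_simps)
    have "((\<lambda>t. (1 / t) ^ n) has_real_derivative real n * (- (1 / t) * (1 / t) * (1 / t) ^ (n - Suc 0))) (at t)"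
      by (rule DERIV_power[OF d0])
    moreover have "real n * (- (1 / t) * (1 / t) * (1 / t) ^ (n - Suc 0)) = - real n * (1 / t) ^ (n + 1)"
      using 1 by (cases n) (auto simp: field_simps)
    ultimately have d1: "((\<lambda>t. (1 / t) ^ n) has_real_derivative - real n * (1 / t) ^ (n + 1)) (at t)"
      by simp
    have d2: "((\<lambda>t. exp (- (1 / t))) has_real_derivative exp (- (1 / t)) * (- (- (1 / t) * (1 / t)))) (at t)"
      by (rule DERIV_fun_exp[OF DERIV_minus[OF d0]])
    have "((\<lambda>t. (1 / t) ^ n * exp (- (1 / t))) has_real_derivative
        flat_exp (n + 2) t - real n * flat_exp (n + 1) t) (at t)"
      using DERIV_mult[OF d1 d2] 1 by (simp add: flat_exp_def algebra_simps)
    moreover have "\<forall>\<^sub>F s in nhds t. (1 / s) ^ n * exp (- (1 / s)) = flat_exp n s"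
      using eventually_nhds_in_open[of "{0<..}" t] 1 by (auto simp: flat_exp_def elim: eventually_mono)
    ultimately show ?thesis by (simp add: DERIV_cong_ev)
  next
    case 2
    have "((\<lambda>t. 0) has_real_derivative 0) (at t)" by simp
    moreover have "\<forall>\<^sub>F s in nhds t. 0 = flat_exp n s"
      using eventually_nhds_in_open[of "{..<0}" t] 2 by (auto simp: flat_exp_def elim: eventually_mono)
    ultimately have "(flat_exp n has_real_derivative 0) (at t)" by (simp add: DERIV_cong_ev)
    then show ?thesis using 2 by (simp add: flat_exp_def)
  next
    case 3
    have "\<forall>\<^sub>F h in at 0. flat_exp (Suc n) h = (flat_exp n (0 + h) - flat_exp n 0) / h"
      by (auto simp: flat_exp_def eventually_at_filter)
    from Lim_transform_eventually[OF flat_exp_tendsto_0 this] show ?thesis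
      using 3 by (simp add: DERIV_def flat_exp_def)
  qed
qed

lemma Ck_on_flat_exp: "Ck_on k UNIV UNIV (flat_exp n)"
proof (induction k arbitrary: n)
  case 0
  have "isCont (flat_exp n) t" for t using flat_exp_derivative by (rule DERIV_isCont)
  then show ?case by (simp add: continuous_at_imp_continuous_on)
next
  case (Suc k)
  have th: "thick UNIV (UNIV::real set)" by (simp add: thick_open)
  show ?case
  proof (rule Ck_on_SucI[OF th])
    show "(flat_exp n has_derivative (\<lambda>v. (flat_exp (n + 2) t + (- real n) * flat_exp (n + 1) t) * v)) (at t)" for t
      using flat_exp_derivative[of n t] by (simp add: has_field_derivative_def)
    show "Ck_on k UNIV UNIV (\<lambda>t. (flat_exp (n + 2) t + (- real n) * flat_exp (n + 1) t) * v)" for v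
      by (intro Ck_on_mult Ck_on_add Ck_on_const th Suc)
  qed
qed

lemma smooth_on_inverse: "smooth_on UNIV (- {0}) (inverse :: real \<Rightarrow> real)"
  unfolding smooth_on_def
proof
  fix k
  have th: "thick UNIV (- {0::real})" by (intro thick_open) auto
  show "Ck_on k UNIV (- {0}) (inverse :: real \<Rightarrow> real)"
  proof (induction k)
    case 0
    then show ?case by (auto intro!: continuous_intros)
  next
    case (Suc k)
    show ?case
    proof (rule Ck_on_SucI[OF th])
      show "(inverse has_derivative (\<lambda>v. ((-1) * (inverse x * inverse x)) * v)) (at x within - {0})"
        if "x \<in> - {0}" for x :: real
        using that by (auto intro!: derivative_eq_intros)
      show "Ck_on k UNIV (- {0}) (\<lambda>x. ((-1) * (inverse x * inverse x)) * v)" for v :: real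
        by (intro Ck_on_mult Ck_on_const th Suc)
    qed
  qed
qed

text \<open>
  The quotient \<open>h (b - s) / (h (b - s) + h (s - a))\<close> with \<open>h = flat_exp 0\<close>: the denominator is positive since
  one of \<open>s < b\<close> and \<open>s > a\<close> always holds.
\<close>

lemma smooth_step_exists:
  fixes a b :: real
  assumes "a < b"
  shows "\<exists>\<rho>. smooth_on UNIV UNIV \<rho> \<and> (\<forall>s\<le>a. \<rho> s = 1) \<and> (\<forall>s\<ge>b. \<rho> s = (0::real))"
proof -
  have th: "thick UNIV (UNIV::real set)" by (simp add: thick_open)
  define h where "h = flat_exp 0"
  have h0: "h t = 0" if "t \<le> 0" for t using that by (simp add: h_def flat_exp_def)
  have hpos: "h t > 0" if "t > 0" for t using that by (simp add: h_def flat_exp_def)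
  have hnn: "h t \<ge> 0" for t using h0[of t] hpos[of t] by (cases "t > 0") auto
  have sh: "smooth_on UNIV UNIV h" by (simp add: h_def smooth_on_def Ck_on_flat_exp)
  let ?d = "\<lambda>s. h (b + (- 1) * s) + h ((- a) + s)"
  have d: "?d s > 0" for s
    using hpos[of "b - s"] hpos[of "s - a"] hnn[of "b - s"] hnn[of "s - a"] assms by (cases "s < b") auto
  let ?\<rho> = "\<lambda>s. h (b + (- 1) * s) * inverse (?d s)"
  have id: "smooth_on UNIV UNIV (\<lambda>s::real. s)"
    by (rule smooth_on_bounded_linear[OF th]) (rule bounded_linear_ident)
  have s1: "smooth_on UNIV UNIV (\<lambda>s. h (b + (- 1) * s))" "smooth_on UNIV UNIV (\<lambda>s. h ((- a) + s))"
    by (rule smooth_on_compose[OF th subspace_UNIV _ _ sh];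
        (intro subset_UNIV smooth_on_add smooth_on_mult smooth_on_const id th)?)+
  have "smooth_on UNIV UNIV ?\<rho>"
  proof (rule smooth_on_mult[OF th s1(1)])
    show "smooth_on UNIV UNIV (\<lambda>s. inverse (?d s))"
    proof (rule smooth_on_compose[OF th subspace_UNIV _ _ smooth_on_inverse])
      show "smooth_on UNIV UNIV ?d" by (intro smooth_on_add th s1)
      show "range ?d \<subseteq> - {0}" using d by (auto simp: less_le)
    qed auto
  qed
  moreover have "?\<rho> s = 1" if "s \<le> a" for s using that d[of s] h0[of "s - a"] by simp
  moreover have "?\<rho> s = 0" if "s \<ge> b" for s using that h0[of "b - s"] by simp
  ultimately show ?thesis by blast
qed


section \<open>Families depending on a parameter in the unit interval\<close>

text \<open>
  Differences of points of \<open>W\<close> lie in \<open>S\<close>, so a derivative within \<open>W\<close> may be replaced by its composite with the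
  orthogonal projection to \<open>S\<close>. This version involves only directions in \<open>S\<close>, where the derivatives of a
  smooth function depend continuously on the point.
\<close>

lemma has_derivative_onb:
  fixes f :: "'a::euclidean_space \<Rightarrow> real"
  assumes "subspace S" "onb S B" "W \<subseteq> S" "x \<in> W" "(f has_derivative f') (at x within W)"
  shows "(f has_derivative (\<lambda>v. \<Sum>b\<in>B. (v \<bullet> b) * f' b)) (at x within W)"
proof -
  have lin: "linear f'" using assms(5) by (rule has_derivative_linear)
  have eq: "f' (y - x) = (\<Sum>b\<in>B. ((y - x) \<bullet> b) * f' b)" if "y \<in> W" for y
  proof -
    have "y - x \<in> S" using assms(1,3,4) that by (auto intro: subspace_diff)
    then have "f' (y - x) = f' (\<Sum>b\<in>B. ((y - x) \<bullet> b) *\<^sub>R b)" using assms(2) by (simp add: onb_def)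
    also have "\<dots> = (\<Sum>b\<in>B. ((y - x) \<bullet> b) * f' b)" by (simp add: linear_sum[OF lin] linear_scale[OF lin])
    finally show ?thesis .
  qed
  have "bounded_linear (\<lambda>v. \<Sum>b\<in>B. (v \<bullet> b) * f' b)"
    by (intro bounded_linear_sum bounded_linear_compose[OF bounded_linear_mult_left] bounded_linear_inner_left)
  moreover have "((\<lambda>y. (1 / norm (y - x)) *\<^sub>R (f y - (f x + (\<Sum>b\<in>B. ((y - x) \<bullet> b) * f' b)))) \<longlongrightarrow> 0) (at x within W)"
    using assms(5) unfolding has_derivative_within
    by (elim conjE, elim Lim_transform_eventually) (auto simp: eventually_at_filter eq)
  ultimately show ?thesis unfolding has_derivative_within by blast
qed

lemma slice_has_derivative:
  assumes "smooth_on (S \<times> UNIV) (W \<times> {0..1::real}) F" "x \<in> W" "t \<in> {0..1}"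
  shows "((\<lambda>x. F (x, t)) has_derivative
    (\<lambda>v. frechet_derivative F (at (x, t) within W \<times> {0..1}) (v, 0))) (at x within W)"
proof -
  have "(F has_derivative frechet_derivative F (at (x, t) within W \<times> {0..1})) (at (x, t) within (\<lambda>x. (x, t)) ` W)"
    by (rule has_derivative_subset[OF smooth_on_derivative(1)[OF assms(1)]]) (use assms in auto)
  moreover have "((\<lambda>x. (x, t)) has_derivative (\<lambda>v. (v, 0))) (at x within W)"
    by (auto intro!: derivative_eq_intros)
  ultimately show ?thesis using diff_chain_within[of "\<lambda>x. (x, t)"] by (fastforce simp: o_def)
qed

lemma slice_has_vector_derivative:
  assumes "smooth_on (S \<times> UNIV) (W \<times> {0..1::real}) F" "x \<in> W" "t \<in> {0..1}"
  shows "((\<lambda>s. F (x, s)) has_vector_derivative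
    frechet_derivative F (at (x, t) within W \<times> {0..1}) (0, 1)) (at t within {0..1})"
proof -
  let ?d = "frechet_derivative F (at (x, t) within W \<times> {0..1})"
  have d: "(F has_derivative ?d) (at (x, t) within W \<times> {0..1})"
    using smooth_on_derivative(1)[OF assms(1)] assms by auto
  have "(F has_derivative ?d) (at (x, t) within (\<lambda>t. (x, t)) ` {0..1})"
    by (rule has_derivative_subset[OF d]) (use assms in auto)
  moreover have "((\<lambda>s. (x, s)) has_derivative (\<lambda>v. (0, v))) (at t within {0..1})"
    by (auto intro!: derivative_eq_intros)
  ultimately have "((\<lambda>s. F (x, s)) has_derivative (\<lambda>v. ?d (0, v))) (at t within {0..1})"
    using diff_chain_within[of "\<lambda>s. (x, s)"] by (fastforce simp: o_def)
  moreover have "(\<lambda>v. ?d (0, v)) = (\<lambda>v. v *\<^sub>R ?d (0, 1))"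
  proof
    show "?d (0, v) = v *\<^sub>R ?d (0, 1)" for v
      using linear_scale[OF has_derivative_linear[OF d], of v "(0, 1)"] by simp
  qed
  ultimately show ?thesis by (simp only: has_vector_derivative_def)
qed

lemma smooth_on_slice_continuous:
  assumes "smooth_on S' (W \<times> {0..1::real}) F" "x \<in> W" "{a..b} \<subseteq> {0..1}"
  shows "continuous_on {a..b} (\<lambda>t. F (x, t))"
  by (rule continuous_on_compose2[OF smooth_on_continuous[OF assms(1)]])
    (use assms in \<open>auto intro!: continuous_intros\<close>)

text \<open>
  Differentiation under the integral sign. The derivative of a slice is taken in the form of
  \<open>has_derivative_onb\<close>: in directions outside \<open>S\<close> the chosen derivatives need not depend measurably on \<open>t\<close>.
\<close>

lemma integral_has_derivative:
  fixes F :: "'a::euclidean_space \<times> real \<Rightarrow> real"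
  assumes S: "subspace S" "openin (top_of_set S) W" and B: "onb S B"
    and F: "smooth_on (S \<times> UNIV) (W \<times> {0..1}) F" and x: "x \<in> W" and ab: "{a..b} \<subseteq> {0..1}"
  shows "((\<lambda>x. integral {a..b} (\<lambda>t. F (x, t))) has_derivative
    (\<lambda>v. \<Sum>c\<in>B. (v \<bullet> c) * integral {a..b} (\<lambda>t. frechet_derivative F (at (x, t) within W \<times> {0..1}) (c, 0))))
    (at x within W)"
proof -
  let ?d = "\<lambda>x t. frechet_derivative F (at (x, t) within W \<times> {0..1})"
  have WS: "W \<subseteq> S" using S(2) by (simp add: openin_imp_subset)
  obtain e where e: "e > 0" "ball x e \<inter> S \<subseteq> W"
    using S(2) x unfolding openin_contains_ball by blast
  define U where "U = W \<inter> ball x e"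
  have U: "U = ball x e \<inter> S" using e WS by (auto simp: U_def)
  \<comment> \<open>Differentiating under the integral uses the mean value inequality on a convex domain, hence the restriction to a ball.\<close>
  have "convex U" unfolding U by (intro convex_Int convex_ball subspace_imp_convex S)
  define fx where "fx = (\<lambda>x t. \<Sum>c\<in>B. ?d x t (c, 0) *\<^sub>R blinfun_inner_left c)"
  have BS: "c \<in> S" if "c \<in> B" for c using B that by (auto simp: onb_def)
  have sm: "smooth_on (S \<times> UNIV) (W \<times> {0..1}) (\<lambda>z. frechet_derivative F (at z within W \<times> {0..1}) (c, 0))"
    if "c \<in> B" for c
    using smooth_on_derivative(2)[OF F] BS[OF that] by auto
  have cont_d: "continuous_on (W \<times> {0..1}) (\<lambda>(x, t). ?d x t (c, 0))" if "c \<in> B" for c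
    using smooth_on_continuous[OF sm[OF that]] by (simp add: case_prod_beta')
  have cont_t: "continuous_on {a..b} (\<lambda>t. ?d y t (c, 0))" if "y \<in> W" "c \<in> B" for y c
    using smooth_on_slice_continuous[OF sm[OF that(2)] that(1) ab] by simp
  have cfx: "continuous_on (W \<times> {a..b}) (\<lambda>(x, t). fx x t)"
    unfolding fx_def case_prod_beta'
    by (intro continuous_on_sum continuous_on_scaleR continuous_on_const
        continuous_on_subset[OF cont_d[unfolded case_prod_beta']]) (use ab in auto)
  have "((\<lambda>x. integral (cbox a b) (\<lambda>t. F (x, t))) has_derivative integral (cbox a b) (fx x)) (at x within U)"
  proof (rule leibniz_rule)
    fix y t assume y: "y \<in> U" and t: "t \<in> cbox a b"
    have "((\<lambda>x. F (x, t)) has_derivative (\<lambda>v. \<Sum>c\<in>B. (v \<bullet> c) * ?d y t (c, 0))) (at y within W)"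
      by (rule has_derivative_onb[OF S(1) B WS _ slice_has_derivative[OF F]]) (use y t ab in \<open>auto simp: U_def\<close>)
    then have "((\<lambda>x. F (x, t)) has_derivative (\<lambda>v. \<Sum>c\<in>B. (v \<bullet> c) * ?d y t (c, 0))) (at y within U)"
      by (rule has_derivative_subset) (simp add: U_def)
    moreover have "blinfun_apply (fx y t) = (\<lambda>v. \<Sum>c\<in>B. (v \<bullet> c) * ?d y t (c, 0))"
      by (auto simp: fx_def blinfun.sum_left blinfun.scaleR_left inner_commute mult.commute)
    ultimately show "((\<lambda>x. F (x, t)) has_derivative blinfun_apply (fx y t)) (at y within U)" by simp
  next
    fix y assume "y \<in> U"
    then show "(\<lambda>t. F (y, t)) integrable_on cbox a b"
      using smooth_on_slice_continuous[OF F _ ab] by (auto simp: U_def intro: integrable_continuous_real)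
  next
    show "continuous_on (U \<times> cbox a b) (\<lambda>(x, t). fx x t)"
      by (rule continuous_on_subset[OF cfx]) (auto simp: U_def)
  qed (use x e \<open>convex U\<close> in \<open>auto simp: U_def\<close>)
  moreover have "blinfun_apply (integral (cbox a b) (fx x)) =
      (\<lambda>v. \<Sum>c\<in>B. (v \<bullet> c) * integral {a..b} (\<lambda>t. ?d x t (c, 0)))"
  proof
    fix v
    have "fx x integrable_on cbox a b"
      unfolding fx_def box_real
      by (intro integrable_continuous_real continuous_on_sum continuous_on_scaleR continuous_on_const cont_t x)
    then have "blinfun_apply (integral (cbox a b) (fx x)) v = integral {a..b} (\<lambda>t. blinfun_apply (fx x t) v)"
      using blinfun_apply_integral by (simp add: blinfun_apply_integral)
    also have "\<dots> = integral {a..b} (\<lambda>t. \<Sum>c\<in>B. (v \<bullet> c) * ?d x t (c, 0))"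
      by (simp add: fx_def blinfun.sum_left blinfun.scaleR_left inner_commute mult.commute)
    also have "\<dots> = (\<Sum>c\<in>B. integral {a..b} (\<lambda>t. (v \<bullet> c) * ?d x t (c, 0)))"
      by (rule integral_sum) (use B in \<open>auto simp: onb_def intro!: integrable_continuous_real continuous_intros cont_t x\<close>)
    finally show "blinfun_apply (integral (cbox a b) (fx x)) v =
        (\<Sum>c\<in>B. (v \<bullet> c) * integral {a..b} (\<lambda>t. ?d x t (c, 0)))" by simp
  qed
  moreover have "at x within U = at x within W"
    unfolding U_def by (rule at_within_Int_open) (use e in auto)
  ultimately show ?thesis by simp
qed

lemma sum_onb_integral:
  fixes F :: "'a::euclidean_space \<times> real \<Rightarrow> real"
  assumes B: "onb S B" and v: "v \<in> S"
    and F: "smooth_on (S \<times> UNIV) (W \<times> {0..1}) F" and x: "x \<in> W" and ab: "{a..b} \<subseteq> {0..1}"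
  shows "(\<Sum>c\<in>B. (v \<bullet> c) * integral {a..b} (\<lambda>t. frechet_derivative F (at (x, t) within W \<times> {0..1}) (c, 0)))
    = integral {a..b} (\<lambda>t. frechet_derivative F (at (x, t) within W \<times> {0..1}) (v, 0))"
proof -
  let ?d = "\<lambda>x t. frechet_derivative F (at (x, t) within W \<times> {0..1})"
  have sm: "smooth_on (S \<times> UNIV) (W \<times> {0..1}) (\<lambda>z. frechet_derivative F (at z within W \<times> {0..1}) (c, 0))"
    if "c \<in> B" for c
    using smooth_on_derivative(2)[OF F] B that by (auto simp: onb_def)
  have cont_t: "continuous_on {a..b} (\<lambda>t. ?d x t (c, 0))" if "c \<in> B" for c
    using smooth_on_slice_continuous[OF sm[OF that] x ab] by simp
  have lin: "linear (?d x t)" if "t \<in> {a..b}" for t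
    using smooth_on_derivative(1)[OF F, of "(x, t)"] x ab that by (intro has_derivative_linear) auto
  have "?d x t (v, 0) = (\<Sum>c\<in>B. (v \<bullet> c) * ?d x t (c, 0))" if "t \<in> {a..b}" for t
  proof -
    have "(v, 0) = (\<Sum>c\<in>B. (v \<bullet> c) *\<^sub>R (c, 0::real))"
      using B v by (simp add: onb_def sum_prod[symmetric] prod_eq_iff fst_sum snd_sum)
    then show ?thesis by (simp add: linear_sum[OF lin[OF that]] linear_scale[OF lin[OF that]] del: scaleR_Pair)
  qed
  then have "integral {a..b} (\<lambda>t. ?d x t (v, 0)) = integral {a..b} (\<lambda>t. \<Sum>c\<in>B. (v \<bullet> c) * ?d x t (c, 0))"
    by (intro integral_cong) auto
  also have "\<dots> = (\<Sum>c\<in>B. integral {a..b} (\<lambda>t. (v \<bullet> c) * ?d x t (c, 0)))"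
    by (rule integral_sum) (use B in \<open>auto simp: onb_def intro!: integrable_continuous_real continuous_intros cont_t\<close>)
  finally show ?thesis by simp
qed

lemma smooth_on_integral:
  fixes F :: "'a::euclidean_space \<times> real \<Rightarrow> real"
  assumes S: "subspace S" "openin (top_of_set S) W" and F: "smooth_on (S \<times> UNIV) (W \<times> {0..1}) F"
  shows "smooth_on S W (\<lambda>x. integral {0..1} (\<lambda>t. F (x, t)))"
proof -
  obtain B where B: "onb S B" using onb_exists[OF S(1)] by blast
  note th = thick_openin[OF S]
  have "Ck_on k S W (\<lambda>x. integral {0..1} (\<lambda>t. F (x, t)))" for k
    using F
  proof (induction k arbitrary: F)
    case 0
    have "(\<lambda>x. integral {0..1} (\<lambda>t. F (x, t))) differentiable (at x within W)" if "x \<in> W" for x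
      using integral_has_derivative[OF S B 0 that, of 0 1] by (auto simp: differentiable_def)
    then show ?case
      by (auto simp: continuous_on_eq_continuous_within intro: differentiable_imp_continuous_within)
  next
    case (Suc k)
    show ?case
    proof (rule Ck_on_SucI[OF th integral_has_derivative[OF S B Suc.prems]])
      fix v assume "v \<in> S"
      show "Ck_on k S W (\<lambda>x. \<Sum>c\<in>B. (v \<bullet> c) * integral {0..1}
          (\<lambda>t. frechet_derivative F (at (x, t) within W \<times> {0..1}) (c, 0)))"
        by (intro Ck_on_sum Ck_on_mult Ck_on_const th Suc.IH smooth_on_derivative(2)[OF Suc.prems])
          (use B in \<open>auto simp: onb_def\<close>)
    qed auto
  qed
  then show ?thesis by (simp add: smooth_on_def)
qed

text \<open>
  The mixed second derivatives agree, also at the ends of the time interval. Writing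
  \<open>F (x, s) = F (x, 0) + \<integral>\<^sub>0\<^sup>s \<partial>\<^sub>t F (x, r) dr\<close> and differentiating under the integral in \<open>x\<close> exhibits \<open>\<partial>\<^sub>v F\<close> as a primitive
  of \<open>\<partial>\<^sub>v \<partial>\<^sub>t F\<close>.
\<close>

lemma mixed_derivative:
  fixes F :: "'a::euclidean_space \<times> real \<Rightarrow> real"
  assumes S: "subspace S" "openin (top_of_set S) W" and F: "smooth_on (S \<times> UNIV) (W \<times> {0..1}) F"
    and x: "x \<in> W" and t: "t \<in> {0..1}" and v: "v \<in> S"
  defines "G \<equiv> \<lambda>z. frechet_derivative F (at z within W \<times> {0..1}) (0, 1)"
  shows "((\<lambda>s. frechet_derivative F (at (x, s) within W \<times> {0..1}) (v, 0)) has_vector_derivative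
    frechet_derivative G (at (x, t) within W \<times> {0..1}) (v, 0)) (at t within {0..1})"
proof -
  obtain B where B: "onb S B" using onb_exists[OF S(1)] by blast
  let ?d = "\<lambda>F x t. frechet_derivative F (at (x, t) within W \<times> {0..1})"
  have G: "smooth_on (S \<times> UNIV) (W \<times> {0..1}) G"
    unfolding G_def by (rule smooth_on_derivative(2)[OF F]) (simp add: subspace_0[OF S(1)])
  have ftc: "F (y, s) = F (y, 0) + integral {0..s} (\<lambda>r. G (y, r))" if "y \<in> W" "s \<in> {0..1}" for y s
  proof -
    have "((\<lambda>r. G (y, r)) has_integral (F (y, s) - F (y, 0))) {0..s}"
    proof (rule fundamental_theorem_of_calculus)
      fix r assume "r \<in> {0..s}"
      then have "((\<lambda>s. F (y, s)) has_vector_derivative G (y, r)) (at r within {0..1})"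
        unfolding G_def using slice_has_vector_derivative[OF F that(1), of r] that by auto
      then show "((\<lambda>s. F (y, s)) has_vector_derivative G (y, r)) (at r within {0..s})"
        by (rule has_vector_derivative_within_subset) (use that in auto)
    qed (use that in auto)
    then show ?thesis by (simp add: integral_unique)
  qed
  have eq: "?d F x s (v, 0) = ?d F x 0 (v, 0) + integral {0..s} (\<lambda>r. ?d G x r (v, 0))" if s: "s \<in> {0..1}" for s
  proof -
    have s': "{0..s} \<subseteq> {0..1}" using s by auto
    have "((\<lambda>y. F (y, 0) + integral {0..s} (\<lambda>r. G (y, r))) has_derivative
       (\<lambda>v. ?d F x 0 (v, 0) + (\<Sum>c\<in>B. (v \<bullet> c) * integral {0..s} (\<lambda>r. ?d G x r (c, 0))))) (at x within W)"
      by (intro has_derivative_add slice_has_derivative[OF F x] integral_has_derivative[OF S B G x s']) auto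
    then have "((\<lambda>y. F (y, s)) has_derivative
       (\<lambda>v. ?d F x 0 (v, 0) + (\<Sum>c\<in>B. (v \<bullet> c) * integral {0..s} (\<lambda>r. ?d G x r (c, 0))))) (at x within W)"
      by (rule has_derivative_transform[rotated 2]) (use ftc[OF _ s] x in simp_all)
    from thick_derivative_unique[OF thick_openin[OF S] x v slice_has_derivative[OF F x s] this]
    show ?thesis using sum_onb_integral[OF B v G x s'] by simp
  qed
  have "continuous_on {0..1} (\<lambda>r. ?d G x r (v, 0))"
    using smooth_on_slice_continuous[OF smooth_on_derivative(2)[OF G, of "(v, 0)"] x] v by auto
  note ivd = integral_has_vector_derivative[OF this t]
  have "((\<lambda>s. ?d F x 0 (v, 0) + integral {0..s} (\<lambda>r. ?d G x r (v, 0))) has_vector_derivative ?d G x t (v, 0))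
     (at t within {0..1})"
    using has_vector_derivative_add[OF has_vector_derivative_const ivd] by simp
  then show ?thesis
    by (rule has_vector_derivative_transform[rotated 2]) (use t in \<open>simp_all add: eq[symmetric]\<close>)
qed


section \<open>Smooth functions and families on a manifold\<close>

locale mfd =
  fixes M :: "('m::{t2_space,second_countable_topology}, 'e::euclidean_space) manifold"
  assumes smooth_manifold: "smooth_manifold M"
begin

lemma subspace_model: "subspace (model M)"
  using smooth_manifold unfolding smooth_manifold_def by (elim conjE)

lemma chart_covers: "\<exists>U c. (U, c) \<in> atlas M \<and> p \<in> U"
proof -
  have "(\<Union>(U, c)\<in>atlas M. U) = UNIV" using smooth_manifold unfolding smooth_manifold_def by (elim conjE)
  then have "p \<in> (\<Union>(U, c)\<in>atlas M. U)" by simp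
  then show ?thesis by auto
qed

lemma chart_open: "(U, c) \<in> atlas M \<Longrightarrow> open U"
  and chart_image_openin: "(U, c) \<in> atlas M \<Longrightarrow> openin (top_of_set (model M)) (c ` U)"
  and chart_homeomorphism: "(U, c) \<in> atlas M \<Longrightarrow> homeomorphism U (c ` U) c (inv_into U c)"
proof -
  have "\<forall>(U, c)\<in>atlas M. open U \<and> openin (top_of_set (model M)) (c ` U) \<and>
        homeomorphism U (c ` U) c (inv_into U c)"
    using smooth_manifold unfolding smooth_manifold_def by (elim conjE)
  then show "(U, c) \<in> atlas M \<Longrightarrow> open U"
    "(U, c) \<in> atlas M \<Longrightarrow> openin (top_of_set (model M)) (c ` U)"
    "(U, c) \<in> atlas M \<Longrightarrow> homeomorphism U (c ` U) c (inv_into U c)"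
    by auto
qed

lemma transition_smooth:
  assumes "(U, c) \<in> atlas M" "(V, d) \<in> atlas M"
  shows "smooth_on (model M) (c ` (U \<inter> V)) (d \<circ> inv_into U c)"
proof -
  have "\<forall>(U, c)\<in>atlas M. \<forall>(V, d)\<in>atlas M. smooth_on (model M) (c ` (U \<inter> V)) (d \<circ> inv_into U c)"
    using smooth_manifold unfolding smooth_manifold_def by (elim conjE)
  then show ?thesis using assms by auto
qed

lemma chart_inverse: "(U, c) \<in> atlas M \<Longrightarrow> p \<in> U \<Longrightarrow> inv_into U c (c p) = p"
  using chart_homeomorphism homeomorphism_apply1 by metis

lemma chart_openin:
  assumes "(U, c) \<in> atlas M" "open V"
  shows "openin (top_of_set (model M)) (c ` (U \<inter> V))"
proof -
  have "openin (top_of_set U) (U \<inter> V)" using assms(2) by (rule openin_open_Int)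
  from homeomorphism_imp_open_map[OF chart_homeomorphism[OF assms(1)] this]
  show ?thesis using chart_image_openin[OF assms(1)] openin_trans by blast
qed

lemma chart_image_subset: "(U, c) \<in> atlas M \<Longrightarrow> p \<in> U \<Longrightarrow> c p \<in> model M"
  using chart_image_openin openin_imp_subset by blast

lemma thick_chart: "(U, c) \<in> atlas M \<Longrightarrow> open V \<Longrightarrow> thick (model M) (c ` (U \<inter> V))"
  by (rule thick_openin[OF subspace_model chart_openin])

lemma thick_chart_Times:
  "(U, c) \<in> atlas M \<Longrightarrow> open V \<Longrightarrow> thick (model M \<times> UNIV) (c ` (U \<inter> V) \<times> {0..1::real})"
  by (rule thick_Times_unit[OF thick_chart])

lemma subspace_model_Times: "subspace (model M \<times> (UNIV :: real set))"
  by (intro subspace_Times subspace_model subspace_UNIV)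

lemma chart_Times_subset:
  "(U, c) \<in> atlas M \<Longrightarrow> c ` (U \<inter> V) \<times> {0..1} \<subseteq> model M \<times> (UNIV :: real set)"
  using chart_image_subset by auto

lemma smooth_on_fst: "thick (S \<times> T) D \<Longrightarrow> smooth_on (S \<times> T) D fst"
  and smooth_on_snd: "thick (S \<times> T) D \<Longrightarrow> smooth_on (S \<times> T) D snd"
  by (auto intro: smooth_on_bounded_linear bounded_linear_fst bounded_linear_snd)

lemma family_chart:
  "smooth_family_on M V F \<Longrightarrow> (U, c) \<in> atlas M \<Longrightarrow>
    smooth_on (model M \<times> UNIV) (c ` (U \<inter> V) \<times> {0..1}) (\<lambda>(x, t). F (inv_into U c x) t)"
  by (auto simp: smooth_family_on_def)

lemma family_at:
  assumes "open V" "t \<in> {0..1}" "smooth_family_on M V F"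
  shows "smooth_fun_on M V (\<lambda>p. F p t)"
  unfolding smooth_fun_on_def
proof clarify
  fix U c assume A: "(U, c) \<in> atlas M"
  note th = thick_chart[OF A assms(1)]
  have F: "smooth_on (model M \<times> UNIV) (c ` (U \<inter> V) \<times> {0..1}) (\<lambda>(x, t). F (inv_into U c x) t)"
    using assms(3) A by (auto simp: smooth_family_on_def)
  have "smooth_on (model M) (c ` (U \<inter> V)) (\<lambda>x. (\<lambda>(x, t). F (inv_into U c x) t) (x, t))"
    by (rule smooth_on_compose[OF th subspace_model_Times chart_Times_subset[OF A] _ F])
      (use assms(2) smooth_on_Pair[OF th smooth_on_bounded_linear[OF th bounded_linear_ident] smooth_on_const[OF th]] in auto)
  then show "smooth_on (model M) (c ` (U \<inter> V)) ((\<lambda>p. F p t) \<circ> inv_into U c)" by (simp add: o_def)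
qed

lemma family_const:
  assumes "open V" "smooth_fun_on M V f"
  shows "smooth_family_on M V (\<lambda>p t. f p)"
  unfolding smooth_family_on_def
proof clarify
  fix U c assume A: "(U, c) \<in> atlas M"
  note th = thick_chart_Times[OF A assms(1)]
  have f: "smooth_on (model M) (c ` (U \<inter> V)) (f \<circ> inv_into U c)"
    using assms(2) A by (auto simp: smooth_fun_on_def)
  have "smooth_on (model M \<times> UNIV) (c ` (U \<inter> V) \<times> {0..1::real}) (\<lambda>x. (f \<circ> inv_into U c) (fst x))"
    by (rule smooth_on_compose[OF th subspace_model _ _ f smooth_on_fst[OF th]])
      (use chart_image_subset[OF A] in auto)
  then show "smooth_on (model M \<times> UNIV) (c ` (U \<inter> V) \<times> {0..1::real}) (\<lambda>(x, t). f (inv_into U c x))"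
    by (simp add: case_prod_beta')
qed

text \<open>
  Smooth functions are the smooth families that do not depend on time, so that the facts below need to be
  proved for families only.
\<close>

lemma smooth_fun_iff_family: "open V \<Longrightarrow> smooth_fun_on M V f \<longleftrightarrow> smooth_family_on M V (\<lambda>p t. f p)"
  using family_at[of V 0 "\<lambda>p t. f p"] family_const by auto

lemma family_cong:
  assumes "\<And>p t. p \<in> V \<Longrightarrow> t \<in> {0..1} \<Longrightarrow> F p t = G p t"
  shows "smooth_family_on M V F \<longleftrightarrow> smooth_family_on M V G"
proof -
  have "smooth_on (model M \<times> UNIV) (c ` (U \<inter> V) \<times> {0..1}) (\<lambda>(x, t). F (inv_into U c x) t) \<longleftrightarrow>
    smooth_on (model M \<times> UNIV) (c ` (U \<inter> V) \<times> {0..1}) (\<lambda>(x, t). G (inv_into U c x) t)"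
    if "(U, c) \<in> atlas M" for U c
    by (rule smooth_on_cong) (use chart_inverse[OF that] assms in auto)
  then show ?thesis unfolding smooth_family_on_def by blast
qed

lemma smooth_fun_cong:
  "open V \<Longrightarrow> (\<And>p. p \<in> V \<Longrightarrow> f p = g p) \<Longrightarrow> smooth_fun_on M V f \<longleftrightarrow> smooth_fun_on M V g"
  using family_cong[of V "\<lambda>p t. f p" "\<lambda>p t. g p"] by (simp add: smooth_fun_iff_family)

lemma family_subset:
  assumes "open V" "open W" "W \<subseteq> V" "smooth_family_on M V F"
  shows "smooth_family_on M W F"
  unfolding smooth_family_on_def
proof clarify
  fix U c assume A: "(U, c) \<in> atlas M"
  obtain N where N: "open N" "c ` (U \<inter> W) = model M \<inter> N"
    using chart_openin[OF A assms(2)] by (auto simp: openin_open)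
  have eq: "c ` (U \<inter> W) \<times> {0..1} = (c ` (U \<inter> V) \<times> {0..1::real}) \<inter> (N \<times> UNIV)"
  proof -
    have "c ` (U \<inter> W) = c ` (U \<inter> V) \<inter> N"
    proof
      show "c ` (U \<inter> W) \<subseteq> c ` (U \<inter> V) \<inter> N" using N(2) assms(3) by auto
      show "c ` (U \<inter> V) \<inter> N \<subseteq> c ` (U \<inter> W)" using N(2) chart_image_subset[OF A] by auto
    qed
    then show ?thesis by auto
  qed
  show "smooth_on (model M \<times> UNIV) (c ` (U \<inter> W) \<times> {0..1}) (\<lambda>(x, t). F (inv_into U c x) t)"
    unfolding eq by (rule smooth_on_Int_open)
      (use assms(4) A N(1) in \<open>auto simp: smooth_family_on_def intro: open_Times\<close>)
qed

lemma smooth_fun_subset: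
  "open V \<Longrightarrow> open W \<Longrightarrow> W \<subseteq> V \<Longrightarrow> smooth_fun_on M V f \<Longrightarrow> smooth_fun_on M W f"
  using family_subset[of V W "\<lambda>p t. f p"] by (simp add: smooth_fun_iff_family)

lemma family_local:
  assumes "open V" "\<And>p. p \<in> V \<Longrightarrow> \<exists>N. open N \<and> p \<in> N \<and> smooth_family_on M N F"
  shows "smooth_family_on M V F"
  unfolding smooth_family_on_def
proof clarify
  fix U c assume A: "(U, c) \<in> atlas M"
  show "smooth_on (model M \<times> UNIV) (c ` (U \<inter> V) \<times> {0..1}) (\<lambda>(x, t). F (inv_into U c x) t)"
  proof (rule smooth_on_local)
    fix z assume "z \<in> c ` (U \<inter> V) \<times> {0..1::real}"
    then obtain p t where p: "p \<in> U" "p \<in> V" and z: "z = (c p, t)" by auto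
    obtain N where N: "open N" "p \<in> N" "smooth_family_on M N F" using assms(2) p by blast
    have F: "smooth_family_on M (N \<inter> V) F"
      by (rule family_subset[OF N(1) _ _ N(3)]) (use N assms in auto)
    obtain O' where O: "open O'" "c ` (U \<inter> (N \<inter> V)) = model M \<inter> O'"
      using chart_openin[OF A, of "N \<inter> V"] N assms(1) by (auto simp: openin_open)
    have sub: "c ` (U \<inter> V) \<subseteq> model M" using chart_image_subset[OF A] by auto
    have "c ` (U \<inter> (N \<inter> V)) = c ` (U \<inter> V) \<inter> O'"
    proof
      show "c ` (U \<inter> (N \<inter> V)) \<subseteq> c ` (U \<inter> V) \<inter> O'" using O(2) by auto
      show "c ` (U \<inter> V) \<inter> O' \<subseteq> c ` (U \<inter> (N \<inter> V))" using O(2) sub by auto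
    qed
    then have eq: "c ` (U \<inter> (N \<inter> V)) \<times> {0..1} = (c ` (U \<inter> V) \<times> {0..1::real}) \<inter> (O' \<times> UNIV)" by auto
    have "smooth_on (model M \<times> UNIV) ((c ` (U \<inter> V) \<times> {0..1}) \<inter> (O' \<times> UNIV)) (\<lambda>(x, t). F (inv_into U c x) t)"
      using F A unfolding eq[symmetric] by (auto simp: smooth_family_on_def)
    moreover have "z \<in> O' \<times> UNIV" using p N O z by auto
    ultimately show "\<exists>N. open N \<and> z \<in> N \<and>
        smooth_on (model M \<times> UNIV) ((c ` (U \<inter> V) \<times> {0..1}) \<inter> N) (\<lambda>(x, t). F (inv_into U c x) t)"
      using open_Times[OF O(1) open_UNIV] by (intro exI[of _ "O' \<times> UNIV"] conjI)
  qed
qed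

lemma smooth_fun_local:
  assumes "open V" "\<And>p. p \<in> V \<Longrightarrow> \<exists>N. open N \<and> p \<in> N \<and> smooth_fun_on M N f"
  shows "smooth_fun_on M V f"
proof -
  have "smooth_family_on M V (\<lambda>p t. f p)"
    by (rule family_local[OF assms(1)]) (use assms(2) family_const in blast)
  then show ?thesis using assms(1) by (simp add: smooth_fun_iff_family)
qed

lemma family_add:
  assumes "open V" "smooth_family_on M V F" "smooth_family_on M V G"
  shows "smooth_family_on M V (\<lambda>p t. F p t + G p t)"
  unfolding smooth_family_on_def
proof clarify
  fix U c assume A: "(U, c) \<in> atlas M"
  show "smooth_on (model M \<times> UNIV) (c ` (U \<inter> V) \<times> {0..1}) (\<lambda>(x, t). F (inv_into U c x) t + G (inv_into U c x) t)"
    using smooth_on_add[OF thick_chart_Times[OF A assms(1)] family_chart[OF assms(2) A] family_chart[OF assms(3) A]]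
    by (simp add: case_prod_beta')
qed

lemma family_mult:
  assumes "open V" "smooth_family_on M V F" "smooth_family_on M V G"
  shows "smooth_family_on M V (\<lambda>p t. F p t * G p t)"
  unfolding smooth_family_on_def
proof clarify
  fix U c assume A: "(U, c) \<in> atlas M"
  show "smooth_on (model M \<times> UNIV) (c ` (U \<inter> V) \<times> {0..1}) (\<lambda>(x, t). F (inv_into U c x) t * G (inv_into U c x) t)"
    using smooth_on_mult[OF thick_chart_Times[OF A assms(1)] family_chart[OF assms(2) A] family_chart[OF assms(3) A]]
    by (simp add: case_prod_beta')
qed

lemma family_path:
  assumes "open V" "smooth_on UNIV {0..1} h"
  shows "smooth_family_on M V (\<lambda>p t. h t)"
  unfolding smooth_family_on_def
proof clarify
  fix U c assume A: "(U, c) \<in> atlas M"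
  note th = thick_chart_Times[OF A assms(1)]
  have "smooth_on (model M \<times> UNIV) (c ` (U \<inter> V) \<times> {0..1}) (\<lambda>z. h (snd z))"
    by (rule smooth_on_compose[OF th subspace_UNIV _ _ assms(2) smooth_on_snd[OF th]]) auto
  then show "smooth_on (model M \<times> UNIV) (c ` (U \<inter> V) \<times> {0..1}) (\<lambda>(x, t). h t)"
    by (simp add: case_prod_beta')
qed

lemma family_constant: "open V \<Longrightarrow> smooth_family_on M V (\<lambda>p t. r)"
  by (rule family_path) (auto intro: smooth_on_const thick_unit)

lemma family_time: "open V \<Longrightarrow> smooth_family_on M V (\<lambda>p t. t)"
  by (rule family_path) (auto intro: smooth_on_bounded_linear thick_unit bounded_linear_ident)

lemma family_sum:
  "open V \<Longrightarrow> (\<And>i. i \<in> I \<Longrightarrow> smooth_family_on M V (F i)) \<Longrightarrow> smooth_family_on M V (\<lambda>p t. \<Sum>i\<in>I. F i p t)"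
  by (induction I rule: infinite_finite_induct) (auto intro!: family_add family_constant)

lemma family_diff:
  "open V \<Longrightarrow> smooth_family_on M V F \<Longrightarrow> smooth_family_on M V G \<Longrightarrow> smooth_family_on M V (\<lambda>p t. F p t - G p t)"
  using family_add[of V F "\<lambda>p t. (-1) * G p t"] family_mult[of V "\<lambda>p t. -1" G] family_constant[of V "-1"]
  by simp

lemma smooth_fun_constant: "open V \<Longrightarrow> smooth_fun_on M V (\<lambda>p. r)"
  by (simp add: smooth_fun_iff_family family_constant)

lemma smooth_fun_add:
  "open V \<Longrightarrow> smooth_fun_on M V f \<Longrightarrow> smooth_fun_on M V g \<Longrightarrow> smooth_fun_on M V (\<lambda>p. f p + g p)"
  by (simp add: smooth_fun_iff_family family_add)

lemma smooth_fun_mult: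
  "open V \<Longrightarrow> smooth_fun_on M V f \<Longrightarrow> smooth_fun_on M V g \<Longrightarrow> smooth_fun_on M V (\<lambda>p. f p * g p)"
  by (simp add: smooth_fun_iff_family family_mult)

lemma smooth_fun_diff:
  "open V \<Longrightarrow> smooth_fun_on M V f \<Longrightarrow> smooth_fun_on M V g \<Longrightarrow> smooth_fun_on M V (\<lambda>p. f p - g p)"
  by (simp add: smooth_fun_iff_family family_diff)

lemma smooth_fun_sum:
  "open V \<Longrightarrow> (\<And>i. i \<in> I \<Longrightarrow> smooth_fun_on M V (f i)) \<Longrightarrow> smooth_fun_on M V (\<lambda>p. \<Sum>i\<in>I. f i p)"
  by (simp add: smooth_fun_iff_family family_sum)

text \<open>
  Smoothness need only be checked in one chart that contains the domain, since transition maps are smooth.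
\<close>

lemma family_of_chart:
  assumes A: "(U, c) \<in> atlas M" and V: "open V" "V \<subseteq> U"
    and F: "smooth_on (model M \<times> UNIV) (c ` V \<times> {0..1}) (\<lambda>(x, t). F (inv_into U c x) t)"
  shows "smooth_family_on M V F"
  unfolding smooth_family_on_def
proof clarify
  fix U' d assume A': "(U', d) \<in> atlas M"
  let ?D = "d ` (U' \<inter> V) \<times> {0..1::real}"
  note th = thick_chart_Times[OF A' V(1)]
  let ?g = "\<lambda>z. ((c \<circ> inv_into U' d) (fst z), snd z)"
  have tr: "smooth_on (model M \<times> UNIV) ?D (\<lambda>z. (c \<circ> inv_into U' d) (fst z))"
    by (rule smooth_on_compose[OF th subspace_model _ _ transition_smooth[OF A' A] smooth_on_fst[OF th]])
      (use chart_image_subset[OF A'] V(2) in auto)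
  have g: "smooth_on (model M \<times> UNIV) ?D ?g" by (intro smooth_on_Pair th tr smooth_on_snd)
  have "smooth_on (model M \<times> UNIV) ?D (\<lambda>z. (\<lambda>(x, t). F (inv_into U c x) t) (?g z))"
    by (rule smooth_on_compose[OF th subspace_model_Times _ _ F g])
      (use chart_image_subset[OF A] V(2) chart_inverse[OF A'] in auto)
  then show "smooth_on (model M \<times> UNIV) ?D (\<lambda>(x, t). F (inv_into U' d x) t)"
    by (rule iffD1[OF smooth_on_cong, rotated]) (use V(2) chart_inverse[OF A] chart_inverse[OF A'] in auto)
qed

lemma smooth_fun_of_chart:
  assumes A: "(U, c) \<in> atlas M" and V: "open V" "V \<subseteq> U"
    and f: "smooth_on (model M) (c ` V) (\<lambda>x. f (inv_into U c x))"
  shows "smooth_fun_on M V f"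
proof -
  have UV: "U \<inter> V = V" using V by auto
  have th: "thick (model M \<times> UNIV) (c ` V \<times> {0..1::real})" using thick_chart_Times[OF A V(1)] by (simp add: UV)
  have "smooth_on (model M \<times> UNIV) (c ` V \<times> {0..1::real}) (\<lambda>z. f (inv_into U c (fst z)))"
    by (rule smooth_on_compose[OF th subspace_model _ _ f smooth_on_fst[OF th]])
      (use chart_image_subset[OF A] V(2) in auto)
  then have "smooth_family_on M V (\<lambda>p t. f p)"
    by (intro family_of_chart[OF A V]) (simp add: case_prod_beta')
  then show ?thesis using V(1) by (simp add: smooth_fun_iff_family)
qed

lemma family_slice:
  assumes "open V" "smooth_family_on M V F" "p \<in> V"
  shows "smooth_on UNIV {0..1} (F p)"
proof -
  obtain U c where A: "(U, c) \<in> atlas M" "p \<in> U" using chart_covers by blast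
  have F: "smooth_on (model M \<times> UNIV) (c ` (U \<inter> V) \<times> {0..1}) (\<lambda>(x, t). F (inv_into U c x) t)"
    using assms(2) A by (auto simp: smooth_family_on_def)
  have "smooth_on UNIV {0..1} (\<lambda>t. (\<lambda>(x, t). F (inv_into U c x) t) (c p, t))"
    by (rule smooth_on_compose[OF thick_unit subspace_model_Times chart_Times_subset[OF A(1)] _ F])
      (use A assms(3) smooth_on_Pair[OF thick_unit smooth_on_const[OF thick_unit]
          smooth_on_bounded_linear[OF thick_unit bounded_linear_ident]] in auto)
  then show ?thesis using A chart_inverse by simp
qed

lemma family_integral:
  assumes "open V" "smooth_family_on M V F"
  shows "smooth_fun_on M V (\<lambda>p. integral {0..1} (F p))"
  unfolding smooth_fun_on_def
proof clarify
  fix U c assume A: "(U, c) \<in> atlas M"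
  have F: "smooth_on (model M \<times> UNIV) (c ` (U \<inter> V) \<times> {0..1}) (\<lambda>(x, t). F (inv_into U c x) t)"
    using assms(2) A by (auto simp: smooth_family_on_def)
  from smooth_on_integral[OF subspace_model chart_openin[OF A assms(1)] F]
  show "smooth_on (model M) (c ` (U \<inter> V)) ((\<lambda>p. integral {0..1} (F p)) \<circ> inv_into U c)"
    by (simp add: o_def)
qed

lemma unit_vector_derivative:
  assumes "(f has_vector_derivative d) (at t within {0..1::real})" "t \<in> {0..1}"
  shows "vector_derivative f (at t within {0..1}) = d"
  using assms vector_derivative_within_cbox[where a = 0 and b = "1::real" and f = f and f' = d and x = t]
  by (simp add: cbox_interval)

lemma family_slice_differentiable:
  assumes "open V" "smooth_family_on M V F" "p \<in> V" "t \<in> {0..1}"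
  shows "(F p has_vector_derivative vector_derivative (F p) (at t within {0..1})) (at t within {0..1})"
  using family_slice[OF assms(1-3)] assms(4) vector_derivative_works
  by (metis differentiable_def smooth_on_derivative(1))

lemma family_velocity:
  assumes "open V" "smooth_family_on M V F"
  shows "smooth_family_on M V (\<lambda>p t. vector_derivative (F p) (at t within {0..1}))"
  unfolding smooth_family_on_def
proof clarify
  fix U c assume A: "(U, c) \<in> atlas M"
  let ?D = "c ` (U \<inter> V) \<times> {0..1::real}"
  let ?F = "\<lambda>(x, t). F (inv_into U c x) t"
  have F: "smooth_on (model M \<times> UNIV) ?D ?F"
    using assms(2) A by (auto simp: smooth_family_on_def)
  have "smooth_on (model M \<times> UNIV) ?D (\<lambda>z. frechet_derivative ?F (at z within ?D) (0, 1))"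
    by (rule smooth_on_derivative(2)[OF F]) (simp add: subspace_0[OF subspace_model])
  then show "smooth_on (model M \<times> UNIV) ?D
      (\<lambda>(x, t). vector_derivative (F (inv_into U c x)) (at t within {0..1}))"
  proof (rule iffD1[OF smooth_on_cong, rotated])
    fix z assume "z \<in> ?D"
    then obtain x t where z: "z = (x, t)" "x \<in> c ` (U \<inter> V)" "t \<in> {0..1}" by auto
    show "frechet_derivative ?F (at z within ?D) (0, 1) =
      (case z of (x, t) \<Rightarrow> vector_derivative (F (inv_into U c x)) (at t within {0..1}))"
      using unit_vector_derivative[OF slice_has_vector_derivative[OF F z(2,3)] z(3)] z(1) by simp
  qed
qed

end


section \<open>Partial derivatives in a chart\<close>

definition chart_partial :: "'m set \<Rightarrow> ('m \<Rightarrow> 'e::real_normed_vector) \<Rightarrow> 'e \<Rightarrow> ('m \<Rightarrow> real) \<Rightarrow> 'm \<Rightarrow> real" where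
  "chart_partial U c b f p = frechet_derivative (f \<circ> inv_into U c) (at (c p) within c ` U) b"

context mfd
begin

lemma at_within_chart:
  assumes A: "(U, c) \<in> atlas M" and V: "open V" and p: "p \<in> U" "p \<in> V"
  shows "at (c p) within c ` (U \<inter> V) = at (c p) within c ` U"
proof -
  obtain N where N: "open N" "c ` (U \<inter> V) = model M \<inter> N"
    using chart_openin[OF A V] by (auto simp: openin_open)
  have "c ` (U \<inter> V) = c ` U \<inter> N" using N(2) chart_image_subset[OF A] by blast
  moreover have "c p \<in> N" using N(2) p by blast
  ultimately show ?thesis using at_within_Int_open[OF _ N(1)] by simp
qed

lemma chart_partial_has_derivative:
  assumes A: "(U, c) \<in> atlas M" and V: "open V" and p: "p \<in> U" "p \<in> V" and f: "smooth_fun_on M V f"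
  shows "((f \<circ> inv_into U c) has_derivative (\<lambda>b. chart_partial U c b f p)) (at (c p) within c ` U)"
proof -
  have "smooth_on (model M) (c ` (U \<inter> V)) (f \<circ> inv_into U c)"
    using f A by (auto simp: smooth_fun_on_def)
  from smooth_on_derivative(1)[OF this, of "c p"] show ?thesis
    using p unfolding at_within_chart[OF A V p] chart_partial_def by auto
qed

text \<open>
  Any derivative of the coordinate expression computes the partial derivative, as images of charts are
  thick.
\<close>

lemma chart_partial_unique:
  assumes A: "(U, c) \<in> atlas M" and V: "open V" and p: "p \<in> U" "p \<in> V" and b: "b \<in> model M"
    and f: "((f \<circ> inv_into U c) has_derivative f') (at (c p) within c ` (U \<inter> V))"
  shows "chart_partial U c b f p = f' b"
proof -
  have "thick (model M) (c ` U)" using thick_chart[OF A open_UNIV] by simp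
  from thick_frechet_derivative[OF this _ b, of "c p" "f \<circ> inv_into U c" f'] f p
  show ?thesis unfolding at_within_chart[OF A V p] chart_partial_def by simp
qed

lemma chart_partial_family:
  assumes A: "(U, c) \<in> atlas M" and V: "open V" and p: "p \<in> U" "p \<in> V" and b: "b \<in> model M"
    and F: "smooth_family_on M V F" and t: "t \<in> {0..1}"
  shows "chart_partial U c b (\<lambda>q. F q t) p =
    frechet_derivative (\<lambda>(x, t). F (inv_into U c x) t) (at (c p, t) within c ` (U \<inter> V) \<times> {0..1}) (b, 0)"
  using chart_partial_unique[OF A V p b, of "\<lambda>q. F q t"] slice_has_derivative[OF family_chart[OF F A], of "c p" t] p t
  by (simp add: o_def)

lemma family_chart_partial:
  assumes A: "(U, c) \<in> atlas M" and V: "open V" "V \<subseteq> U" and b: "b \<in> model M" and F: "smooth_family_on M V F"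
  shows "smooth_family_on M V (\<lambda>p t. chart_partial U c b (\<lambda>q. F q t) p)"
proof (rule family_of_chart[OF A V])
  have UV: "U \<inter> V = V" using V by auto
  let ?D = "c ` (U \<inter> V) \<times> {0..1::real}"
  let ?F = "\<lambda>(x, t). F (inv_into U c x) t"
  have "smooth_on (model M \<times> UNIV) ?D (\<lambda>z. frechet_derivative ?F (at z within ?D) (b, 0))"
    by (rule smooth_on_derivative(2)[OF family_chart[OF F A]]) (use b in auto)
  then have "smooth_on (model M \<times> UNIV) ?D (\<lambda>(x, t). chart_partial U c b (\<lambda>q. F q t) (inv_into U c x))"
    by (rule iffD1[OF smooth_on_cong, rotated])
      (use chart_partial_family[OF A V(1) _ _ b F] chart_inverse[OF A] in auto)
  then show "smooth_on (model M \<times> UNIV) (c ` V \<times> {0..1}) (\<lambda>(x, t). chart_partial U c b (\<lambda>q. F q t) (inv_into U c x))"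
    by (simp add: UV)
qed

lemma smooth_fun_chart_partial:
  assumes A: "(U, c) \<in> atlas M" and V: "open V" "V \<subseteq> U" and b: "b \<in> model M" and f: "smooth_fun_on M V f"
  shows "smooth_fun_on M V (chart_partial U c b f)"
  using family_chart_partial[OF A V b family_const[OF V(1) f]] V(1) by (simp add: smooth_fun_iff_family)

lemma chart_partial_integral:
  assumes A: "(U, c) \<in> atlas M" and V: "open V" and p: "p \<in> U" "p \<in> V" and b: "b \<in> model M"
    and F: "smooth_family_on M V F"
  shows "chart_partial U c b (\<lambda>q. integral {0..1} (F q)) p = integral {0..1} (\<lambda>t. chart_partial U c b (\<lambda>q. F q t) p)"
proof -
  obtain B where B: "onb (model M) B" using onb_exists[OF subspace_model] by blast
  let ?D = "c ` (U \<inter> V) \<times> {0..1::real}"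
  let ?F = "\<lambda>(x, t). F (inv_into U c x) t"
  note F' = family_chart[OF F A]
  have cp: "c p \<in> c ` (U \<inter> V)" using p by auto
  have "chart_partial U c b (\<lambda>q. integral {0..1} (F q)) p =
    (\<Sum>a\<in>B. (b \<bullet> a) * integral {0..1} (\<lambda>t. frechet_derivative ?F (at (c p, t) within ?D) (a, 0)))"
    by (rule chart_partial_unique[OF A V p b])
      (use integral_has_derivative[OF subspace_model chart_openin[OF A V] B F' cp, of 0 1] in \<open>simp add: o_def\<close>)
  also have "\<dots> = integral {0..1} (\<lambda>t. frechet_derivative ?F (at (c p, t) within ?D) (b, 0))"
    by (rule sum_onb_integral[OF B b F' cp]) simp
  also have "\<dots> = integral {0..1} (\<lambda>t. chart_partial U c b (\<lambda>q. F q t) p)"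
    by (rule integral_cong) (use chart_partial_family[OF A V p b F] in simp)
  finally show ?thesis .
qed

text \<open>
  Symmetry of mixed derivatives in space and time, read in a chart.
\<close>

lemma chart_partial_velocity:
  assumes A: "(U, c) \<in> atlas M" and V: "open V" and p: "p \<in> U" "p \<in> V" and b: "b \<in> model M"
    and F: "smooth_family_on M V F" and t: "t \<in> {0..1}"
  shows "((\<lambda>t. chart_partial U c b (\<lambda>q. F q t) p) has_vector_derivative
    chart_partial U c b (\<lambda>q. vector_derivative (F q) (at t within {0..1})) p) (at t within {0..1})"
proof -
  let ?D = "c ` (U \<inter> V) \<times> {0..1::real}"
  let ?F = "\<lambda>(x, t). F (inv_into U c x) t"
  let ?G = "\<lambda>z. frechet_derivative ?F (at z within ?D) (0, 1)"
  note F' = family_chart[OF F A]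
  have cp: "c p \<in> c ` (U \<inter> V)" using p by auto
  have G: "vector_derivative (F (inv_into U c x)) (at s within {0..1}) = ?G (x, s)"
    if "x \<in> c ` (U \<inter> V)" "s \<in> {0..1}" for x s
    using unit_vector_derivative[OF slice_has_vector_derivative[OF F' that] that(2)] by simp
  have smG: "smooth_on (model M \<times> UNIV) ?D ?G"
    by (rule smooth_on_derivative(2)[OF F']) (simp add: subspace_0[OF subspace_model])
  have "((\<lambda>q. vector_derivative (F q) (at t within {0..1})) \<circ> inv_into U c has_derivative
      (\<lambda>b. frechet_derivative ?G (at (c p, t) within ?D) (b, 0))) (at (c p) within c ` (U \<inter> V))"
    by (rule has_derivative_transform[OF cp _ slice_has_derivative[OF smG cp t]]) (use G t in simp)
  from chart_partial_unique[OF A V p b this]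
  have eq: "chart_partial U c b (\<lambda>q. vector_derivative (F q) (at t within {0..1})) p =
      frechet_derivative ?G (at (c p, t) within ?D) (b, 0)" .
  show ?thesis unfolding eq
    by (rule has_vector_derivative_transform[OF t _ mixed_derivative[OF subspace_model chart_openin[OF A V] F' cp t b]])
      (use chart_partial_family[OF A V p b F] in simp)
qed

lemma chart_partial_add:
  assumes A: "(U, c) \<in> atlas M" and V: "open V" and p: "p \<in> U" "p \<in> V" and b: "b \<in> model M"
    and f: "smooth_fun_on M V f" and g: "smooth_fun_on M V g"
  shows "chart_partial U c b (\<lambda>q. r * f q + s * g q) p = r * chart_partial U c b f p + s * chart_partial U c b g p"
  by (rule chart_partial_unique[OF A V p b])
    (use chart_partial_has_derivative[OF A V p f] chart_partial_has_derivative[OF A V p g]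
      in \<open>auto simp: at_within_chart[OF A V p] o_def intro!: derivative_eq_intros\<close>)

lemma chart_partial_mult:
  assumes A: "(U, c) \<in> atlas M" and V: "open V" and p: "p \<in> U" "p \<in> V" and b: "b \<in> model M"
    and f: "smooth_fun_on M V f" and g: "smooth_fun_on M V g"
  shows "chart_partial U c b (\<lambda>q. f q * g q) p = f p * chart_partial U c b g p + g p * chart_partial U c b f p"
proof -
  have "chart_partial U c b (\<lambda>q. f q * g q) p =
    (f \<circ> inv_into U c) (c p) * chart_partial U c b g p + chart_partial U c b f p * (g \<circ> inv_into U c) (c p)"
    by (rule chart_partial_unique[OF A V p b])
      (use has_derivative_mult[OF chart_partial_has_derivative[OF A V p f] chart_partial_has_derivative[OF A V p g]]
      in \<open>simp add: at_within_chart[OF A V p] o_def\<close>)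
  then show ?thesis using chart_inverse[OF A p(1)] by simp
qed


section \<open>Bump functions\<close>

lemma CinfI: "smooth_fun_on M UNIV f \<Longrightarrow> f \<in> Cinf M" and CinfD: "f \<in> Cinf M \<Longrightarrow> open V \<Longrightarrow> smooth_fun_on M V f"
  using smooth_fun_subset[of UNIV V f] by (auto simp: Cinf_def)

lemma Cinf_const [intro]: "(\<lambda>p. r) \<in> Cinf M"
  and Cinf_add [intro]: "f \<in> Cinf M \<Longrightarrow> g \<in> Cinf M \<Longrightarrow> (\<lambda>p. f p + g p) \<in> Cinf M"
  and Cinf_diff [intro]: "f \<in> Cinf M \<Longrightarrow> g \<in> Cinf M \<Longrightarrow> (\<lambda>p. f p - g p) \<in> Cinf M"
  and Cinf_mult [intro]: "f \<in> Cinf M \<Longrightarrow> g \<in> Cinf M \<Longrightarrow> (\<lambda>p. f p * g p) \<in> Cinf M"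
  by (simp_all add: Cinf_def smooth_fun_constant smooth_fun_add smooth_fun_diff smooth_fun_mult)

lemma Cinf_sum [intro]: "(\<And>i. i \<in> I \<Longrightarrow> f i \<in> Cinf M) \<Longrightarrow> (\<lambda>p. \<Sum>i\<in>I. f i p) \<in> Cinf M"
  by (simp add: Cinf_def smooth_fun_sum)

text \<open>
  In a chart, a smooth step function of the squared distance to the point. It vanishes off the image of a compact set,
  which is closed in the manifold because the manifold is Hausdorff; this makes the extension by zero smooth.
\<close>

lemma bump_exists:
  assumes W: "open W" "p \<in> W"
  shows "\<exists>\<eta> K N. \<eta> \<in> Cinf M \<and> closed K \<and> K \<subseteq> W \<and> open N \<and> p \<in> N \<and> N \<subseteq> K \<and>
    (\<forall>q\<in>N. \<eta> q = 1) \<and> (\<forall>q. q \<notin> K \<longrightarrow> \<eta> q = 0)"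
proof -
  obtain U c where A: "(U, c) \<in> atlas M" "p \<in> U" using chart_covers by blast
  define a where "a = c p"
  have "a \<in> c ` (U \<inter> W)" using A W by (auto simp: a_def)
  then obtain e where e: "e > 0" "ball a e \<inter> model M \<subseteq> c ` (U \<inter> W)"
    using chart_openin[OF A(1) W(1)] unfolding openin_contains_ball by blast
  \<comment> \<open>The bump function is \<open>1\<close> within distance \<open>e / 4\<close> and \<open>0\<close> beyond \<open>e / 2\<close>, so its support stays inside the ball of radius \<open>e\<close>.\<close>
  have "(e / 4)\<^sup>2 < (e / 2)\<^sup>2" using e(1) by (intro power_strict_mono) auto
  then obtain \<rho> where \<rho>: "smooth_on UNIV UNIV \<rho>" "\<And>s. s \<le> (e / 4)\<^sup>2 \<Longrightarrow> \<rho> s = 1" "\<And>s. s \<ge> (e / 2)\<^sup>2 \<Longrightarrow> \<rho> s = (0::real)"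
    using smooth_step_exists by blast
  define \<eta> where "\<eta> = (\<lambda>q. if q \<in> U then \<rho> ((c q - a) \<bullet> (c q - a)) else 0)"
  define K where "K = inv_into U c ` (cball a (e / 2) \<inter> model M)"
  define N where "N = U \<inter> c -` ball a (e / 4)"
  have sub: "cball a (e / 2) \<inter> model M \<subseteq> c ` (U \<inter> W)" using e by (auto simp: subset_iff)
  have KW: "K \<subseteq> U \<inter> W"
    using sub chart_inverse[OF A(1)] unfolding K_def by fastforce
  have "compact K"
    unfolding K_def
  proof (rule compact_continuous_image)
    show "continuous_on (cball a (e / 2) \<inter> model M) (inv_into U c)"
      using homeomorphism_cont2[OF chart_homeomorphism[OF A(1)]] by (rule continuous_on_subset) (use sub in auto)
    show "compact (cball a (e / 2) \<inter> model M)"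
      by (intro compact_Int_closed compact_cball closed_subspace subspace_model)
  qed
  then have K: "closed K" by (rule compact_imp_closed)
  have N: "open N"
    unfolding N_def using homeomorphism_cont1[OF chart_homeomorphism[OF A(1)]] chart_open[OF A(1)]
    by (rule continuous_open_preimage) simp
  have pN: "p \<in> N" using A(2) e(1) by (simp add: N_def a_def)
  have in_K: "q \<in> K" if "q \<in> U" "dist a (c q) \<le> e / 2" for q
    unfolding K_def using that chart_inverse[OF A(1) that(1)] chart_image_subset[OF A(1) that(1)]
    by (intro image_eqI[of _ _ "c q"]) auto
  have NK: "N \<subseteq> K" using in_K e(1) by (auto simp: N_def)
  have norm_sq: "(c q - a) \<bullet> (c q - a) = (dist a (c q))\<^sup>2" for q
    by (subst dist_commute) (simp only: dist_norm power2_norm_eq_inner)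
  have one: "\<eta> q = 1" if "q \<in> N" for q
    using that e(1) unfolding N_def \<eta>_def norm_sq by (auto intro!: \<rho>(2) power_mono)
  have zero: "\<eta> q = 0" if "q \<notin> K" for q
    using that in_K[of q] e(1) unfolding \<eta>_def norm_sq by (force intro!: \<rho>(3) power_mono)
  have "smooth_fun_on M UNIV \<eta>"
  proof (rule smooth_fun_local)
    fix q :: 'm
    show "\<exists>N. open N \<and> q \<in> N \<and> smooth_fun_on M N \<eta>"
    proof (cases "q \<in> U")
      case True
      have th: "thick (model M) (c ` U)" using thick_chart[OF A(1) open_UNIV] by simp
      have sq: "smooth_on (model M) (c ` U) (\<lambda>x. \<Sum>i\<in>Basis. ((x + - a) \<bullet> i) * ((x + - a) \<bullet> i))"
        by (intro smooth_on_sum smooth_on_mult th smooth_on_bounded_linear_comp[OF th bounded_linear_inner_left]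
            smooth_on_add smooth_on_const smooth_on_bounded_linear bounded_linear_ident)
      have "smooth_on (model M) (c ` U) (\<lambda>x. \<rho> (\<Sum>i\<in>Basis. ((x + - a) \<bullet> i) * ((x + - a) \<bullet> i)))"
        by (rule smooth_on_compose[OF th subspace_UNIV _ _ \<rho>(1) sq]) auto
      then have "smooth_on (model M) (c ` U) (\<lambda>x. \<eta> (inv_into U c x))"
        by (rule iffD1[OF smooth_on_cong, rotated])
          (use chart_inverse[OF A(1)] euclidean_inner in \<open>auto simp: \<eta>_def euclidean_inner[symmetric]\<close>)
      from smooth_fun_of_chart[OF A(1) chart_open[OF A(1)] order_refl this]
      show ?thesis using True chart_open[OF A(1)] by blast
    next
      case False
      then have "q \<in> - K" using KW by auto
      moreover have "smooth_fun_on M (- K) \<eta>"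
        by (rule iffD1[OF smooth_fun_cong smooth_fun_constant[of _ 0]]) (use K zero in auto)
      ultimately show ?thesis using K by (auto simp: closed_def)
    qed
  qed auto
  then have "\<eta> \<in> Cinf M" by (rule CinfI)
  then show ?thesis using K KW N pN NK one zero by blast
qed

lemma extension_by_zero:
  assumes W: "open W" and K: "closed K" "K \<subseteq> W" and \<eta>: "\<eta> \<in> Cinf M" "\<And>q. q \<notin> K \<Longrightarrow> \<eta> q = 0"
    and g: "smooth_fun_on M W g"
  shows "(\<lambda>q. if q \<in> W then \<eta> q * g q else 0) \<in> Cinf M"
proof (rule CinfI, rule smooth_fun_local)
  fix q
  show "\<exists>N. open N \<and> q \<in> N \<and> smooth_fun_on M N (\<lambda>q. if q \<in> W then \<eta> q * g q else 0)"
  proof (cases "q \<in> W")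
    case True
    have "smooth_fun_on M W (\<lambda>q. if q \<in> W then \<eta> q * g q else 0)"
      by (rule iffD1[OF smooth_fun_cong[OF W] smooth_fun_mult[OF W CinfD[OF \<eta>(1) W] g]]) auto
    then show ?thesis using True W by blast
  next
    case False
    have "smooth_fun_on M (- K) (\<lambda>q. if q \<in> W then \<eta> q * g q else 0)"
      by (rule iffD1[OF smooth_fun_cong smooth_fun_constant[of _ 0]]) (use K \<eta> in auto)
    then show ?thesis using False K by (intro exI[of _ "- K"]) auto
  qed
qed auto

lemma local_extension:
  assumes W: "open W" "p \<in> W" and g: "smooth_fun_on M W g"
  shows "\<exists>G N. G \<in> Cinf M \<and> open N \<and> p \<in> N \<and> N \<subseteq> W \<and> (\<forall>q\<in>N. G q = g q)"
proof -
  obtain \<eta> K N where \<eta>: "\<eta> \<in> Cinf M" "closed K" "K \<subseteq> W" "open N" "p \<in> N" "N \<subseteq> K"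
    "\<forall>q\<in>N. \<eta> q = 1" "\<forall>q. q \<notin> K \<longrightarrow> \<eta> q = 0"
    using bump_exists[OF W] by blast
  show ?thesis
    by (intro exI[of _ "\<lambda>q. if q \<in> W then \<eta> q * g q else 0"] exI[of _ N] conjI ballI
        extension_by_zero[OF W(1) \<eta>(2,3,1) _ g]) (use \<eta> in auto)
qed


section \<open>Tangent vectors and local frames\<close>

lemma tangent_linear:
  "v \<in> tangent_space M m \<Longrightarrow> f \<in> Cinf M \<Longrightarrow> g \<in> Cinf M \<Longrightarrow> v (\<lambda>p. r * f p + s * g p) = r * v f + s * v g"
  and tangent_mult:
  "v \<in> tangent_space M m \<Longrightarrow> f \<in> Cinf M \<Longrightarrow> g \<in> Cinf M \<Longrightarrow> v (\<lambda>p. f p * g p) = f m * v g + g m * v f"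
  and tangent_non_smooth: "v \<in> tangent_space M m \<Longrightarrow> f \<notin> Cinf M \<Longrightarrow> v f = 0"
  by (auto simp: tangent_space_def)

lemma tangent_add: "v \<in> tangent_space M m \<Longrightarrow> f \<in> Cinf M \<Longrightarrow> g \<in> Cinf M \<Longrightarrow> v (\<lambda>p. f p + g p) = v f + v g"
  using tangent_linear[of v m f g 1 1] by simp

lemma tangent_diff: "v \<in> tangent_space M m \<Longrightarrow> f \<in> Cinf M \<Longrightarrow> g \<in> Cinf M \<Longrightarrow> v (\<lambda>p. f p - g p) = v f - v g"
  using tangent_linear[of v m f g 1 "-1"] by simp

lemma tangent_scale: "v \<in> tangent_space M m \<Longrightarrow> f \<in> Cinf M \<Longrightarrow> v (\<lambda>p. r * f p) = r * v f"
  using tangent_linear[of v m f f r 0] by simp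

lemma tangent_const: "v \<in> tangent_space M m \<Longrightarrow> v (\<lambda>p. r) = 0"
proof -
  assume v: "v \<in> tangent_space M m"
  have "v (\<lambda>p. 1) = 0" using tangent_mult[OF v Cinf_const Cinf_const, of 1 1] by simp
  then show ?thesis using tangent_scale[OF v Cinf_const, of r 1] by simp
qed

lemma tangent_sum:
  assumes "v \<in> tangent_space M m" "\<And>i. i \<in> I \<Longrightarrow> f i \<in> Cinf M"
  shows "v (\<lambda>p. \<Sum>i\<in>I. f i p) = (\<Sum>i\<in>I. v (f i))"
  using assms(2)
proof (induction I rule: infinite_finite_induct)
  case (insert i I)
  then show ?case using tangent_add[OF assms(1), of "f i" "\<lambda>p. \<Sum>i\<in>I. f i p"] by auto
qed (simp_all add: tangent_const[OF assms(1)])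

text \<open>
  If \<open>f - g\<close> vanishes near \<open>m\<close>, then it equals \<open>(1 - \<eta>) (f - g)\<close> for a bump function \<open>\<eta>\<close>, and both factors vanish
  at \<open>m\<close>, so that every derivation at \<open>m\<close> gives zero.
\<close>

lemma tangent_local:
  assumes v: "v \<in> tangent_space M m" and f: "f \<in> Cinf M" and g: "g \<in> Cinf M"
    and N: "open N" "m \<in> N" "\<And>q. q \<in> N \<Longrightarrow> f q = g q"
  shows "v f = v g"
proof -
  obtain \<eta> K N' where \<eta>: "\<eta> \<in> Cinf M" "K \<subseteq> N" "m \<in> N'" "N' \<subseteq> K"
    "\<forall>q\<in>N'. \<eta> q = 1" "\<forall>q. q \<notin> K \<longrightarrow> \<eta> q = 0"
    using bump_exists[OF N(1,2)] by blast
  have "(\<lambda>q. f q - g q) = (\<lambda>q. (1 - \<eta> q) * (f q - g q))"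
    using \<eta>(2,6) N(3) by (auto simp: fun_eq_iff)
  moreover have "v (\<lambda>q. (1 - \<eta> q) * (f q - g q)) =
      (1 - \<eta> m) * v (\<lambda>q. f q - g q) + (f m - g m) * v (\<lambda>q. 1 - \<eta> q)"
    by (rule tangent_mult[OF v]) (use f g \<eta>(1) in auto)
  ultimately have "v (\<lambda>q. f q - g q) = 0" using \<eta>(3,5) N(2,3) by simp
  then show ?thesis using tangent_diff[OF v f g] by simp
qed

text \<open>
  Hadamard's lemma: the derivative of \<open>f\<close> along the segment from \<open>c p\<close> to \<open>c q\<close> is integrated, and
  \<open>g b q\<close> is the mean of the partial derivative along this segment, which is smooth in \<open>q\<close>.
\<close>

lemma hadamard:
  assumes A: "(U, c) \<in> atlas M" and p: "p \<in> U" and B: "onb (model M) B" and f: "f \<in> Cinf M"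
  shows "\<exists>W g. open W \<and> p \<in> W \<and> W \<subseteq> U \<and>
    (\<forall>b\<in>B. smooth_fun_on M W (g b) \<and> g b p = chart_partial U c b f p) \<and>
    (\<forall>q\<in>W. f q = f p + (\<Sum>b\<in>B. ((c q - c p) \<bullet> b) * g b q))"
proof -
  define a where "a = c p"
  have th: "thick (model M) (c ` U)" using thick_chart[OF A open_UNIV] by simp
  have "a \<in> c ` U" using p by (simp add: a_def)
  then obtain e where e: "e > 0" "ball a e \<inter> model M \<subseteq> c ` U"
    using chart_image_openin[OF A] unfolding openin_contains_ball by blast
  have aM: "a \<in> model M" using chart_image_subset[OF A p] by (simp add: a_def)
  define W where "W = U \<inter> c -` ball a e"
  have W: "open W" "p \<in> W" "W \<subseteq> U"
    using continuous_open_preimage[OF homeomorphism_cont1[OF chart_homeomorphism[OF A]] chart_open[OF A], of "ball a e"] e(1) p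
    by (auto simp: W_def a_def)
  have UW: "U \<inter> W = W" using W by auto
  have seg: "a + s *\<^sub>R (x - a) \<in> c ` U" if "x \<in> c ` W" "s \<in> {0..1}" for x s
  proof -
    have x: "x \<in> model M" "dist a x < e" using that(1) chart_image_subset[OF A] by (auto simp: W_def)
    have "s * norm (x - a) \<le> 1 * norm (x - a)" using that(2) by (intro mult_right_mono) auto
    then have "a + s *\<^sub>R (x - a) \<in> ball a e" using x(2) that(2) by (simp add: dist_norm norm_minus_commute)
    moreover have "a + s *\<^sub>R (x - a) \<in> model M"
      using subspace_model aM x(1) by (intro subspace_add subspace_scale subspace_diff)
    ultimately show ?thesis using e(2) by auto
  qed
  define H where "H = (\<lambda>b q s. chart_partial U c b f (inv_into U c (a + s *\<^sub>R (c q - a))))"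
  have H: "smooth_family_on M W (H b)" if b: "b \<in> B" for b
  proof (rule family_of_chart[OF A W(1,3)])
    let ?D = "c ` W \<times> {0..1::real}"
    have thW: "thick (model M \<times> UNIV) ?D" using thick_chart_Times[OF A W(1)] by (simp add: UW)
    have "b \<in> model M" using B b by (auto simp: onb_def)
    then have "smooth_fun_on M U (chart_partial U c b f)"
      by (intro smooth_fun_chart_partial[OF A chart_open[OF A] order_refl] CinfD[OF f] chart_open[OF A])
    then have sm: "smooth_on (model M) (c ` U) (chart_partial U c b f \<circ> inv_into U c)"
      using A by (fastforce simp: smooth_fun_on_def)
    have g: "smooth_on (model M \<times> UNIV) ?D (\<lambda>z. a + snd z *\<^sub>R (fst z + - a))"
      by (intro smooth_on_add smooth_on_scaleR smooth_on_const smooth_on_fst smooth_on_snd thW)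
    have "smooth_on (model M \<times> UNIV) ?D (\<lambda>z. (chart_partial U c b f \<circ> inv_into U c) (a + snd z *\<^sub>R (fst z + - a)))"
      by (rule smooth_on_compose[OF thW subspace_model _ _ sm g]) (use chart_image_subset[OF A] seg in auto)
    then show "smooth_on (model M \<times> UNIV) ?D (\<lambda>(x, t). H b (inv_into U c x) t)"
      by (rule iffD1[OF smooth_on_cong, rotated]) (use chart_inverse[OF A] W(3) in \<open>auto simp: H_def subset_iff\<close>)
  qed
  define g where "g = (\<lambda>b q. integral {0..1} (H b q))"
  have "smooth_fun_on M W (g b) \<and> g b p = chart_partial U c b f p" if "b \<in> B" for b
    using family_integral[OF W(1) H[OF that]] chart_inverse[OF A p] by (simp add: g_def H_def a_def)
  moreover have "f q = f p + (\<Sum>b\<in>B. ((c q - c p) \<bullet> b) * g b q)" if q: "q \<in> W" for q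
  proof -
    let ?f = "f \<circ> inv_into U c"
    let ?l = "\<lambda>s. a + s *\<^sub>R (c q - a)"
    have cq: "c q \<in> c ` W" using q by auto
    have dM: "c q - a \<in> model M"
      using subspace_model aM chart_image_subset[OF A] q W(3) by (intro subspace_diff) auto
    have "((\<lambda>s. ?f (?l s)) has_vector_derivative (\<Sum>b\<in>B. ((c q - a) \<bullet> b) * H b q s)) (at s within {0..1})"
      if s: "s \<in> {0..1}" for s
    proof -
      obtain r where r: "r \<in> U" "?l s = c r" using seg[OF cq s] by auto
      let ?d = "\<lambda>b. chart_partial U c b f r"
      have d: "(?f has_derivative ?d) (at (c r) within c ` U)"
        by (rule chart_partial_has_derivative[OF A open_UNIV r(1)]) (use f in \<open>auto intro: CinfD\<close>)
      then have lin: "linear ?d" by (rule has_derivative_linear)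
      have "(?f has_derivative ?d) (at (?l s) within ?l ` {0..1})"
        unfolding r(2) by (rule has_derivative_subset[OF d]) (use seg[OF cq] in auto)
      moreover have "(?l has_derivative (\<lambda>h. h *\<^sub>R (c q - a))) (at s within {0..1})"
        by (auto intro!: derivative_eq_intros)
      ultimately have "((\<lambda>s. ?f (?l s)) has_derivative (\<lambda>h. ?d (h *\<^sub>R (c q - a)))) (at s within {0..1})"
        using diff_chain_within[of ?l _ s "{0..1}" ?f] by (fastforce simp: o_def)
      moreover have "?d (c q - a) = (\<Sum>b\<in>B. ((c q - a) \<bullet> b) * H b q s)"
      proof -
        have "?d (c q - a) = ?d (\<Sum>b\<in>B. ((c q - a) \<bullet> b) *\<^sub>R b)" using B dM by (simp add: onb_def)
        also have "\<dots> = (\<Sum>b\<in>B. ((c q - a) \<bullet> b) * ?d b)" by (simp add: linear_sum[OF lin] linear_scale[OF lin])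
        finally show ?thesis using chart_inverse[OF A r(1)] by (simp add: H_def r(2))
      qed
      ultimately show ?thesis by (simp add: has_vector_derivative_def linear_scale[OF lin])
    qed
    from fundamental_theorem_of_calculus[OF _ this]
    have "((\<lambda>s. \<Sum>b\<in>B. ((c q - a) \<bullet> b) * H b q s) has_integral (?f (?l 1) - ?f (?l 0))) {0..1}" by simp
    then have "f q - f p = integral {0..1} (\<lambda>s. \<Sum>b\<in>B. ((c q - a) \<bullet> b) * H b q s)"
      using chart_inverse[OF A] p q W(3) by (auto simp: integral_unique a_def)
    also have "\<dots> = (\<Sum>b\<in>B. integral {0..1} (\<lambda>s. ((c q - a) \<bullet> b) * H b q s))"
      by (rule integral_sum)
        (use B smooth_on_continuous[OF family_slice[OF W(1) H q]] in
          \<open>auto simp: onb_def intro!: integrable_continuous_real continuous_on_mult continuous_on_const\<close>)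
    finally show ?thesis by (simp add: g_def a_def)
  qed
  ultimately show ?thesis using W by blast
qed

text \<open>
  A derivation is determined by its values on coordinate functions: it is applied to the expansion given by
  \<open>hadamard\<close>, in which all terms but those with a differentiated coordinate vanish at \<open>p\<close>. The functions \<open>x b\<close> are global
  functions that agree with the coordinates near \<open>p\<close>, because tangent vectors act on global functions only.
\<close>

lemma tangent_expansion:
  assumes A: "(U, c) \<in> atlas M" and p: "p \<in> U" and B: "onb (model M) B" and f: "f \<in> Cinf M"
    and x: "\<And>b. b \<in> B \<Longrightarrow> x b \<in> Cinf M" and N: "open N" "p \<in> N" "\<And>q b. q \<in> N \<Longrightarrow> b \<in> B \<Longrightarrow> x b q = c q \<bullet> b"
    and v: "v \<in> tangent_space M p"
  shows "v f = (\<Sum>b\<in>B. v (x b) * chart_partial U c b f p)"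
proof -
  obtain W g where W: "open W" "p \<in> W" "W \<subseteq> U"
    and g: "\<And>b. b \<in> B \<Longrightarrow> smooth_fun_on M W (g b)" "\<And>b. b \<in> B \<Longrightarrow> g b p = chart_partial U c b f p"
    and eq: "\<And>q. q \<in> W \<Longrightarrow> f q = f p + (\<Sum>b\<in>B. ((c q - c p) \<bullet> b) * g b q)"
    using hadamard[OF A p B f] by blast
  have fin: "finite B" using B by (simp add: onb_def)
  have "\<forall>b\<in>B. \<exists>G N. G \<in> Cinf M \<and> open N \<and> p \<in> N \<and> N \<subseteq> W \<and> (\<forall>q\<in>N. G q = g b q)"
    using local_extension[OF W(1,2) g(1)] by blast
  then obtain G N' where G: "\<And>b. b \<in> B \<Longrightarrow> G b \<in> Cinf M"
    "\<And>b. b \<in> B \<Longrightarrow> open (N' b) \<and> p \<in> N' b" "\<And>b q. b \<in> B \<Longrightarrow> q \<in> N' b \<Longrightarrow> G b q = g b q"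
    by metis
  \<comment> \<open>On this neighbourhood all extended functions agree with the local ones.\<close>
  let ?N = "N \<inter> W \<inter> (\<Inter>b\<in>B. N' b)"
  have Gp: "G b p = chart_partial U c b f p" if "b \<in> B" for b using G(2,3) g(2) that by auto
  have "v f = v (\<lambda>q. f p + (\<Sum>b\<in>B. (x b q - x b p) * G b q))"
  proof (rule tangent_local[OF v f])
    show "open ?N" using N(1) W(1) fin G(2) by (auto intro: open_INT)
    show "p \<in> ?N" using N(2) W(2) G(2) by auto
    fix q assume q: "q \<in> ?N"
    have "(\<Sum>b\<in>B. (x b q - x b p) * G b q) = (\<Sum>b\<in>B. ((c q - c p) \<bullet> b) * g b q)"
      by (rule sum.cong) (use q N G(3) in \<open>auto simp: inner_diff_left\<close>)
    then show "f q = f p + (\<Sum>b\<in>B. (x b q - x b p) * G b q)" using eq[of q] q by auto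
  qed (intro Cinf_add Cinf_sum Cinf_mult Cinf_diff Cinf_const x G(1))
  also have "\<dots> = v (\<lambda>q. f p) + v (\<lambda>q. \<Sum>b\<in>B. (x b q - x b p) * G b q)"
    by (rule tangent_add[OF v]) (intro Cinf_sum Cinf_mult Cinf_diff Cinf_const x G(1))+
  also have "\<dots> = (\<Sum>b\<in>B. v (\<lambda>q. (x b q - x b p) * G b q))"
    by (subst tangent_sum[OF v]) (simp_all add: tangent_const[OF v] x G(1) Cinf_mult Cinf_diff Cinf_const)
  also have "\<dots> = (\<Sum>b\<in>B. v (x b) * chart_partial U c b f p)"
  proof (rule sum.cong)
    fix b assume b: "b \<in> B"
    have "v (\<lambda>q. (x b q - x b p) * G b q) = (x b p - x b p) * v (G b) + G b p * v (\<lambda>q. x b q - x b p)"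
      by (rule tangent_mult[OF v]) (intro Cinf_diff Cinf_const x G(1) b)+
    also have "v (\<lambda>q. x b q - x b p) = v (x b)"
      using tangent_diff[OF v x[OF b] Cinf_const, of "x b p"] by (simp add: tangent_const[OF v])
    finally show "v (\<lambda>q. (x b q - x b p) * G b q) = v (x b) * chart_partial U c b f p" using Gp[OF b] by simp
  qed simp
  finally show ?thesis .
qed

text \<open>
  Tangent vectors only see functions and vector fields defined on the whole manifold. A frame therefore
  consists of global functions \<open>x b\<close> and global vector fields \<open>E b\<close>, indexed by an orthonormal basis of the model space, which
  on \<open>N\<close> are the coordinate functions and the coordinate vector fields of a chart. Most later arguments about vectors
  and covectors are algebra with these.
\<close>

definition chart_frame ::
  "'m set \<Rightarrow> ('m \<Rightarrow> 'e) \<Rightarrow> 'e set \<Rightarrow> 'm set \<Rightarrow> ('e \<Rightarrow> 'm \<Rightarrow> real) \<Rightarrow> ('e \<Rightarrow> 'm \<Rightarrow> 'm tvec) \<Rightarrow> bool" where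
  "chart_frame U c B N x E \<longleftrightarrow> (U, c) \<in> atlas M \<and> onb (model M) B \<and> open N \<and> N \<subseteq> U \<and>
     (\<forall>b\<in>B. x b \<in> Cinf M) \<and> (\<forall>b\<in>B. E b \<in> vector_fields M) \<and>
     (\<forall>p\<in>N. \<forall>b\<in>B. \<forall>f\<in>Cinf M. E b p f = chart_partial U c b f p) \<and>
     (\<forall>p\<in>N. \<forall>a\<in>B. \<forall>b\<in>B. E a p (x b) = (if a = b then 1 else 0)) \<and>
     (\<forall>p\<in>N. \<forall>v\<in>tangent_space M p. v = (\<lambda>f. \<Sum>b\<in>B. v (x b) * E b p f))"

lemma chart_frameD:
  assumes "chart_frame U c B N x E"
  shows "(U, c) \<in> atlas M" "onb (model M) B" "open N" "N \<subseteq> U" "finite B"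
    "\<And>b. b \<in> B \<Longrightarrow> b \<in> model M" "\<And>b. b \<in> B \<Longrightarrow> x b \<in> Cinf M" "\<And>b. b \<in> B \<Longrightarrow> E b \<in> vector_fields M"
    "\<And>p b f. p \<in> N \<Longrightarrow> b \<in> B \<Longrightarrow> f \<in> Cinf M \<Longrightarrow> E b p f = chart_partial U c b f p"
    "\<And>p a b. p \<in> N \<Longrightarrow> a \<in> B \<Longrightarrow> b \<in> B \<Longrightarrow> E a p (x b) = (if a = b then 1 else 0)"
    "\<And>p v. p \<in> N \<Longrightarrow> v \<in> tangent_space M p \<Longrightarrow> v = (\<lambda>f. \<Sum>b\<in>B. v (x b) * E b p f)"
proof -
  note D1 = assms[unfolded chart_frame_def]
  note D2 = D1[THEN conjunct2]
  note D3 = D2[THEN conjunct2]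
  note D4 = D3[THEN conjunct2]
  note D5 = D4[THEN conjunct2]
  note D6 = D5[THEN conjunct2]
  note D7 = D6[THEN conjunct2]
  note D8 = D7[THEN conjunct2]
  show "(U, c) \<in> atlas M" by (rule D1[THEN conjunct1])
  show B: "onb (model M) B" by (rule D2[THEN conjunct1])
  show "finite B" "\<And>b. b \<in> B \<Longrightarrow> b \<in> model M" using B by (auto simp: onb_def)
  show "open N" by (rule D3[THEN conjunct1])
  show "N \<subseteq> U" by (rule D4[THEN conjunct1])
  show "\<And>b. b \<in> B \<Longrightarrow> x b \<in> Cinf M" by (rule D5[THEN conjunct1, rule_format])
  show "\<And>b. b \<in> B \<Longrightarrow> E b \<in> vector_fields M" by (rule D6[THEN conjunct1, rule_format])
  show "\<And>p b f. p \<in> N \<Longrightarrow> b \<in> B \<Longrightarrow> f \<in> Cinf M \<Longrightarrow> E b p f = chart_partial U c b f p"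
    by (rule D7[THEN conjunct1, rule_format])
  show "\<And>p a b. p \<in> N \<Longrightarrow> a \<in> B \<Longrightarrow> b \<in> B \<Longrightarrow> E a p (x b) = (if a = b then 1 else 0)"
    by (rule D8[THEN conjunct1, rule_format])
  show "\<And>p v. p \<in> N \<Longrightarrow> v \<in> tangent_space M p \<Longrightarrow> v = (\<lambda>f. \<Sum>b\<in>B. v (x b) * E b p f)"
    by (rule D8[THEN conjunct2, rule_format])
qed

text \<open>
  Coordinates and coordinate vector fields are multiplied by a bump function and extended by zero.
\<close>

lemma chart_frame_exists: "\<exists>U c B N x E. chart_frame U c B N x E \<and> m \<in> N"
  unfolding chart_frame_def
proof -
  obtain U c where A: "(U, c) \<in> atlas M" "m \<in> U" using chart_covers by blast
  note U = chart_open[OF A(1)]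
  obtain B where B: "onb (model M) B" using onb_exists[OF subspace_model] by blast
  obtain \<eta> K N where \<eta>: "\<eta> \<in> Cinf M" "closed K" "K \<subseteq> U" "open N" "m \<in> N" "N \<subseteq> K"
    "\<forall>q\<in>N. \<eta> q = 1" "\<forall>q. q \<notin> K \<longrightarrow> \<eta> q = 0"
    using bump_exists[OF U A(2)] by blast
  have NU: "N \<subseteq> U" using \<eta> by auto
  have BM: "b \<in> model M" if "b \<in> B" for b using B that by (auto simp: onb_def)
  define x where "x = (\<lambda>b q. if q \<in> U then \<eta> q * (c q \<bullet> b) else 0)"
  have th: "thick (model M) (c ` U)" using thick_chart[OF A(1) open_UNIV] by simp
  have coord: "smooth_fun_on M U (\<lambda>q. c q \<bullet> b)" for b
  proof (rule smooth_fun_of_chart[OF A(1) U order_refl])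
    have "smooth_on (model M) (c ` U) (\<lambda>x. x \<bullet> b)"
      by (rule smooth_on_bounded_linear[OF th bounded_linear_inner_left])
    then show "smooth_on (model M) (c ` U) (\<lambda>x. c (inv_into U c x) \<bullet> b)"
      by (rule iffD1[OF smooth_on_cong, rotated]) (use chart_inverse[OF A(1)] in auto)
  qed
  have x: "x b \<in> Cinf M" for b
    unfolding x_def by (rule extension_by_zero[OF U \<eta>(2,3,1) _ coord]) (use \<eta>(8) in auto)
  have xN: "x b q = c q \<bullet> b" if "q \<in> N" for b q using that NU \<eta>(7) by (auto simp: x_def)
  define E where "E = (\<lambda>b p f. if f \<in> Cinf M then if p \<in> U then \<eta> p * chart_partial U c b f p else 0 else 0)"
  have E: "E b \<in> vector_fields M" if b: "b \<in> B" for b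
  proof -
    have "E b p \<in> tangent_space M p" for p
    proof (cases "p \<in> U")
      case True
      note add = chart_partial_add[OF A(1) open_UNIV True UNIV_I BM[OF b] CinfD[OF _ open_UNIV] CinfD[OF _ open_UNIV]]
      note mult = chart_partial_mult[OF A(1) open_UNIV True UNIV_I BM[OF b] CinfD[OF _ open_UNIV] CinfD[OF _ open_UNIV]]
      have "(\<lambda>p. r * f p + s * g p) \<in> Cinf M" if "f \<in> Cinf M" "g \<in> Cinf M" for f g r s
        by (intro Cinf_add Cinf_mult Cinf_const that)
      then show ?thesis using True by (auto simp: tangent_space_def E_def add mult Cinf_mult algebra_simps)
    qed (auto simp: tangent_space_def E_def)
    moreover have "(\<lambda>p. E b p f) \<in> Cinf M" if f: "f \<in> Cinf M" for f
    proof -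
      have "(\<lambda>q. if q \<in> U then \<eta> q * chart_partial U c b f q else 0) \<in> Cinf M"
        by (rule extension_by_zero[OF U \<eta>(2,3,1) _ smooth_fun_chart_partial[OF A(1) U order_refl BM[OF b] CinfD[OF f U]]])
          (use \<eta>(8) in auto)
      then show ?thesis using f by (simp add: E_def)
    qed
    ultimately show ?thesis by (simp add: vector_fields_def)
  qed
  have EN: "E b p f = chart_partial U c b f p" if "p \<in> N" "f \<in> Cinf M" for b p f
    using that NU \<eta>(7) by (auto simp: E_def)
  have dual: "E a p (x b) = (if a = b then 1 else 0)" if p: "p \<in> N" and a: "a \<in> B" and b: "b \<in> B" for a b p
  proof -
    have "chart_partial U c a (x b) p = a \<bullet> b"
    proof (rule chart_partial_unique[OF A(1) \<eta>(4) _ p BM[OF a]])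
      have "((\<lambda>y. y \<bullet> b) has_derivative (\<lambda>y. y \<bullet> b)) (at (c p) within c ` (U \<inter> N))"
        by (rule bounded_linear_imp_has_derivative[OF bounded_linear_inner_left])
      then show "((x b \<circ> inv_into U c) has_derivative (\<lambda>a. a \<bullet> b)) (at (c p) within c ` (U \<inter> N))"
        by (rule has_derivative_transform[rotated 2]) (use p NU xN chart_inverse[OF A(1)] in auto)
    qed (use p NU in auto)
    then show ?thesis using EN[OF p x] B a b by (simp add: onb_def)
  qed
  have expand: "v = (\<lambda>f. \<Sum>b\<in>B. v (x b) * E b p f)" if p: "p \<in> N" and v: "v \<in> tangent_space M p" for p v
  proof
    fix f
    show "v f = (\<Sum>b\<in>B. v (x b) * E b p f)"
    proof (cases "f \<in> Cinf M")
      case True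
      then show ?thesis
        using tangent_expansion[OF A(1) _ B True x \<eta>(4) p xN v] p NU EN[OF p True] by auto
    next
      case False
      then show ?thesis using tangent_non_smooth[OF v] by (simp add: E_def)
    qed
  qed
  show "\<exists>U c B N x E. ((U, c) \<in> atlas M \<and> onb (model M) B \<and> open N \<and> N \<subseteq> U \<and>
     (\<forall>b\<in>B. x b \<in> Cinf M) \<and> (\<forall>b\<in>B. E b \<in> vector_fields M) \<and>
     (\<forall>p\<in>N. \<forall>b\<in>B. \<forall>f\<in>Cinf M. E b p f = chart_partial U c b f p) \<and>
     (\<forall>p\<in>N. \<forall>a\<in>B. \<forall>b\<in>B. E a p (x b) = (if a = b then 1 else 0)) \<and>
     (\<forall>p\<in>N. \<forall>v\<in>tangent_space M p. v = (\<lambda>f. \<Sum>b\<in>B. v (x b) * E b p f))) \<and> m \<in> N"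
    by (intro exI[of _ U] exI[of _ c] exI[of _ B] exI[of _ N] exI[of _ x] exI[of _ E] conjI ballI
        A(1) B \<eta>(4,5) NU x E EN dual expand)
qed

end


section \<open>Vector fields and one-forms\<close>

definition one_forms :: "('m, 'e::euclidean_space) manifold \<Rightarrow> ('m \<Rightarrow> 'm covec) set" where
  "one_forms M = {\<alpha>. (\<forall>m. \<alpha> m \<in> cotangent_space M m) \<and>
     (\<forall>Y\<in>vector_fields M. (\<lambda>m. \<alpha> m (Y m)) \<in> Cinf M)}"

context mfd
begin

lemma tangent_space_lincomb:
  assumes "u \<in> tangent_space M m" "v \<in> tangent_space M m"
  shows "(\<lambda>f. r * u f + s * v f) \<in> tangent_space M m"
  using assms unfolding tangent_space_def by (auto simp: algebra_simps)

lemma tangent_space_zero: "(\<lambda>f. 0) \<in> tangent_space M m"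
  unfolding tangent_space_def by auto

lemma tangent_space_add: "u \<in> tangent_space M m \<Longrightarrow> v \<in> tangent_space M m \<Longrightarrow> (\<lambda>f. u f + v f) \<in> tangent_space M m"
  using tangent_space_lincomb[of u m v 1 1] by simp

lemma tangent_space_scale: "u \<in> tangent_space M m \<Longrightarrow> (\<lambda>f. r * u f) \<in> tangent_space M m"
  using tangent_space_lincomb[of u m u r 0] by simp

lemma tangent_space_sum:
  "(\<And>i. i \<in> I \<Longrightarrow> u i \<in> tangent_space M m) \<Longrightarrow> (\<lambda>f. \<Sum>i\<in>I. r i * u i f) \<in> tangent_space M m"
proof (induction I rule: infinite_finite_induct)
  case (insert i I)
  then show ?case using tangent_space_lincomb[of "u i" m "\<lambda>f. \<Sum>i\<in>I. r i * u i f" "r i" 1] by simp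
qed (simp_all add: tangent_space_zero)

lemma cotangent_linear:
  "\<alpha> \<in> cotangent_space M m \<Longrightarrow> u \<in> tangent_space M m \<Longrightarrow> v \<in> tangent_space M m \<Longrightarrow>
    \<alpha> (\<lambda>f. r * u f + s * v f) = r * \<alpha> u + s * \<alpha> v"
  by (simp add: cotangent_space_def)

lemma cotangent_outside: "\<alpha> \<in> cotangent_space M m \<Longrightarrow> v \<notin> tangent_space M m \<Longrightarrow> \<alpha> v = 0"
  by (simp add: cotangent_space_def)

lemma cotangent_add:
  "\<alpha> \<in> cotangent_space M m \<Longrightarrow> u \<in> tangent_space M m \<Longrightarrow> v \<in> tangent_space M m \<Longrightarrow> \<alpha> (\<lambda>f. u f + v f) = \<alpha> u + \<alpha> v"
  using cotangent_linear[of \<alpha> m u v 1 1] by simp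

lemma cotangent_scale:
  "\<alpha> \<in> cotangent_space M m \<Longrightarrow> u \<in> tangent_space M m \<Longrightarrow> \<alpha> (\<lambda>f. r * u f) = r * \<alpha> u"
  using cotangent_linear[of \<alpha> m u u r 0] by simp

lemma cotangent_zero: "\<alpha> \<in> cotangent_space M m \<Longrightarrow> \<alpha> (\<lambda>f. 0) = 0"
  using cotangent_scale[of \<alpha> m "\<lambda>f. 0" 0] tangent_space_zero by simp

lemma cotangent_sum:
  assumes "\<alpha> \<in> cotangent_space M m" "\<And>i. i \<in> I \<Longrightarrow> u i \<in> tangent_space M m"
  shows "\<alpha> (\<lambda>f. \<Sum>i\<in>I. r i * u i f) = (\<Sum>i\<in>I. r i * \<alpha> (u i))"
  using assms(2)
proof (induction I rule: infinite_finite_induct)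
  case (insert i I)
  then show ?case
    using cotangent_linear[OF assms(1), of "u i" "\<lambda>f. \<Sum>i\<in>I. r i * u i f" "r i" 1] tangent_space_sum[of I u m r] by simp
qed (simp_all add: cotangent_zero[OF assms(1)])

lemma cotangent_space_lincomb:
  assumes "\<alpha> \<in> cotangent_space M m" "\<beta> \<in> cotangent_space M m"
  shows "(\<lambda>v. r * \<alpha> v + s * \<beta> v) \<in> cotangent_space M m"
  using assms unfolding cotangent_space_def by (auto simp: algebra_simps)

lemma cotangent_space_zero: "(\<lambda>f. 0) \<in> cotangent_space M m"
  unfolding cotangent_space_def by auto

lemma vector_field_at: "X \<in> vector_fields M \<Longrightarrow> X m \<in> tangent_space M m"
  and vector_field_smooth: "X \<in> vector_fields M \<Longrightarrow> f \<in> Cinf M \<Longrightarrow> (\<lambda>p. X p f) \<in> Cinf M"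
  by (auto simp: vector_fields_def)

lemma vector_field_lincomb:
  assumes "X \<in> vector_fields M" "Y \<in> vector_fields M" "g \<in> Cinf M" "h \<in> Cinf M"
  shows "(\<lambda>p f. g p * X p f + h p * Y p f) \<in> vector_fields M"
  using assms tangent_space_lincomb by (auto simp: vector_fields_def intro!: Cinf_add Cinf_mult)

lemma vector_field_scale:
  "X \<in> vector_fields M \<Longrightarrow> g \<in> Cinf M \<Longrightarrow> (\<lambda>p f. g p * X p f) \<in> vector_fields M"
  using vector_field_lincomb[of X X g "\<lambda>p. 0"] Cinf_const by simp

lemma vector_field_zero: "(\<lambda>p f. 0) \<in> vector_fields M"
  by (auto simp: vector_fields_def tangent_space_zero)

lemma vector_field_sum:
  "(\<And>i. i \<in> I \<Longrightarrow> X i \<in> vector_fields M) \<Longrightarrow> (\<And>i. i \<in> I \<Longrightarrow> g i \<in> Cinf M) \<Longrightarrow>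
    (\<lambda>p f. \<Sum>i\<in>I. g i p * X i p f) \<in> vector_fields M"
  by (auto simp: vector_fields_def intro!: tangent_space_sum Cinf_sum Cinf_mult)

text \<open>
  A vector is extended with constant coefficients in a frame.
\<close>

lemma vector_field_extension:
  assumes "v \<in> tangent_space M m"
  shows "\<exists>Y\<in>vector_fields M. Y m = v"
proof -
  obtain U c B N x E where fr: "chart_frame U c B N x E" "m \<in> N" using chart_frame_exists by blast
  note f = chart_frameD[OF fr(1)]
  have "(\<lambda>p f. \<Sum>b\<in>B. v (x b) * E b p f) \<in> vector_fields M"
    by (rule vector_field_sum[OF f(8) Cinf_const])
  moreover have "(\<lambda>f. \<Sum>b\<in>B. v (x b) * E b m f) = v" using f(11)[OF fr(2) assms] by simp
  ultimately show ?thesis by (intro bexI[of _ "\<lambda>p f. \<Sum>b\<in>B. v (x b) * E b p f"])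
qed

lemma lie_bracket_vector_field:
  assumes X: "X \<in> vector_fields M" and Y: "Y \<in> vector_fields M"
  shows "lie_bracket X Y \<in> vector_fields M"
proof -
  have "lie_bracket X Y m \<in> tangent_space M m" for m
  proof -
    have Xm: "X m \<in> tangent_space M m" and Ym: "Y m \<in> tangent_space M m" by (rule vector_field_at[OF X], rule vector_field_at[OF Y])
    have out: "lie_bracket X Y m f = 0" if "f \<notin> Cinf M" for f
      using that tangent_non_smooth[OF vector_field_at[OF X]] tangent_non_smooth[OF vector_field_at[OF Y]]
      by (simp add: lie_bracket_def tangent_const[OF Xm] tangent_const[OF Ym])
    have lin: "lie_bracket X Y m (\<lambda>p. a * f p + b * g p) = a * lie_bracket X Y m f + b * lie_bracket X Y m g"
      if "f \<in> Cinf M" "g \<in> Cinf M" for f g a b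
      using that X Y
      by (simp add: lie_bracket_def tangent_linear[OF vector_field_at[OF X]] tangent_linear[OF vector_field_at[OF Y]]
          vector_field_smooth[OF X] vector_field_smooth[OF Y], (simp add: algebra_simps)?)
    have mult: "lie_bracket X Y m (\<lambda>p. f p * g p) = f m * lie_bracket X Y m g + g m * lie_bracket X Y m f"
      if "f \<in> Cinf M" "g \<in> Cinf M" for f g
      using that X Y
      by (simp add: lie_bracket_def tangent_mult[OF vector_field_at[OF X]] tangent_mult[OF vector_field_at[OF Y]]
          tangent_add[OF Xm] tangent_add[OF Ym] tangent_mult[OF Xm] tangent_mult[OF Ym]
          vector_field_smooth[OF X] vector_field_smooth[OF Y] Cinf_mult, (simp add: algebra_simps)?)
    show ?thesis unfolding tangent_space_def using out lin mult by simp
  qed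
  moreover have "(\<lambda>m. lie_bracket X Y m f) \<in> Cinf M" if "f \<in> Cinf M" for f
    unfolding lie_bracket_def by (rule Cinf_diff[OF vector_field_smooth[OF X vector_field_smooth[OF Y that]] vector_field_smooth[OF Y vector_field_smooth[OF X that]]])
  ultimately show ?thesis unfolding vector_fields_def by blast
qed

lemma lie_bracket_apply: "lie_bracket X Y m f = X m (\<lambda>p. Y p f) - Y m (\<lambda>p. X p f)"
  by (simp add: lie_bracket_def)

lemma lie_bracket_antisym: "lie_bracket Y X m = (\<lambda>f. - lie_bracket X Y m f)"
  by (simp add: lie_bracket_def)

lemma lie_bracket_lincomb_right:
  assumes X: "X \<in> vector_fields M" and Y: "Y \<in> vector_fields M" and Z: "Z \<in> vector_fields M"
    and g: "g \<in> Cinf M" and h: "h \<in> Cinf M"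
  shows "lie_bracket X (\<lambda>p f. g p * Y p f + h p * Z p f) m =
    (\<lambda>f. (g m * lie_bracket X Y m f + X m g * Y m f) + (h m * lie_bracket X Z m f + X m h * Z m f))"
proof
  fix f
  note Xm = vector_field_at[OF X, of m]
  show "lie_bracket X (\<lambda>p f. g p * Y p f + h p * Z p f) m f =
    (g m * lie_bracket X Y m f + X m g * Y m f) + (h m * lie_bracket X Z m f + X m h * Z m f)"
  proof (cases "f \<in> Cinf M")
    case True
    then show ?thesis using Y Z g h
      by (simp add: lie_bracket_def tangent_add[OF Xm] tangent_mult[OF Xm] vector_field_smooth[OF Y] vector_field_smooth[OF Z] Cinf_mult, (simp add: algebra_simps)?)
  next
    case False
    have "lie_bracket X W m f = 0" if "W \<in> vector_fields M" for W
      by (rule tangent_non_smooth[OF vector_field_at[OF lie_bracket_vector_field[OF X that]] False])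
    then show ?thesis
      using vector_field_lincomb[OF Y Z g h] Y Z
        tangent_non_smooth[OF vector_field_at[OF Y] False] tangent_non_smooth[OF vector_field_at[OF Z] False] by simp
  qed
qed

lemma lie_bracket_lincomb_left:
  assumes X: "X \<in> vector_fields M" and Y: "Y \<in> vector_fields M" and Z: "Z \<in> vector_fields M"
  shows "lie_bracket (\<lambda>p f. r * X p f + s * Y p f) Z m = (\<lambda>f. r * lie_bracket X Z m f + s * lie_bracket Y Z m f)"
proof
  note W = vector_field_lincomb[OF X Y Cinf_const Cinf_const, of r s]
  fix f
  note Zm = vector_field_at[OF Z, of m]
  show "lie_bracket (\<lambda>p f. r * X p f + s * Y p f) Z m f = r * lie_bracket X Z m f + s * lie_bracket Y Z m f"
  proof (cases "f \<in> Cinf M")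
    case True
    then show ?thesis using X Y
      by (simp add: lie_bracket_def tangent_linear[OF Zm] vector_field_smooth[OF X] vector_field_smooth[OF Y], (simp add: algebra_simps)?)
  next
    case False
    have "lie_bracket V Z m f = 0" if "V \<in> vector_fields M" for V
      by (rule tangent_non_smooth[OF vector_field_at[OF lie_bracket_vector_field[OF that Z]] False])
    then show ?thesis using W X Y by simp
  qed
qed

lemma lie_bracket_jacobi:
  assumes X: "X \<in> vector_fields M" and Y: "Y \<in> vector_fields M" and Z: "Z \<in> vector_fields M"
  shows "lie_bracket X (lie_bracket Y Z) m =
    (\<lambda>f. lie_bracket (lie_bracket X Y) Z m f + lie_bracket Y (lie_bracket X Z) m f)"
proof
  fix f
  note Xm = vector_field_at[OF X, of m]
  note Ym = vector_field_at[OF Y, of m]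
  note Zm = vector_field_at[OF Z, of m]
  show "lie_bracket X (lie_bracket Y Z) m f = lie_bracket (lie_bracket X Y) Z m f + lie_bracket Y (lie_bracket X Z) m f"
  proof (cases "f \<in> Cinf M")
    case True
    then show ?thesis using X Y Z
      by (simp add: lie_bracket_def tangent_diff[OF Xm] tangent_diff[OF Ym] tangent_diff[OF Zm] vector_field_smooth[OF X] vector_field_smooth[OF Y] vector_field_smooth[OF Z])
  next
    case False
    have "W m f = 0" if "W \<in> vector_fields M" for W by (rule tangent_non_smooth[OF vector_field_at[OF that] False])
    note zero = this[OF lie_bracket_vector_field]
    show ?thesis
      using zero[OF X lie_bracket_vector_field[OF Y Z]] zero[OF lie_bracket_vector_field[OF X Y] Z]
        zero[OF Y lie_bracket_vector_field[OF X Z]] by simp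
  qed
qed

lemma one_form_at: "\<alpha> \<in> one_forms M \<Longrightarrow> \<alpha> m \<in> cotangent_space M m"
  and one_form_smooth: "\<alpha> \<in> one_forms M \<Longrightarrow> Y \<in> vector_fields M \<Longrightarrow> (\<lambda>m. \<alpha> m (Y m)) \<in> Cinf M"
  by (auto simp: one_forms_def)

text \<open>
  Every tangent vector is the value of a global vector field, so linearity needs to be tested on such values only.
\<close>

lemma cotangentI:
  assumes "\<And>v. v \<notin> tangent_space M m \<Longrightarrow> \<alpha> v = 0"
    and "\<And>X Y r s. X \<in> vector_fields M \<Longrightarrow> Y \<in> vector_fields M \<Longrightarrow>
      \<alpha> (\<lambda>f. r * X m f + s * Y m f) = r * \<alpha> (X m) + s * \<alpha> (Y m)"
  shows "\<alpha> \<in> cotangent_space M m"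
  unfolding cotangent_space_def
proof (intro CollectI conjI ballI allI impI)
  fix u v r s assume "u \<in> tangent_space M m" "v \<in> tangent_space M m"
  then obtain X Y where "X \<in> vector_fields M" "X m = u" "Y \<in> vector_fields M" "Y m = v"
    using vector_field_extension by meson
  then show "\<alpha> (\<lambda>f. r * u f + s * v f) = r * \<alpha> u + s * \<alpha> v" using assms(2)[of X Y r s] by simp
qed (rule assms(1))


section \<open>Tensoriality, the Lie derivative and the exterior derivative\<close>

text \<open>
  A functional that is linear over the smooth functions depends only on the value of the vector field at
  \<open>m\<close>: with a bump function \<open>\<eta>\<close> supported in the domain of a frame,
  \<open>T X = T (\<eta>\<^sup>2 X) = \<Sum>\<^sub>b X m (x b) T (\<eta> E\<^sub>b)\<close>. This is what makes the Lie derivative and the exterior derivative, which are defined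
  by extending vectors to vector fields, well defined.
\<close>

lemma tensorial:
  assumes add: "\<And>X Y g h. X \<in> vector_fields M \<Longrightarrow> Y \<in> vector_fields M \<Longrightarrow> g \<in> Cinf M \<Longrightarrow> h \<in> Cinf M \<Longrightarrow>
      T (\<lambda>p f. g p * X p f + h p * Y p f) = g m * T X + h m * T Y"
    and X: "X \<in> vector_fields M" and Y: "Y \<in> vector_fields M" and eq: "X m = Y m"
  shows "T X = (T Y :: real)"
proof -
  obtain U c B N x E where fr: "chart_frame U c B N x E" "m \<in> N" using chart_frame_exists by blast
  note f = chart_frameD[OF fr(1)]
  obtain \<eta> K N' where \<eta>: "\<eta> \<in> Cinf M" "K \<subseteq> N" "m \<in> N'" "\<forall>q\<in>N'. \<eta> q = 1" "\<forall>q. q \<notin> K \<longrightarrow> \<eta> q = 0"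
    using bump_exists[OF f(3) fr(2)] by blast
  have scale: "T (\<lambda>p f. g p * Z p f) = g m * T Z" if "Z \<in> vector_fields M" "g \<in> Cinf M" for g Z
    using add[of Z Z g "\<lambda>p. 0"] that Cinf_const by simp
  have zero: "T (\<lambda>p f. 0) = 0" using scale[OF vector_field_zero, of "\<lambda>p. 0"] Cinf_const by simp
  have sum: "T (\<lambda>p f. \<Sum>i\<in>I. g i p * Z i p f) = (\<Sum>i\<in>I. g i m * T (Z i))"
    if "\<And>i. i \<in> I \<Longrightarrow> Z i \<in> vector_fields M" "\<And>i. i \<in> I \<Longrightarrow> g i \<in> Cinf M" for I g and Z :: "'e \<Rightarrow> 'm \<Rightarrow> 'm tvec"
    using that
  proof (induction I rule: infinite_finite_induct)
    case (insert i I)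
    have "(\<lambda>p f. \<Sum>i\<in>I. g i p * Z i p f) \<in> vector_fields M" by (rule vector_field_sum) (use insert in auto)
    then show ?case
      using add[of "Z i" "\<lambda>p f. \<Sum>i\<in>I. g i p * Z i p f" "g i" "\<lambda>p. 1"] insert Cinf_const by simp
  qed (simp_all add: zero)
  \<comment> \<open>Off \<open>K\<close> both sides of the expansion of \<open>\<eta>\<^sup>2 Z\<close> vanish, and on \<open>K\<close> the frame expands \<open>Z\<close>.\<close>
  have loc: "T Z = (\<Sum>b\<in>B. Z m (x b) * T (\<lambda>p f. \<eta> p * E b p f))" if Z: "Z \<in> vector_fields M" for Z
  proof -
    have "(\<lambda>p f. (\<eta> p * \<eta> p) * Z p f) = (\<lambda>p f. \<Sum>b\<in>B. (\<eta> p * Z p (x b)) * (\<eta> p * E b p f))"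
    proof (intro ext)
      fix p f
      show "(\<eta> p * \<eta> p) * Z p f = (\<Sum>b\<in>B. (\<eta> p * Z p (x b)) * (\<eta> p * E b p f))"
      proof (cases "p \<in> K")
        case True
        then have "Z p f = (\<Sum>b\<in>B. Z p (x b) * E b p f)"
          using f(11)[OF subsetD[OF \<eta>(2) True] vector_field_at[OF Z, of p]] by metis
        then show ?thesis by (simp add: sum_distrib_left mult_ac)
      qed (use \<eta>(5) in simp)
    qed
    moreover have "T (\<lambda>p f. (\<eta> p * \<eta> p) * Z p f) = T Z"
      using scale[OF Z Cinf_mult[OF \<eta>(1,1)]] \<eta>(3,4) by simp
    moreover have "T (\<lambda>p f. \<Sum>b\<in>B. (\<eta> p * Z p (x b)) * (\<eta> p * E b p f)) =
        (\<Sum>b\<in>B. (\<eta> m * Z m (x b)) * T (\<lambda>p f. \<eta> p * E b p f))"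
      by (rule sum[of B "\<lambda>b p f. \<eta> p * E b p f" "\<lambda>b p. \<eta> p * Z p (x b)"])
        (rule vector_field_scale[OF f(8) \<eta>(1)], assumption, rule Cinf_mult[OF \<eta>(1) vector_field_smooth[OF Z f(7)]])
    ultimately show ?thesis using \<eta>(3,4) by simp
  qed
  show ?thesis using loc[OF X] loc[OF Y] eq by simp
qed

lemma the_tensor:
  assumes "X \<in> vector_fields M" "\<And>Y. Y \<in> vector_fields M \<Longrightarrow> Y m = X m \<Longrightarrow> T Y = T X"
  shows "(THE r. \<forall>Y\<in>vector_fields M. Y m = X m \<longrightarrow> r = T Y) = T X"
proof (rule the_equality)
  show "\<forall>Y\<in>vector_fields M. Y m = X m \<longrightarrow> T X = T Y" using assms(2)[symmetric] by blast
  show "r = T X" if "\<forall>Y\<in>vector_fields M. Y m = X m \<longrightarrow> r = T Y" for r using that assms(1) by blast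
qed

text \<open>
  The expression on the right is linear over the smooth functions in \<open>Y\<close>: the terms that
  differentiate a coefficient cancel.
\<close>

lemma lie_derivative_eval:
  assumes X: "X \<in> vector_fields M" and \<alpha>: "\<alpha> \<in> one_forms M" and Y: "Y \<in> vector_fields M"
  shows "lie_derivative M X \<alpha> m (Y m) = X m (\<lambda>p. \<alpha> p (Y p)) - \<alpha> m (lie_bracket X Y m)"
proof -
  let ?T = "\<lambda>Y. X m (\<lambda>p. \<alpha> p (Y p)) - \<alpha> m (lie_bracket X Y m)"
  note Xm = vector_field_at[OF X, of m]
  have "?T Z = ?T Y" if Z: "Z \<in> vector_fields M" "Z m = Y m" for Z
  proof (rule tensorial[of ?T])
    fix Y Z g h assume Y: "Y \<in> vector_fields M" and Z: "Z \<in> vector_fields M" and g: "g \<in> Cinf M" and h: "h \<in> Cinf M"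
    have 1: "\<alpha> p (\<lambda>f. g p * Y p f + h p * Z p f) = g p * \<alpha> p (Y p) + h p * \<alpha> p (Z p)" for p
      by (rule cotangent_linear) (rule one_form_at[OF \<alpha>] vector_field_at[OF Y] vector_field_at[OF Z])+
    note T = vector_field_at[OF lie_bracket_vector_field[OF X Y], of m] vector_field_at[OF Y, of m]
      vector_field_at[OF lie_bracket_vector_field[OF X Z], of m] vector_field_at[OF Z, of m]
    have "X m (\<lambda>p. g p * \<alpha> p (Y p) + h p * \<alpha> p (Z p)) =
        (g m * X m (\<lambda>p. \<alpha> p (Y p)) + \<alpha> m (Y m) * X m g) + (h m * X m (\<lambda>p. \<alpha> p (Z p)) + \<alpha> m (Z m) * X m h)"
      using \<alpha> Y Z g h by (simp add: tangent_add[OF Xm] tangent_mult[OF Xm] Cinf_mult one_form_smooth[OF \<alpha>])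
    moreover have "\<alpha> m (lie_bracket X (\<lambda>p f. g p * Y p f + h p * Z p f) m) =
        (g m * \<alpha> m (lie_bracket X Y m) + X m g * \<alpha> m (Y m)) + (h m * \<alpha> m (lie_bracket X Z m) + X m h * \<alpha> m (Z m))"
      unfolding lie_bracket_lincomb_right[OF X Y Z g h]
        cotangent_add[OF one_form_at[OF \<alpha>] tangent_space_lincomb[OF T(1,2)] tangent_space_lincomb[OF T(3,4)]]
        cotangent_linear[OF one_form_at[OF \<alpha>] T(1,2)] cotangent_linear[OF one_form_at[OF \<alpha>] T(3,4)] ..
    ultimately show "?T (\<lambda>p f. g p * Y p f + h p * Z p f) = g m * ?T Y + h m * ?T Z"
      unfolding 1 by (simp add: algebra_simps)
  qed (use Z Y in auto)
  from the_tensor[of Y m ?T, OF Y this] show ?thesis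
    unfolding lie_derivative_def using vector_field_at[OF Y] by simp
qed

lemma lie_derivative_outside: "v \<notin> tangent_space M m \<Longrightarrow> lie_derivative M X \<alpha> m v = 0"
  by (simp add: lie_derivative_def)

lemma lie_derivative_one_form:
  assumes X: "X \<in> vector_fields M" and \<alpha>: "\<alpha> \<in> one_forms M"
  shows "lie_derivative M X \<alpha> \<in> one_forms M"
proof -
  have "lie_derivative M X \<alpha> m \<in> cotangent_space M m" for m
  proof (rule cotangentI)
    fix Y Z r s assume Y: "Y \<in> vector_fields M" and Z: "Z \<in> vector_fields M"
    let ?W = "\<lambda>p f. r * Y p f + s * Z p f"
    have W: "?W \<in> vector_fields M" by (rule vector_field_lincomb[OF Y Z Cinf_const Cinf_const])
    note Xm = vector_field_at[OF X, of m]
    have 1: "\<alpha> p (\<lambda>f. r * Y p f + s * Z p f) = r * \<alpha> p (Y p) + s * \<alpha> p (Z p)" for p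
      by (rule cotangent_linear) (rule one_form_at[OF \<alpha>] vector_field_at[OF Y] vector_field_at[OF Z])+
    have 2: "lie_bracket X ?W m = (\<lambda>f. r * lie_bracket X Y m f + s * lie_bracket X Z m f)"
      using lie_bracket_lincomb_right[OF X Y Z Cinf_const Cinf_const, of r s m] by (simp add: tangent_const[OF Xm])
    have "lie_derivative M X \<alpha> m (?W m) = X m (\<lambda>p. \<alpha> p (?W p)) - \<alpha> m (lie_bracket X ?W m)"
      by (rule lie_derivative_eval[OF X \<alpha> W])
    also have "\<dots> = r * lie_derivative M X \<alpha> m (Y m) + s * lie_derivative M X \<alpha> m (Z m)"
      unfolding 1 2 lie_derivative_eval[OF X \<alpha> Y] lie_derivative_eval[OF X \<alpha> Z] using \<alpha> Y Z X
      by (simp add: tangent_linear[OF Xm] one_form_smooth[OF \<alpha>] cotangent_linear[OF one_form_at]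
          vector_field_at lie_bracket_vector_field, (simp add: algebra_simps)?)
    finally show "lie_derivative M X \<alpha> m (\<lambda>f. r * Y m f + s * Z m f) =
        r * lie_derivative M X \<alpha> m (Y m) + s * lie_derivative M X \<alpha> m (Z m)" .
  qed (rule lie_derivative_outside)
  moreover have "(\<lambda>m. lie_derivative M X \<alpha> m (Y m)) \<in> Cinf M" if Y: "Y \<in> vector_fields M" for Y
    unfolding lie_derivative_eval[OF X \<alpha> Y]
    by (intro Cinf_diff vector_field_smooth[OF X] vector_field_smooth[OF Y] one_form_smooth[OF \<alpha>] X Y lie_bracket_vector_field)
  ultimately show ?thesis by (simp add: one_forms_def)
qed

text \<open>
  Tensoriality in \<open>Y\<close> follows from that of the Lie derivative, since
  \<open>d\<alpha>(X, Y) = (L\<^sub>X \<alpha>)(Y) - Y(\<alpha>(X))\<close>, and tensoriality in \<open>X\<close> follows by antisymmetry.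
\<close>

lemma ext_deriv_eval:
  assumes \<alpha>: "\<alpha> \<in> one_forms M" and X: "X \<in> vector_fields M" and Y: "Y \<in> vector_fields M"
  shows "ext_deriv M \<alpha> m (X m) (Y m) =
    X m (\<lambda>p. \<alpha> p (Y p)) - Y m (\<lambda>p. \<alpha> p (X p)) - \<alpha> m (lie_bracket X Y m)"
proof -
  let ?T = "\<lambda>X Y. X m (\<lambda>p. \<alpha> p (Y p)) - Y m (\<lambda>p. \<alpha> p (X p)) - \<alpha> m (lie_bracket X Y m)"
  have anti: "?T Y X = - ?T X Y" if "X \<in> vector_fields M" "Y \<in> vector_fields M" for X Y
  proof -
    have "\<alpha> m (lie_bracket Y X m) = - \<alpha> m (lie_bracket X Y m)"
      using cotangent_scale[OF one_form_at[OF \<alpha>], of "lie_bracket X Y m" m "-1"] that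
      by (subst lie_bracket_antisym) (simp add: vector_field_at[OF lie_bracket_vector_field])
    then show ?thesis by simp
  qed
  have right: "?T X Y = ?T X Z"
    if X: "X \<in> vector_fields M" and "Y \<in> vector_fields M" "Z \<in> vector_fields M" "Y m = Z m" for X Y Z
  proof (rule tensorial[of "?T X"])
    fix Y Z g h assume Y: "Y \<in> vector_fields M" and Z: "Z \<in> vector_fields M" and g: "g \<in> Cinf M" and h: "h \<in> Cinf M"
    have W: "(\<lambda>p f. g p * Y p f + h p * Z p f) \<in> vector_fields M" by (rule vector_field_lincomb[OF Y Z g h])
    have eq: "?T X Y = lie_derivative M X \<alpha> m (Y m) - Y m (\<lambda>p. \<alpha> p (X p))" if "Y \<in> vector_fields M" for Y
      using lie_derivative_eval[OF X \<alpha> that] by simp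
    show "?T X (\<lambda>p f. g p * Y p f + h p * Z p f) = g m * ?T X Y + h m * ?T X Z"
      unfolding eq[OF W] eq[OF Y] eq[OF Z]
      using cotangent_linear[OF one_form_at[OF lie_derivative_one_form[OF X \<alpha>]] vector_field_at[OF Y] vector_field_at[OF Z]]
      by (simp add: algebra_simps)
  qed (use that in auto)
  have all: "?T X' Y' = ?T X Y" if X': "X' \<in> vector_fields M" and Y': "Y' \<in> vector_fields M" and eq: "X' m = X m" "Y' m = Y m" for X' Y'
  proof -
    have "?T X' Y' = ?T X' Y" by (rule right[OF X' Y' Y eq(2)])
    also have "\<dots> = - ?T Y X'" by (rule anti[OF Y X'])
    also have "?T Y X' = ?T Y X" by (rule right[OF Y X' X eq(1)])
    also have "- \<dots> = ?T X Y" using anti[OF X Y] by linarith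
    finally show ?thesis .
  qed
  have "(THE r. \<forall>X'\<in>vector_fields M. \<forall>Y'\<in>vector_fields M. X' m = X m \<longrightarrow> Y' m = Y m \<longrightarrow> r = ?T X' Y') = ?T X Y"
  proof (rule the_equality)
    show "\<forall>X'\<in>vector_fields M. \<forall>Y'\<in>vector_fields M. X' m = X m \<longrightarrow> Y' m = Y m \<longrightarrow> ?T X Y = ?T X' Y'"
      by (intro ballI impI) (rule all[symmetric])
    show "r = ?T X Y"
      if "\<forall>X'\<in>vector_fields M. \<forall>Y'\<in>vector_fields M. X' m = X m \<longrightarrow> Y' m = Y m \<longrightarrow> r = ?T X' Y'" for r
      using that[rule_format, OF X Y refl refl] .
  qed
  then show ?thesis
    unfolding ext_deriv_def using vector_field_at[OF X] vector_field_at[OF Y] by simp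
qed

lemma ext_deriv_outside: "u \<notin> tangent_space M m \<or> v \<notin> tangent_space M m \<Longrightarrow> ext_deriv M \<alpha> m u v = 0"
  by (auto simp: ext_deriv_def)

text \<open>
  Cartan's formula \<open>i\<^sub>X d\<alpha> = L\<^sub>X \<alpha> - d (\<alpha>(X))\<close>.
\<close>

lemma ext_deriv_lie_derivative:
  assumes "\<alpha> \<in> one_forms M" "X \<in> vector_fields M" "Y \<in> vector_fields M"
  shows "ext_deriv M \<alpha> m (X m) (Y m) = lie_derivative M X \<alpha> m (Y m) - Y m (\<lambda>p. \<alpha> p (X p))"
  using ext_deriv_eval[OF assms] lie_derivative_eval[OF assms(2,1,3)] by simp

lemma ext_deriv_cotangent:
  assumes \<alpha>: "\<alpha> \<in> one_forms M"
  shows "ext_deriv M \<alpha> m u \<in> cotangent_space M m"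
proof (cases "u \<in> tangent_space M m")
  case True
  then obtain X where X: "X \<in> vector_fields M" "X m = u" using vector_field_extension by blast
  show ?thesis
  proof (rule cotangentI)
    fix Y Z r s assume Y: "Y \<in> vector_fields M" and Z: "Z \<in> vector_fields M"
    note W = vector_field_lincomb[OF Y Z Cinf_const Cinf_const, of r s]
    note e = ext_deriv_lie_derivative[OF \<alpha> X(1), of _ m, unfolded X(2)]
    show "ext_deriv M \<alpha> m u (\<lambda>f. r * Y m f + s * Z m f) = r * ext_deriv M \<alpha> m u (Y m) + s * ext_deriv M \<alpha> m u (Z m)"
      unfolding e[OF Y] e[OF Z] e[OF W]
        cotangent_linear[OF one_form_at[OF lie_derivative_one_form[OF X(1) \<alpha>]] vector_field_at[OF Y] vector_field_at[OF Z]]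
      by (simp add: algebra_simps)
  qed (simp add: ext_deriv_outside)
next
  case False
  then have "ext_deriv M \<alpha> m u = (\<lambda>v. 0)" by (auto simp: ext_deriv_outside)
  then show ?thesis by (simp add: cotangent_space_zero)
qed

lemma ext_deriv_antisym:
  assumes \<alpha>: "\<alpha> \<in> one_forms M"
  shows "ext_deriv M \<alpha> m u v = - ext_deriv M \<alpha> m v u"
proof (cases "u \<in> tangent_space M m \<and> v \<in> tangent_space M m")
  case True
  then obtain X Y where X: "X \<in> vector_fields M" "X m = u" and Y: "Y \<in> vector_fields M" "Y m = v"
    using vector_field_extension by meson
  have "\<alpha> m (lie_bracket Y X m) = - \<alpha> m (lie_bracket X Y m)"
    using cotangent_scale[OF one_form_at[OF \<alpha>], of "lie_bracket X Y m" m "-1"] X Y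
    by (subst lie_bracket_antisym) (simp add: vector_field_at[OF lie_bracket_vector_field])
  then show ?thesis using ext_deriv_eval[OF \<alpha> X(1) Y(1), of m] ext_deriv_eval[OF \<alpha> Y(1) X(1), of m] X Y by simp
qed (auto simp: ext_deriv_outside)

lemma ext_deriv_sum_left:
  assumes \<alpha>: "\<alpha> \<in> one_forms M" and "\<And>i. i \<in> I \<Longrightarrow> u i \<in> tangent_space M m"
  shows "ext_deriv M \<alpha> m (\<lambda>f. \<Sum>i\<in>I. r i * u i f) v = (\<Sum>i\<in>I. r i * ext_deriv M \<alpha> m (u i) v)"
proof -
  have "ext_deriv M \<alpha> m (\<lambda>f. \<Sum>i\<in>I. r i * u i f) v = - (\<Sum>i\<in>I. r i * ext_deriv M \<alpha> m v (u i))"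
    by (subst ext_deriv_antisym[OF \<alpha>]) (simp add: cotangent_sum[OF ext_deriv_cotangent[OF \<alpha>] assms(2)])
  also have "\<dots> = (\<Sum>i\<in>I. r i * ext_deriv M \<alpha> m (u i) v)"
    unfolding sum_negf[symmetric] by (rule sum.cong) (simp_all add: ext_deriv_antisym[OF \<alpha>, of m v])
  finally show ?thesis .
qed

lemma ext_deriv_lincomb_left:
  assumes \<alpha>: "\<alpha> \<in> one_forms M" and "u \<in> tangent_space M m" "w \<in> tangent_space M m"
  shows "ext_deriv M \<alpha> m (\<lambda>f. r * u f + s * w f) v = r * ext_deriv M \<alpha> m u v + s * ext_deriv M \<alpha> m w v"
  using cotangent_linear[OF ext_deriv_cotangent[OF \<alpha>] assms(2,3), of v r s] ext_deriv_antisym[OF \<alpha>, of m _ v]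
  by simp

lemma interior_d_one_form:
  assumes X: "X \<in> vector_fields M" and \<alpha>: "\<alpha> \<in> one_forms M"
  shows "interior_d M X \<alpha> \<in> one_forms M"
proof -
  have "(\<lambda>m. ext_deriv M \<alpha> m (X m) (Y m)) \<in> Cinf M" if Y: "Y \<in> vector_fields M" for Y
    unfolding ext_deriv_eval[OF \<alpha> X Y]
    by (intro Cinf_diff vector_field_smooth[OF X] vector_field_smooth[OF Y] one_form_smooth[OF \<alpha>] X Y lie_bracket_vector_field)
  moreover have "interior_d M X \<alpha> m \<in> cotangent_space M m" for m
    using ext_deriv_cotangent[OF \<alpha>, of m "X m"] by (simp add: interior_d_def[abs_def])
  ultimately show ?thesis by (simp add: one_forms_def interior_d_def)
qed

lemma one_form_lincomb:
  "\<alpha> \<in> one_forms M \<Longrightarrow> \<beta> \<in> one_forms M \<Longrightarrow> g \<in> Cinf M \<Longrightarrow> h \<in> Cinf M \<Longrightarrow>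
    (\<lambda>m v. g m * \<alpha> m v + h m * \<beta> m v) \<in> one_forms M"
  by (auto simp: one_forms_def cotangent_space_lincomb intro!: Cinf_add Cinf_mult)

lemma one_form_diff:
  "\<alpha> \<in> one_forms M \<Longrightarrow> \<beta> \<in> one_forms M \<Longrightarrow> (\<lambda>m v. \<alpha> m v - \<beta> m v) \<in> one_forms M"
  using one_form_lincomb[of \<alpha> \<beta> "\<lambda>p. 1" "\<lambda>p. -1"] Cinf_const by simp

lemma lie_derivative_lincomb_form:
  assumes X: "X \<in> vector_fields M" and \<alpha>: "\<alpha> \<in> one_forms M" and \<beta>: "\<beta> \<in> one_forms M"
    and g: "g \<in> Cinf M" and h: "h \<in> Cinf M"
  shows "lie_derivative M X (\<lambda>m v. g m * \<alpha> m v + h m * \<beta> m v) m v =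
    (g m * lie_derivative M X \<alpha> m v + X m g * \<alpha> m v) + (h m * lie_derivative M X \<beta> m v + X m h * \<beta> m v)"
proof (cases "v \<in> tangent_space M m")
  case True
  then obtain Y where Y: "Y \<in> vector_fields M" "Y m = v" using vector_field_extension by blast
  note Xm = vector_field_at[OF X, of m]
  have "lie_derivative M X (\<lambda>m v. g m * \<alpha> m v + h m * \<beta> m v) m (Y m) =
    (g m * lie_derivative M X \<alpha> m (Y m) + X m g * \<alpha> m (Y m)) + (h m * lie_derivative M X \<beta> m (Y m) + X m h * \<beta> m (Y m))"
    unfolding lie_derivative_eval[OF X one_form_lincomb[OF \<alpha> \<beta> g h] Y(1)]
      lie_derivative_eval[OF X \<alpha> Y(1)] lie_derivative_eval[OF X \<beta> Y(1)]
    using \<alpha> \<beta> Y(1) g h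
    by (simp add: tangent_add[OF Xm] tangent_mult[OF Xm] one_form_smooth[OF \<alpha>] one_form_smooth[OF \<beta>] Cinf_mult, (simp add: algebra_simps)?)
  then show ?thesis by (simp add: Y(2))
next
  case False
  then show ?thesis
    using cotangent_outside[OF one_form_at[OF \<alpha>] False] cotangent_outside[OF one_form_at[OF \<beta>] False]
    by (simp add: lie_derivative_outside)
qed

lemma lie_derivative_lincomb_field:
  assumes X: "X \<in> vector_fields M" and Y: "Y \<in> vector_fields M" and \<alpha>: "\<alpha> \<in> one_forms M"
  shows "lie_derivative M (\<lambda>p f. r * X p f + s * Y p f) \<alpha> m v =
    r * lie_derivative M X \<alpha> m v + s * lie_derivative M Y \<alpha> m v"
proof (cases "v \<in> tangent_space M m")
  case True
  then obtain Z where Z: "Z \<in> vector_fields M" "Z m = v" using vector_field_extension by blast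
  note W = vector_field_lincomb[OF X Y Cinf_const Cinf_const, of r s]
  have "lie_bracket (\<lambda>p f. r * X p f + s * Y p f) Z m = (\<lambda>f. r * lie_bracket X Z m f + s * lie_bracket Y Z m f)"
    by (rule lie_bracket_lincomb_left[OF X Y Z(1)])
  then have "lie_derivative M (\<lambda>p f. r * X p f + s * Y p f) \<alpha> m (Z m) =
      r * lie_derivative M X \<alpha> m (Z m) + s * lie_derivative M Y \<alpha> m (Z m)"
    unfolding lie_derivative_eval[OF X \<alpha> Z(1)] lie_derivative_eval[OF Y \<alpha> Z(1)] lie_derivative_eval[OF W \<alpha> Z(1)]
    using X Y Z(1) \<alpha>
    by (simp add: cotangent_linear[OF one_form_at] vector_field_at lie_bracket_vector_field, (simp add: algebra_simps)?)
  then show ?thesis by (simp add: Z(2))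
qed (simp add: lie_derivative_outside)

lemma interior_d_lincomb_form:
  assumes X: "X \<in> vector_fields M" and \<alpha>: "\<alpha> \<in> one_forms M" and \<beta>: "\<beta> \<in> one_forms M"
  shows "interior_d M X (\<lambda>m v. r * \<alpha> m v + s * \<beta> m v) m v = r * interior_d M X \<alpha> m v + s * interior_d M X \<beta> m v"
proof (cases "v \<in> tangent_space M m")
  case True
  then obtain Y where Y: "Y \<in> vector_fields M" "Y m = v" using vector_field_extension by blast
  note Xm = vector_field_at[OF X, of m]
  note Ym = vector_field_at[OF Y(1), of m]
  have "ext_deriv M (\<lambda>m v. r * \<alpha> m v + s * \<beta> m v) m (X m) (Y m) =
     r * ext_deriv M \<alpha> m (X m) (Y m) + s * ext_deriv M \<beta> m (X m) (Y m)"
    unfolding ext_deriv_eval[OF one_form_lincomb[OF \<alpha> \<beta> Cinf_const Cinf_const] X Y(1)]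
      ext_deriv_eval[OF \<alpha> X Y(1)] ext_deriv_eval[OF \<beta> X Y(1)]
    using \<alpha> \<beta> X Y(1)
    by (simp add: tangent_linear[OF Xm] tangent_linear[OF Ym] one_form_smooth[OF \<alpha>] one_form_smooth[OF \<beta>], (simp add: algebra_simps)?)
  then show ?thesis by (simp add: Y(2) interior_d_def)
qed (simp add: interior_d_def ext_deriv_outside)


section \<open>Commutation relations of the Cartan operations\<close>

text \<open>
  The relation \<open>[L\<^sub>X, L\<^sub>Y] = L\<^sub>[\<^sub>X\<^sub>,\<^sub>Y\<^sub>]\<close>, by evaluation on a vector field and the Jacobi identity.
\<close>

lemma lie_derivative_commutator:
  assumes X: "X \<in> vector_fields M" and Y: "Y \<in> vector_fields M" and \<gamma>: "\<gamma> \<in> one_forms M"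
  shows "lie_derivative M X (lie_derivative M Y \<gamma>) m v =
    lie_derivative M (lie_bracket X Y) \<gamma> m v + lie_derivative M Y (lie_derivative M X \<gamma>) m v"
proof (cases "v \<in> tangent_space M m")
  case True
  then obtain Z where Z: "Z \<in> vector_fields M" "Z m = v" using vector_field_extension by blast
  note vf = lie_bracket_vector_field X Y Z(1)
  note Xm = vector_field_at[OF X, of m]
  note Ym = vector_field_at[OF Y, of m]
  have jac: "\<gamma> m (lie_bracket X (lie_bracket Y Z) m) =
      \<gamma> m (lie_bracket (lie_bracket X Y) Z m) + \<gamma> m (lie_bracket Y (lie_bracket X Z) m)"
    unfolding lie_bracket_jacobi[OF X Y Z(1)]
    by (rule cotangent_add[OF one_form_at[OF \<gamma>]]) (rule vector_field_at, intro vf)+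
  have "lie_derivative M X (lie_derivative M Y \<gamma>) m (Z m) =
    lie_derivative M (lie_bracket X Y) \<gamma> m (Z m) + lie_derivative M Y (lie_derivative M X \<gamma>) m (Z m)"
    using \<gamma> vf jac
    by (simp add: lie_derivative_eval lie_derivative_one_form tangent_diff[OF Xm] tangent_diff[OF Ym]
        one_form_smooth[OF \<gamma>] vector_field_smooth[OF X] vector_field_smooth[OF Y] vector_field_smooth[OF Z(1)] lie_bracket_apply)
  then show ?thesis by (simp add: Z(2))
qed (simp add: lie_derivative_outside)

text \<open>
  The relation \<open>L\<^sub>X i\<^sub>W d = i\<^sub>[\<^sub>X\<^sub>,\<^sub>W\<^sub>] d + i\<^sub>W d L\<^sub>X\<close>, again by evaluation on a vector field.
\<close>

lemma lie_derivative_interior_d: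
  assumes X: "X \<in> vector_fields M" and W: "W \<in> vector_fields M" and \<beta>: "\<beta> \<in> one_forms M"
  shows "lie_derivative M X (interior_d M W \<beta>) m v =
    interior_d M (lie_bracket X W) \<beta> m v + interior_d M W (lie_derivative M X \<beta>) m v"
proof (cases "v \<in> tangent_space M m")
  case True
  then obtain Z where Z: "Z \<in> vector_fields M" "Z m = v" using vector_field_extension by blast
  note vf = lie_bracket_vector_field X W Z(1)
  note Xm = vector_field_at[OF X, of m]
  note Wm = vector_field_at[OF W, of m]
  note Zm = vector_field_at[OF Z(1), of m]
  have jac: "\<beta> m (lie_bracket X (lie_bracket W Z) m) =
      \<beta> m (lie_bracket (lie_bracket X W) Z m) + \<beta> m (lie_bracket W (lie_bracket X Z) m)"
    unfolding lie_bracket_jacobi[OF X W Z(1)]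
    by (rule cotangent_add[OF one_form_at[OF \<beta>]]) (rule vector_field_at, intro vf)+
  have "lie_derivative M X (interior_d M W \<beta>) m (Z m) =
    X m (\<lambda>p. ext_deriv M \<beta> p (W p) (Z p)) - ext_deriv M \<beta> m (W m) (lie_bracket X Z m)"
    using lie_derivative_eval[OF X interior_d_one_form[OF W \<beta>] Z(1)] by (simp add: interior_d_def)
  also have "\<dots> = ext_deriv M \<beta> m (lie_bracket X W m) (Z m) + ext_deriv M (lie_derivative M X \<beta>) m (W m) (Z m)"
    using \<beta> vf jac
    by (simp add: ext_deriv_eval lie_derivative_eval lie_derivative_one_form
        tangent_diff[OF Xm] tangent_diff[OF Wm] tangent_diff[OF Zm] Cinf_diff
        one_form_smooth[OF \<beta>] vector_field_smooth[OF X] vector_field_smooth[OF W] vector_field_smooth[OF Z(1)] lie_bracket_apply)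
  finally show ?thesis by (simp add: Z(2) interior_d_def)
qed (simp add: lie_derivative_outside interior_d_def ext_deriv_outside)

text \<open>
  The relation \<open>d i\<^sub>Y d = d L\<^sub>Y\<close>: the forms \<open>i\<^sub>Y d\<alpha>\<close> and \<open>L\<^sub>Y \<alpha>\<close> differ by the exact form \<open>d (\<alpha>(Y))\<close>, whose
  exterior derivative vanishes.
\<close>

lemma interior_d_interior_d:
  assumes W: "W \<in> vector_fields M" and Y: "Y \<in> vector_fields M" and \<alpha>: "\<alpha> \<in> one_forms M"
  shows "interior_d M W (interior_d M Y \<alpha>) m v = interior_d M W (lie_derivative M Y \<alpha>) m v"
proof (cases "v \<in> tangent_space M m")
  case True
  then obtain Z where Z: "Z \<in> vector_fields M" "Z m = v" using vector_field_extension by blast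
  note vf = lie_bracket_vector_field W Y Z(1)
  note Wm = vector_field_at[OF W, of m]
  note Zm = vector_field_at[OF Z(1), of m]
  have i: "interior_d M Y \<alpha> p (V p) = lie_derivative M Y \<alpha> p (V p) - V p (\<lambda>p. \<alpha> p (Y p))" if "V \<in> vector_fields M" for V p
    using ext_deriv_lie_derivative[OF \<alpha> Y that] by (simp add: interior_d_def)
  have "ext_deriv M (interior_d M Y \<alpha>) m (W m) (Z m) = ext_deriv M (lie_derivative M Y \<alpha>) m (W m) (Z m)"
    using vf \<alpha>
    by (simp add: ext_deriv_eval interior_d_one_form lie_derivative_one_form i
        tangent_diff[OF Wm] tangent_diff[OF Zm] one_form_smooth[OF \<alpha>] one_form_smooth[OF lie_derivative_one_form[OF Y \<alpha>]] vector_field_smooth[OF Y] vector_field_smooth[OF W] vector_field_smooth[OF Z(1)] lie_bracket_apply)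
  then show ?thesis by (simp add: Z(2) interior_d_def)
qed (simp add: interior_d_def ext_deriv_outside)

end


section \<open>Time-dependent vector fields and one-forms\<close>

text \<open>
  Smooth one-parameter families of vector fields and of one-forms. Up to the condition at time zero they are
  the components of the sections of the bundle of cotangent paths; see \<open>path_sections_iff\<close>.
\<close>

definition time_fields :: "('m, 'e::euclidean_space) manifold \<Rightarrow> (real \<Rightarrow> 'm \<Rightarrow> 'm tvec) set" where
  "time_fields M = {Y. (\<forall>t\<in>{0..1}. Y t \<in> vector_fields M) \<and>
     (\<forall>f\<in>Cinf M. smooth_family_on M UNIV (\<lambda>p t. Y t p f))}"

definition time_forms :: "('m, 'e::euclidean_space) manifold \<Rightarrow> (real \<Rightarrow> 'm \<Rightarrow> 'm covec) set" where
  "time_forms M = {\<beta>. (\<forall>t\<in>{0..1}. \<beta> t \<in> one_forms M) \<and>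
     (\<forall>Z\<in>vector_fields M. smooth_family_on M UNIV (\<lambda>p t. \<beta> t p (Z p)))}"

abbreviation velocity :: "(real \<Rightarrow> 'm \<Rightarrow> 'm tvec) \<Rightarrow> real \<Rightarrow> 'm \<Rightarrow> 'm tvec" where
  "velocity Y t p \<equiv> path_velocity (\<lambda>s. Y s p) t"

abbreviation integral_form :: "(real \<Rightarrow> 'm \<Rightarrow> 'm covec) \<Rightarrow> 'm \<Rightarrow> 'm covec" where
  "integral_form \<beta> p \<equiv> path_integral (\<lambda>s. \<beta> s p)"

context mfd
begin

lemma family_Cinf: "smooth_family_on M UNIV F \<Longrightarrow> t \<in> {0..1} \<Longrightarrow> (\<lambda>p. F p t) \<in> Cinf M"
  by (rule CinfI, rule family_at) auto

lemma Cinf_family: "open V \<Longrightarrow> f \<in> Cinf M \<Longrightarrow> smooth_family_on M V (\<lambda>p t. f p)"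
  by (intro family_const CinfD)

lemma tangent_chart:
  assumes "v \<in> tangent_space M m"
  shows "\<exists>U c B r. (U, c) \<in> atlas M \<and> m \<in> U \<and> finite B \<and> (\<forall>b\<in>B. b \<in> model M) \<and>
    (\<forall>f\<in>Cinf M. v f = (\<Sum>b\<in>B. r b * chart_partial U c b f m))"
proof -
  obtain U c B N x E where fr: "chart_frame U c B N x E" "m \<in> N" using chart_frame_exists by blast
  note f = chart_frameD[OF fr(1)]
  have "v f = (\<Sum>b\<in>B. v (x b) * chart_partial U c b f m)" if "f \<in> Cinf M" for f
  proof -
    have "v f = (\<Sum>b\<in>B. v (x b) * E b m f)" using fun_cong[OF f(11)[OF fr(2) assms], of f] .
    then show ?thesis using f(9)[OF fr(2) _ that] by simp
  qed
  then show ?thesis using f(1,4,5,6) fr(2)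
    by (intro exI[of _ U] exI[of _ c] exI[of _ B] exI[of _ "\<lambda>b. v (x b)"]) auto
qed

lemma chart_partial_slice_continuous:
  assumes "(U, c) \<in> atlas M" "m \<in> U" "b \<in> model M" "smooth_family_on M UNIV F"
  shows "continuous_on {0..1} (\<lambda>t. chart_partial U c b (\<lambda>q. F q t) m)"
proof -
  note U = chart_open[OF assms(1)]
  have "smooth_family_on M U F" by (rule family_subset[OF _ U _ assms(4)]) auto
  from family_slice[OF U family_chart_partial[OF assms(1) U order_refl assms(3) this] assms(2)]
  show ?thesis by (rule smooth_on_continuous)
qed

text \<open>
  In a chart, a tangent vector is a combination of partial derivatives, and these commute with the integral.
\<close>

lemma tangent_integral:
  assumes v: "v \<in> tangent_space M m" and F: "smooth_family_on M UNIV F"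
  shows "v (\<lambda>q. integral {0..1} (F q)) = integral {0..1} (\<lambda>t. v (\<lambda>q. F q t))"
proof -
  obtain U c B r where U: "(U, c) \<in> atlas M" "m \<in> U" "finite B" "\<And>b. b \<in> B \<Longrightarrow> b \<in> model M"
    and eq: "\<And>f. f \<in> Cinf M \<Longrightarrow> v f = (\<Sum>b\<in>B. r b * chart_partial U c b f m)"
    using tangent_chart[OF v] by blast
  have int: "(\<lambda>q. integral {0..1} (F q)) \<in> Cinf M" by (rule CinfI[OF family_integral[OF open_UNIV F]])
  have "integral {0..1} (\<lambda>t. v (\<lambda>q. F q t)) =
      integral {0..1} (\<lambda>t. \<Sum>b\<in>B. r b * chart_partial U c b (\<lambda>q. F q t) m)"
    by (rule integral_cong) (rule eq[OF family_Cinf[OF F]])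
  also have "\<dots> = (\<Sum>b\<in>B. integral {0..1} (\<lambda>t. r b * chart_partial U c b (\<lambda>q. F q t) m))"
    by (rule integral_sum[OF U(3)])
      (intro integrable_continuous_real continuous_on_mult continuous_on_const
        chart_partial_slice_continuous[OF U(1,2,4) F])
  also have "\<dots> = (\<Sum>b\<in>B. r b * chart_partial U c b (\<lambda>q. integral {0..1} (F q)) m)"
    using chart_partial_integral[OF U(1) open_UNIV U(2) UNIV_I U(4) F] by simp
  finally show ?thesis using eq[OF int] by simp
qed

lemma tangent_velocity:
  assumes v: "v \<in> tangent_space M m" and F: "smooth_family_on M UNIV F" and t: "t \<in> {0..1}"
  shows "((\<lambda>t. v (\<lambda>q. F q t)) has_vector_derivative
    v (\<lambda>q. vector_derivative (F q) (at t within {0..1}))) (at t within {0..1})"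
proof -
  obtain U c B r where U: "(U, c) \<in> atlas M" "m \<in> U" "finite B" "\<And>b. b \<in> B \<Longrightarrow> b \<in> model M"
    and eq: "\<And>f. f \<in> Cinf M \<Longrightarrow> v f = (\<Sum>b\<in>B. r b * chart_partial U c b f m)"
    using tangent_chart[OF v] by blast
  have "((\<lambda>t. \<Sum>b\<in>B. r b * chart_partial U c b (\<lambda>q. F q t) m) has_vector_derivative
    (\<Sum>b\<in>B. r b * chart_partial U c b (\<lambda>q. vector_derivative (F q) (at t within {0..1})) m)) (at t within {0..1})"
    using chart_partial_velocity[OF U(1) open_UNIV U(2) UNIV_I U(4) F t]
    unfolding has_real_derivative_iff_has_vector_derivative[symmetric]
    by (intro DERIV_sum DERIV_cmult)
  also have "(\<Sum>b\<in>B. r b * chart_partial U c b (\<lambda>q. vector_derivative (F q) (at t within {0..1})) m) =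
      v (\<lambda>q. vector_derivative (F q) (at t within {0..1}))"
    by (rule eq[OF family_Cinf[OF family_velocity[OF open_UNIV F] t], symmetric])
  finally show ?thesis
    by (rule has_vector_derivative_transform[OF t, rotated]) (rule eq[OF family_Cinf[OF F]])
qed

text \<open>
  On the domain of a frame, \<open>X\<close> is a combination with smooth coefficients of partial derivatives.
\<close>

lemma vector_field_family:
  assumes X: "X \<in> vector_fields M" and F: "smooth_family_on M UNIV F"
  shows "smooth_family_on M UNIV (\<lambda>p t. X p (\<lambda>q. F q t))"
proof (rule family_local)
  fix m :: 'm
  obtain U c B N x E where fr: "chart_frame U c B N x E" "m \<in> N" using chart_frame_exists by blast
  note f = chart_frameD[OF fr(1)]
  have F': "smooth_family_on M N F" by (rule family_subset[OF _ f(3) _ F]) auto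
  have "smooth_family_on M N (\<lambda>p t. \<Sum>b\<in>B. X p (x b) * chart_partial U c b (\<lambda>q. F q t) p)"
    by (intro family_sum family_mult f(3) Cinf_family vector_field_smooth[OF X] f(7)
        family_chart_partial[OF f(1,3,4) f(6) F'])
  then have "smooth_family_on M N (\<lambda>p t. X p (\<lambda>q. F q t))"
  proof (rule iffD1[OF family_cong, rotated])
    fix p t assume p: "p \<in> N" and t: "t \<in> {0..1::real}"
    have "X p (\<lambda>q. F q t) = (\<Sum>b\<in>B. X p (x b) * E b p (\<lambda>q. F q t))"
      using fun_cong[OF f(11)[OF p vector_field_at[OF X]], of "\<lambda>q. F q t"] .
    then show "(\<Sum>b\<in>B. X p (x b) * chart_partial U c b (\<lambda>q. F q t) p) = X p (\<lambda>q. F q t)"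
      using f(9)[OF p _ family_Cinf[OF F t]] by simp
  qed
  then show "\<exists>N. open N \<and> m \<in> N \<and> smooth_family_on M N (\<lambda>p t. X p (\<lambda>q. F q t))"
    using f(3) fr(2) by blast
qed simp

lemma time_fieldD:
  assumes "Y \<in> time_fields M"
  shows "t \<in> {0..1} \<Longrightarrow> Y t \<in> vector_fields M" "f \<in> Cinf M \<Longrightarrow> smooth_family_on M UNIV (\<lambda>p t. Y t p f)"
  using assms by (simp_all add: time_fields_def)

lemma time_formD:
  assumes "\<beta> \<in> time_forms M"
  shows "t \<in> {0..1} \<Longrightarrow> \<beta> t \<in> one_forms M" "Z \<in> vector_fields M \<Longrightarrow> smooth_family_on M UNIV (\<lambda>p t. \<beta> t p (Z p))"
  using assms by (simp_all add: time_forms_def)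

text \<open>
  For a function \<open>f\<close> that is not smooth all \<open>Y s p f\<close> with \<open>s\<close> in the unit interval vanish by
  convention, so that the formula holds for every \<open>f\<close>.
\<close>

lemma has_velocity:
  assumes Y: "Y \<in> time_fields M" and t: "t \<in> {0..1}"
  shows "((\<lambda>s. Y s p f) has_vector_derivative velocity Y t p f) (at t within {0..1})"
proof (cases "f \<in> Cinf M")
  case True
  from family_slice_differentiable[OF open_UNIV time_fieldD(2)[OF Y True] UNIV_I t]
  show ?thesis by (simp add: path_velocity_def)
next
  case False
  have zero: "((\<lambda>s. Y s p f) has_vector_derivative 0) (at t within {0..1})"
  proof (rule has_vector_derivative_transform[OF t, where f = "\<lambda>s. 0"])
    show "Y s p f = 0" if "s \<in> {0..1}" for s
      by (rule tangent_non_smooth[OF vector_field_at[OF time_fieldD(1)[OF Y that]] False])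
  qed simp
  then show ?thesis using unit_vector_derivative[OF zero t] by (simp add: path_velocity_def)
qed

lemma velocity_eqI:
  assumes "t \<in> {0..1}" "\<And>f. ((\<lambda>s. Y s p f) has_vector_derivative d f) (at t within {0..1})"
  shows "velocity Y t p = d"
  using unit_vector_derivative[OF assms(2,1)] by (auto simp: path_velocity_def)

lemma velocity_lincomb:
  assumes "Y \<in> time_fields M" "Z \<in> time_fields M" "t \<in> {0..1}"
  shows "velocity (\<lambda>s p f. g p * Y s p f + h p * Z s p f) t p = (\<lambda>f. g p * velocity Y t p f + h p * velocity Z t p f)"
  by (rule velocity_eqI[OF assms(3)])
    (use has_velocity[OF assms(1,3)] has_velocity[OF assms(2,3)] in
      \<open>auto simp: has_real_derivative_iff_has_vector_derivative[symmetric] intro!: DERIV_add DERIV_cmult\<close>)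

lemma velocity_time_field:
  assumes Y: "Y \<in> time_fields M"
  shows "velocity Y \<in> time_fields M"
proof -
  have smooth: "smooth_family_on M UNIV (\<lambda>p t. velocity Y t p f)" if "f \<in> Cinf M" for f
    using family_velocity[OF open_UNIV time_fieldD(2)[OF Y that]] by (simp add: path_velocity_def)
  have "velocity Y t \<in> vector_fields M" if t: "t \<in> {0..1}" for t
  proof -
    have uniq: "velocity Y t p f = d" if "((\<lambda>s. Y s p f) has_vector_derivative d) (at t within {0..1})" for p f d
      using unit_vector_derivative[OF that t] by (simp add: path_velocity_def)
    note d = has_velocity[OF Y t, unfolded has_real_derivative_iff_has_vector_derivative[symmetric]]
    note T = vector_field_at[OF time_fieldD(1)[OF Y]]
    have "velocity Y t p \<in> tangent_space M p" for p
      unfolding tangent_space_def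
    proof (intro CollectI conjI allI impI ballI)
      fix f assume f: "f \<notin> Cinf M"
      show "velocity Y t p f = 0"
        by (rule uniq, rule has_vector_derivative_transform[OF t, where f = "\<lambda>s. 0"])
          (simp_all add: tangent_non_smooth[OF T f])
    next
      fix f g a b assume f: "f \<in> Cinf M" and g: "g \<in> Cinf M"
      show "velocity Y t p (\<lambda>q. a * f q + b * g q) = a * velocity Y t p f + b * velocity Y t p g"
      proof (rule uniq, rule has_vector_derivative_transform[OF t])
        show "Y s p (\<lambda>q. a * f q + b * g q) = a * Y s p f + b * Y s p g" if "s \<in> {0..1}" for s
          by (rule tangent_linear[OF T[OF that] f g])
        show "((\<lambda>s. a * Y s p f + b * Y s p g) has_vector_derivative a * velocity Y t p f + b * velocity Y t p g)
            (at t within {0..1})"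
          unfolding has_real_derivative_iff_has_vector_derivative[symmetric] by (intro DERIV_add DERIV_cmult d)
      qed
    next
      fix f g assume f: "f \<in> Cinf M" and g: "g \<in> Cinf M"
      show "velocity Y t p (\<lambda>q. f q * g q) = f p * velocity Y t p g + g p * velocity Y t p f"
      proof (rule uniq, rule has_vector_derivative_transform[OF t])
        show "Y s p (\<lambda>q. f q * g q) = f p * Y s p g + g p * Y s p f" if "s \<in> {0..1}" for s
          by (rule tangent_mult[OF T[OF that] f g])
        show "((\<lambda>s. f p * Y s p g + g p * Y s p f) has_vector_derivative f p * velocity Y t p g + g p * velocity Y t p f)
            (at t within {0..1})"
          unfolding has_real_derivative_iff_has_vector_derivative[symmetric] by (intro DERIV_add DERIV_cmult d)
      qed
    qed
    then show ?thesis using family_Cinf[OF smooth t] by (simp add: vector_fields_def)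
  qed
  then show ?thesis using smooth by (simp add: time_fields_def)
qed

lemma lie_bracket_time_field:
  assumes X: "X \<in> vector_fields M" and Y: "Y \<in> time_fields M"
  shows "(\<lambda>t. lie_bracket X (Y t)) \<in> time_fields M"
proof -
  have "smooth_family_on M UNIV (\<lambda>p t. lie_bracket X (Y t) p f)" if "f \<in> Cinf M" for f
    unfolding lie_bracket_apply
    by (intro family_diff open_UNIV vector_field_family[OF X] time_fieldD(2)[OF Y] that vector_field_smooth[OF X])
  then show ?thesis using lie_bracket_vector_field[OF X time_fieldD(1)[OF Y]] by (simp add: time_fields_def)
qed

text \<open>
  A vector field that does not depend on time commutes with the derivative in time; this is where the
  symmetry of mixed derivatives enters the Leibniz identity.
\<close>

lemma velocity_lie_bracket:
  assumes X: "X \<in> vector_fields M" and Y: "Y \<in> time_fields M" and t: "t \<in> {0..1}"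
  shows "velocity (\<lambda>s. lie_bracket X (Y s)) t p = lie_bracket X (velocity Y t) p"
proof
  fix f
  note V = time_fieldD(1)[OF velocity_time_field[OF Y] t]
  note L = time_fieldD(1)[OF velocity_time_field[OF lie_bracket_time_field[OF X Y]] t]
  show "velocity (\<lambda>s. lie_bracket X (Y s)) t p f = lie_bracket X (velocity Y t) p f"
  proof (cases "f \<in> Cinf M")
    case True
    have "((\<lambda>s. X p (\<lambda>q. Y s q f) - Y s p (\<lambda>q. X q f)) has_vector_derivative
        X p (\<lambda>q. velocity Y t q f) - velocity Y t p (\<lambda>q. X q f)) (at t within {0..1})"
      using tangent_velocity[OF vector_field_at[OF X] time_fieldD(2)[OF Y True] t, of p]
      by (intro has_vector_derivative_diff has_velocity[OF Y t]) (simp add: path_velocity_def)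
    from unit_vector_derivative[OF this t] show ?thesis by (simp add: path_velocity_def lie_bracket_apply)
  next
    case False
    show ?thesis
      using tangent_non_smooth[OF vector_field_at[OF L] False]
        tangent_non_smooth[OF vector_field_at[OF lie_bracket_vector_field[OF X V]] False] by simp
  qed
qed

lemma lie_derivative_time_form:
  assumes X: "X \<in> vector_fields M" and \<beta>: "\<beta> \<in> time_forms M"
  shows "(\<lambda>t. lie_derivative M X (\<beta> t)) \<in> time_forms M"
proof -
  have "smooth_family_on M UNIV (\<lambda>p t. lie_derivative M X (\<beta> t) p (Z p))" if Z: "Z \<in> vector_fields M" for Z
  proof (rule iffD1[OF family_cong])
    show "smooth_family_on M UNIV (\<lambda>p t. X p (\<lambda>q. \<beta> t q (Z q)) - \<beta> t p (lie_bracket X Z p))"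
      by (intro family_diff open_UNIV vector_field_family[OF X] time_formD(2)[OF \<beta>] Z lie_bracket_vector_field[OF X])
  qed (simp add: lie_derivative_eval[OF X time_formD(1)[OF \<beta>] Z])
  then show ?thesis using lie_derivative_one_form[OF X time_formD(1)[OF \<beta>]] by (simp add: time_forms_def)
qed

text \<open>
  Expanding \<open>Y\<^sub>t\<close> in a frame reduces the claim to the fixed vector fields of the frame.
\<close>

lemma interior_d_time_form:
  assumes Y: "Y \<in> time_fields M" and \<alpha>: "\<alpha> \<in> one_forms M"
  shows "(\<lambda>t. interior_d M (Y t) \<alpha>) \<in> time_forms M"
proof -
  have "smooth_family_on M UNIV (\<lambda>p t. interior_d M (Y t) \<alpha> p (Z p))" if Z: "Z \<in> vector_fields M" for Z
  proof (rule family_local)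
    fix m :: 'm
    obtain U c B N x E where fr: "chart_frame U c B N x E" "m \<in> N" using chart_frame_exists by blast
    note f = chart_frameD[OF fr(1)]
    have "smooth_family_on M N (\<lambda>p t. \<Sum>b\<in>B. Y t p (x b) * interior_d M (E b) \<alpha> p (Z p))"
      by (intro family_sum family_mult f(3) Cinf_family one_form_smooth[OF interior_d_one_form[OF _ \<alpha>] Z] f(8)
          family_subset[OF open_UNIV f(3) subset_UNIV time_fieldD(2)[OF Y f(7)]])
    then have "smooth_family_on M N (\<lambda>p t. interior_d M (Y t) \<alpha> p (Z p))"
    proof (rule iffD1[OF family_cong, rotated])
      fix p t assume p: "p \<in> N" and t: "t \<in> {0..1::real}"
      have "interior_d M (Y t) \<alpha> p (Z p) = ext_deriv M \<alpha> p (\<lambda>f. \<Sum>b\<in>B. Y t p (x b) * E b p f) (Z p)"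
        using f(11)[OF p vector_field_at[OF time_fieldD(1)[OF Y t]]] by (simp add: interior_d_def)
      also have "\<dots> = (\<Sum>b\<in>B. Y t p (x b) * ext_deriv M \<alpha> p (E b p) (Z p))"
        by (rule ext_deriv_sum_left[OF \<alpha> vector_field_at[OF f(8)]])
      finally show "(\<Sum>b\<in>B. Y t p (x b) * interior_d M (E b) \<alpha> p (Z p)) = interior_d M (Y t) \<alpha> p (Z p)"
        by (simp add: interior_d_def)
    qed
    then show "\<exists>N. open N \<and> m \<in> N \<and> smooth_family_on M N (\<lambda>p t. interior_d M (Y t) \<alpha> p (Z p))"
      using f(3) fr(2) by blast
  qed simp
  then show ?thesis using interior_d_one_form[OF time_fieldD(1)[OF Y] \<alpha>] by (simp add: time_forms_def)
qed

lemma time_form_diff: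
  assumes "\<beta> \<in> time_forms M" "\<gamma> \<in> time_forms M"
  shows "(\<lambda>t p v. \<beta> t p v - \<gamma> t p v) \<in> time_forms M"
  using assms unfolding time_forms_def by (auto intro!: one_form_diff family_diff)

lemma time_form_continuous:
  assumes "\<beta> \<in> time_forms M" "v \<in> tangent_space M p"
  shows "continuous_on {0..1} (\<lambda>t. \<beta> t p v)"
proof -
  obtain Z where Z: "Z \<in> vector_fields M" "Z p = v" using vector_field_extension[OF assms(2)] by blast
  from family_slice[OF open_UNIV time_formD(2)[OF assms(1) Z(1)] UNIV_I, of p] show ?thesis
    unfolding Z(2) by (rule smooth_on_continuous)
qed

lemma time_form_outside:
  assumes "\<beta> \<in> time_forms M" "v \<notin> tangent_space M p" "t \<in> {0..1}"
  shows "\<beta> t p v = 0"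
  by (rule cotangent_outside[OF one_form_at[OF time_formD(1)[OF assms(1,3)]] assms(2)])

lemma integral_form_lincomb:
  assumes \<beta>: "\<beta> \<in> time_forms M" and \<gamma>: "\<gamma> \<in> time_forms M"
  shows "integral_form (\<lambda>t p v. g p * \<beta> t p v + h p * \<gamma> t p v) p =
    (\<lambda>v. g p * integral_form \<beta> p v + h p * integral_form \<gamma> p v)"
proof
  fix v
  show "integral_form (\<lambda>t p v. g p * \<beta> t p v + h p * \<gamma> t p v) p v =
    g p * integral_form \<beta> p v + h p * integral_form \<gamma> p v"
  proof (cases "v \<in> tangent_space M p")
    case True
    then show ?thesis
      using time_form_continuous[OF \<beta> True] time_form_continuous[OF \<gamma> True]
      by (simp add: path_integral_def integral_add integrable_continuous_real continuous_on_mult_left)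
  next
    case False
    note 0 = time_form_outside[OF \<beta> False] time_form_outside[OF \<gamma> False]
    have "integral {0..1} (\<lambda>t. \<beta> t p v) = integral {0..1} (\<lambda>t::real. 0)" by (rule integral_cong) (rule 0(1))
    moreover have "integral {0..1} (\<lambda>t. \<gamma> t p v) = integral {0..1} (\<lambda>t::real. 0)" by (rule integral_cong) (rule 0(2))
    moreover have "integral {0..1} (\<lambda>t. g p * \<beta> t p v + h p * \<gamma> t p v) = integral {0..1} (\<lambda>t::real. 0)"
      by (rule integral_cong) (simp only: 0 mult_zero_right add_0)
    ultimately show ?thesis by (simp add: path_integral_def)
  qed
qed

lemma integral_form_one_form:
  assumes \<beta>: "\<beta> \<in> time_forms M"
  shows "integral_form \<beta> \<in> one_forms M"
proof -
  have "(\<lambda>p. integral_form \<beta> p (Z p)) \<in> Cinf M" if "Z \<in> vector_fields M" for Z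
    unfolding path_integral_def by (rule CinfI[OF family_integral[OF open_UNIV time_formD(2)[OF \<beta> that]]])
  moreover have "integral_form \<beta> p \<in> cotangent_space M p" for p
  proof (rule cotangentI)
    fix v assume out: "v \<notin> tangent_space M p"
    have "integral {0..1} (\<lambda>t. \<beta> t p v) = integral {0..1} (\<lambda>t::real. 0)"
      by (rule integral_cong) (rule time_form_outside[OF \<beta> out])
    then show "integral_form \<beta> p v = 0" by (simp add: path_integral_def)
  next
    fix X Y r s assume X: "X \<in> vector_fields M" and Y: "Y \<in> vector_fields M"
    have "integral {0..1} (\<lambda>t. \<beta> t p (\<lambda>f. r * X p f + s * Y p f)) =
        integral {0..1} (\<lambda>t. r * \<beta> t p (X p) + s * \<beta> t p (Y p))"
      by (intro integral_cong cotangent_linear[OF one_form_at[OF time_formD(1)[OF \<beta>]]] vector_field_at[OF X] vector_field_at[OF Y])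
    also have "\<dots> = r * integral {0..1} (\<lambda>t. \<beta> t p (X p)) + s * integral {0..1} (\<lambda>t. \<beta> t p (Y p))"
      using time_form_continuous[OF \<beta> vector_field_at[OF X]] time_form_continuous[OF \<beta> vector_field_at[OF Y]]
      by (simp add: integral_add integrable_continuous_real continuous_on_mult_left)
    finally show "integral_form \<beta> p (\<lambda>f. r * X p f + s * Y p f) = r * integral_form \<beta> p (X p) + s * integral_form \<beta> p (Y p)"
      by (simp add: path_integral_def)
  qed
  ultimately show ?thesis by (simp add: one_forms_def)
qed

text \<open>
  Applying a fixed tangent vector commutes with integration in time, and so does evaluation on a fixed bracket.
\<close>

lemma integral_lie_derivative:
  assumes X: "X \<in> vector_fields M" and \<beta>: "\<beta> \<in> time_forms M"
  shows "integral_form (\<lambda>t. lie_derivative M X (\<beta> t)) p v = lie_derivative M X (integral_form \<beta>) p v"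
proof (cases "v \<in> tangent_space M p")
  case True
  then obtain Z where Z: "Z \<in> vector_fields M" "Z p = v" using vector_field_extension by blast
  note F = time_formD(2)[OF \<beta> Z(1)]
  note L = lie_bracket_vector_field[OF X Z(1)]
  have "integral {0..1} (\<lambda>t. lie_derivative M X (\<beta> t) p (Z p)) =
      integral {0..1} (\<lambda>t. X p (\<lambda>q. \<beta> t q (Z q)) - \<beta> t p (lie_bracket X Z p))"
    by (rule integral_cong) (rule lie_derivative_eval[OF X time_formD(1)[OF \<beta>] Z(1)])
  also have "\<dots> = integral {0..1} (\<lambda>t. X p (\<lambda>q. \<beta> t q (Z q))) - integral {0..1} (\<lambda>t. \<beta> t p (lie_bracket X Z p))"
    by (intro integral_diff integrable_continuous_real time_form_continuous[OF \<beta> vector_field_at[OF L]]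
        smooth_on_continuous[OF family_slice[OF open_UNIV vector_field_family[OF X F] UNIV_I]])
  also have "\<dots> = lie_derivative M X (integral_form \<beta>) p (Z p)"
    unfolding lie_derivative_eval[OF X integral_form_one_form[OF \<beta>] Z(1)]
    by (simp add: path_integral_def tangent_integral[OF vector_field_at[OF X] F])
  finally show ?thesis by (simp add: Z(2) path_integral_def)
next
  case False
  then show ?thesis by (simp add: path_integral_def lie_derivative_outside)
qed

text \<open>
  The form \<open>i d\<alpha>\<close> is linear in the vector, so the integral of \<open>i d\<alpha>\<close> along the velocity is given by the
  fundamental theorem of calculus, applied to the coefficients of \<open>Y\<^sub>t\<close> in a frame. The lower end contributes nothing because
  \<open>Y\<^sub>0\<close> vanishes: this is the role of the condition \<open>X\<^sub>0 = 0\<close> on cotangent paths.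
\<close>

lemma integral_interior_d_velocity:
  assumes Y: "Y \<in> time_fields M" and \<alpha>: "\<alpha> \<in> one_forms M" and 0: "Y 0 p = (\<lambda>f. 0)"
  shows "integral_form (\<lambda>t. interior_d M (velocity Y t) \<alpha>) p v = interior_d M (Y 1) \<alpha> p v"
proof -
  obtain U c B N x E where fr: "chart_frame U c B N x E" "p \<in> N" using chart_frame_exists by blast
  note f = chart_frameD[OF fr(1)]
  have expand: "ext_deriv M \<alpha> p u v = (\<Sum>b\<in>B. u (x b) * ext_deriv M \<alpha> p (E b p) v)" if "u \<in> tangent_space M p" for u
    using ext_deriv_sum_left[OF \<alpha>, where I = B and r = "\<lambda>b. u (x b)" and u = "\<lambda>b. E b p" and m = p and v = v]
      vector_field_at[OF f(8)] f(11)[OF fr(2) that] by metis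
  have ftc: "((\<lambda>t. velocity Y t p g) has_integral Y 1 p g) {0..1}" for g
    using fundamental_theorem_of_calculus[of 0 1 "\<lambda>s. Y s p g" "\<lambda>t. velocity Y t p g"] has_velocity[OF Y] 0 by simp
  have "((\<lambda>t. \<Sum>b\<in>B. velocity Y t p (x b) * ext_deriv M \<alpha> p (E b p) v) has_integral
      (\<Sum>b\<in>B. Y 1 p (x b) * ext_deriv M \<alpha> p (E b p) v)) {0..1}"
    by (intro has_integral_sum f(5) has_integral_mult_left ftc)
  then have "integral {0..1} (\<lambda>t. \<Sum>b\<in>B. velocity Y t p (x b) * ext_deriv M \<alpha> p (E b p) v) =
      (\<Sum>b\<in>B. Y 1 p (x b) * ext_deriv M \<alpha> p (E b p) v)" by (rule integral_unique)
  moreover have "integral {0..1} (\<lambda>t. ext_deriv M \<alpha> p (velocity Y t p) v) =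
      integral {0..1} (\<lambda>t. \<Sum>b\<in>B. velocity Y t p (x b) * ext_deriv M \<alpha> p (E b p) v)"
    by (intro integral_cong expand vector_field_at[OF time_fieldD(1)[OF velocity_time_field[OF Y]]])
  ultimately show ?thesis
    using expand[OF vector_field_at[OF time_fieldD(1)[OF Y, of 1], of p]] by (simp add: path_integral_def interior_d_def)
qed

end


section \<open>The bracket of cotangent paths\<close>

abbreviation field_part :: "('m \<Rightarrow> 'm gpath) \<Rightarrow> real \<Rightarrow> 'm \<Rightarrow> 'm tvec" where
  "field_part a \<equiv> \<lambda>t p. fst (a p t)"

abbreviation form_part :: "('m \<Rightarrow> 'm gpath) \<Rightarrow> real \<Rightarrow> 'm \<Rightarrow> 'm covec" where
  "form_part a \<equiv> \<lambda>t p. snd (a p t)"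

lemma gvec_eqI: "(\<And>f. fst x f = fst y f) \<Longrightarrow> (\<And>v. snd x v = snd y v) \<Longrightarrow> x = (y :: 'm gvec)"
  by (auto simp: prod_eq_iff)

lemma gvec_simps [simp]:
  "fst gzero = (\<lambda>f. 0)" "snd gzero = (\<lambda>v. 0)"
  "fst (gadd x y) = (\<lambda>f. fst x f + fst y f)" "snd (gadd x y) = (\<lambda>v. snd x v + snd y v)"
  "fst (gscale r x) = (\<lambda>f. r * fst x f)" "snd (gscale r x) = (\<lambda>v. r * snd x v)"
  by (simp_all add: gzero_def gadd_def gscale_def)

lemma gscale_one [simp]: "gscale 1 x = x"
  and gscale_zero [simp]: "gscale 0 x = gzero"
  and gadd_zero [simp]: "gadd x gzero = x" "gadd gzero x = x"
  and gscale_gzero [simp]: "gscale r gzero = gzero"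
  by (simp_all add: prod_eq_iff)

context mfd
begin

lemma path_sections_iff:
  "a \<in> sections (cotangent_paths M) \<longleftrightarrow>
    (\<forall>p t. t \<notin> {0..1} \<longrightarrow> a p t = gzero) \<and> field_part a \<in> time_fields M \<and> form_part a \<in> time_forms M \<and>
    (\<forall>p. fst (a p 0) = (\<lambda>f. 0))" (is "_ \<longleftrightarrow> ?R")
proof
  assume "a \<in> sections (cotangent_paths M)"
  then have mem: "\<And>p. a p \<in> carrier (path_fibre M p)"
    and sm: "\<And>f. f \<in> Cinf M \<Longrightarrow> smooth_family_on M UNIV (\<lambda>p t. fst (a p t) f)"
      "\<And>Y. Y \<in> vector_fields M \<Longrightarrow> smooth_family_on M UNIV (\<lambda>p t. snd (a p t) (Y p))"
    by (auto simp: sections_def cotangent_paths_def)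
  have T: "fst (a p t) \<in> tangent_space M p" "snd (a p t) \<in> cotangent_space M p" if "t \<in> {0..1}" for p t
    using mem[of p] that by (auto simp: path_fibre_def)
  have "field_part a \<in> time_fields M"
    using T(1) sm(1) family_Cinf[OF sm(1)] by (simp add: time_fields_def vector_fields_def)
  moreover have "form_part a \<in> time_forms M"
    using T(2) sm(2) family_Cinf[OF sm(2)] by (simp add: time_forms_def one_forms_def)
  ultimately show ?R using mem by (simp add: path_fibre_def)
next
  assume R: ?R
  then have X: "field_part a \<in> time_fields M" and \<alpha>: "form_part a \<in> time_forms M" by auto
  note X1 = time_fieldD(1)[OF X]
  note X2 = time_fieldD(2)[OF X]
  note A1 = time_formD(1)[OF \<alpha>]
  note A2 = time_formD(2)[OF \<alpha>]
  have "a p \<in> carrier (path_fibre M p)" for p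
  proof -
    have "smooth_on UNIV {0..1} (\<lambda>t. snd (a p t) v)" if v: "v \<in> tangent_space M p" for v
    proof -
      obtain Y where Y: "Y \<in> vector_fields M" "Y p = v" using vector_field_extension[OF v] by blast
      show ?thesis using family_slice[OF open_UNIV A2[OF Y(1)] UNIV_I, of p] by (simp add: Y(2))
    qed
    then show ?thesis
      using R vector_field_at[OF X1] one_form_at[OF A1] family_slice[OF open_UNIV X2 UNIV_I]
      by (simp add: path_fibre_def)
  qed
  moreover have "smooth_map_on M UNIV (\<lambda>p. p)" by (auto simp: smooth_map_on_def o_def intro: CinfD)
  ultimately show "a \<in> sections (cotangent_paths M)"
    using X2 A2 by (simp add: sections_def cotangent_paths_def)
qed

lemma path_sectionD:
  assumes "a \<in> sections (cotangent_paths M)"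
  shows "field_part a \<in> time_fields M" "form_part a \<in> time_forms M" "fst (a p 0) = (\<lambda>f. 0)"
    "t \<notin> {0..1} \<Longrightarrow> a p t = gzero" "(\<lambda>p. fst (a p 1)) \<in> vector_fields M"
    "integral_form (form_part a) \<in> one_forms M"
proof -
  note R = assms[unfolded path_sections_iff]
  show X: "field_part a \<in> time_fields M" and \<alpha>: "form_part a \<in> time_forms M" using R by auto
  show "fst (a p 0) = (\<lambda>f. 0)" "t \<notin> {0..1} \<Longrightarrow> a p t = gzero" using R by auto
  show "(\<lambda>p. fst (a p 1)) \<in> vector_fields M" using time_fieldD(1)[OF X, of 1] by simp
  show "integral_form (form_part a) \<in> one_forms M" by (rule integral_form_one_form[OF \<alpha>])
qed

lemma path_bracket_outside: "t \<notin> {0..1} \<Longrightarrow> path_bracket M a b p t = gzero"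
  unfolding path_bracket_def by (rule if_not_P)

lemma path_bracket_field:
  "t \<in> {0..1} \<Longrightarrow> field_part (path_bracket M a b) t = lie_bracket (field_part a 1) (field_part b t)"
  by (simp add: path_bracket_def fun_eq_iff)

lemma path_bracket_form:
  "t \<in> {0..1} \<Longrightarrow> form_part (path_bracket M a b) t =
    (\<lambda>p v. lie_derivative M (field_part a 1) (form_part b t) p v
      - interior_d M (velocity (field_part b) t) (integral_form (form_part a)) p v)"
  by (simp add: path_bracket_def fun_eq_iff)

lemma time_fields_cong:
  assumes "\<And>t. t \<in> {0..1} \<Longrightarrow> Y t = Z t"
  shows "Y \<in> time_fields M \<longleftrightarrow> Z \<in> time_fields M"
proof -
  have "smooth_family_on M UNIV (\<lambda>p t. Y t p f) \<longleftrightarrow> smooth_family_on M UNIV (\<lambda>p t. Z t p f)" for f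
    by (rule family_cong) (simp add: assms)
  then show ?thesis using assms by (simp add: time_fields_def)
qed

lemma time_forms_cong:
  assumes "\<And>t. t \<in> {0..1} \<Longrightarrow> \<beta> t = \<gamma> t"
  shows "\<beta> \<in> time_forms M \<longleftrightarrow> \<gamma> \<in> time_forms M"
proof -
  have "smooth_family_on M UNIV (\<lambda>p t. \<beta> t p (Z p)) \<longleftrightarrow> smooth_family_on M UNIV (\<lambda>p t. \<gamma> t p (Z p))" for Z
    by (rule family_cong) (simp add: assms)
  then show ?thesis using assms by (simp add: time_forms_def)
qed

lemma velocity_cong:
  assumes Z: "Z \<in> time_fields M" and t: "t \<in> {0..1}" and eq: "\<And>s. s \<in> {0..1} \<Longrightarrow> Y s p = Z s p"
  shows "velocity Y t p = velocity Z t p"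
proof (rule velocity_eqI[OF t])
  fix f
  show "((\<lambda>s. Y s p f) has_vector_derivative velocity Z t p f) (at t within {0..1})"
    by (rule has_vector_derivative_transform[OF t _ has_velocity[OF Z t]]) (simp add: eq)
qed

lemma integral_form_cong:
  "(\<And>t. t \<in> {0..1} \<Longrightarrow> \<beta> t p = \<gamma> t p) \<Longrightarrow> integral_form \<beta> p = integral_form \<gamma> p"
  by (auto simp: path_integral_def fun_eq_iff intro!: integral_cong)

lemma path_bracket_section:
  assumes a: "a \<in> sections (cotangent_paths M)" and b: "b \<in> sections (cotangent_paths M)"
  shows "path_bracket M a b \<in> sections (cotangent_paths M)"
  unfolding path_sections_iff
proof (intro conjI allI impI)
  note A = path_sectionD[OF a]
  note B = path_sectionD[OF b]
  show "field_part (path_bracket M a b) \<in> time_fields M"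
    by (rule iffD1[OF time_fields_cong lie_bracket_time_field[OF A(5) B(1)]]) (rule path_bracket_field[symmetric])
  have "(\<lambda>t p v. lie_derivative M (field_part a 1) (form_part b t) p v
      - interior_d M (velocity (field_part b) t) (integral_form (form_part a)) p v) \<in> time_forms M"
    by (rule time_form_diff[OF lie_derivative_time_form[OF A(5) B(2)]
          interior_d_time_form[OF velocity_time_field[OF B(1)] A(6)]])
  then show "form_part (path_bracket M a b) \<in> time_forms M"
    by (rule iffD1[OF time_forms_cong, rotated]) (rule path_bracket_form[symmetric])
  show "fst (path_bracket M a b p 0) = (\<lambda>f. 0)" for p
    using fun_cong[OF path_bracket_field[of 0 a b], of p] B(3)
    by (simp add: lie_bracket_def tangent_const[OF vector_field_at[OF A(5)]])
qed (rule path_bracket_outside)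

text \<open>
  The Lie derivative along \<open>X\<^sub>1\<close> commutes with integration, and the contraction with the velocity of \<open>Y\<close> integrates to
  the contraction with \<open>Y\<^sub>1\<close>.
\<close>

lemma path_bracket_integral_form:
  assumes a: "a \<in> sections (cotangent_paths M)" and b: "b \<in> sections (cotangent_paths M)"
  shows "integral_form (form_part (path_bracket M a b)) =
    (\<lambda>p v. lie_derivative M (field_part a 1) (integral_form (form_part b)) p v
      - interior_d M (field_part b 1) (integral_form (form_part a)) p v)"
proof
  fix p
  note A = path_sectionD[OF a]
  note B = path_sectionD[OF b]
  let ?L = "\<lambda>t. lie_derivative M (field_part a 1) (form_part b t)"
  let ?I = "\<lambda>t. interior_d M (velocity (field_part b) t) (integral_form (form_part a))"
  have "integral_form (form_part (path_bracket M a b)) p = integral_form (\<lambda>t p v. 1 * ?L t p v + (-1) * ?I t p v) p"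
    by (rule integral_form_cong) (simp add: fun_cong[OF path_bracket_form])
  also have "\<dots> = (\<lambda>v. 1 * integral_form ?L p v + (-1) * integral_form ?I p v)"
    by (rule integral_form_lincomb[OF lie_derivative_time_form[OF A(5) B(2)]
          interior_d_time_form[OF velocity_time_field[OF B(1)] A(6)]])
  finally show "integral_form (form_part (path_bracket M a b)) p =
    (\<lambda>v. lie_derivative M (field_part a 1) (integral_form (form_part b)) p v
      - interior_d M (field_part b 1) (integral_form (form_part a)) p v)"
    using integral_lie_derivative[OF A(5) B(2)] integral_interior_d_velocity[OF B(1) A(6) B(3)] by simp
qed

text \<open>
  The first component of the bracket at \<open>t = 1\<close> is \<open>[X\<^sub>1, Y\<^sub>1]\<close>, and the integral of the second one is given by
  \<open>path_bracket_integral_form\<close>.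
\<close>

lemma ev1_path_bracket:
  assumes a: "a \<in> sections (cotangent_paths M)" and b: "b \<in> sections (cotangent_paths M)"
  shows "ev1_int p (path_bracket M a b p) = dorfman_bracket M (\<lambda>p. ev1_int p (a p)) (\<lambda>p. ev1_int p (b p)) p"
  using fun_cong[OF path_bracket_integral_form[OF a b], of p] fun_cong[OF path_bracket_field[of 1 a b], of p]
  by (simp add: ev1_int_def dorfman_bracket_def Let_def)

lemma lie_derivative_diff:
  "X \<in> vector_fields M \<Longrightarrow> \<alpha> \<in> one_forms M \<Longrightarrow> \<beta> \<in> one_forms M \<Longrightarrow>
    lie_derivative M X (\<lambda>m v. \<alpha> m v - \<beta> m v) m v = lie_derivative M X \<alpha> m v - lie_derivative M X \<beta> m v"
  using lie_derivative_lincomb_form[OF _ _ _ Cinf_const Cinf_const, of X \<alpha> \<beta> 1 "-1" m v]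
  by (simp add: tangent_const[OF vector_field_at])

lemma interior_d_diff:
  "X \<in> vector_fields M \<Longrightarrow> \<alpha> \<in> one_forms M \<Longrightarrow> \<beta> \<in> one_forms M \<Longrightarrow>
    interior_d M X (\<lambda>m v. \<alpha> m v - \<beta> m v) m v = interior_d M X \<alpha> m v - interior_d M X \<beta> m v"
  using interior_d_lincomb_form[of X \<alpha> \<beta> 1 "-1" m v] by simp

text \<open>
  With \<open>A = \<integral> \<alpha>\<close>, \<open>B = \<integral> \<beta>\<close> and \<open>V\<close> the velocity of the third section at time \<open>t\<close>, the inner brackets contribute
  \<open>\<integral> [a, b] = L\<^sub>X B - i\<^sub>Y dA\<close> and velocities \<open>[Y, V]\<close>, \<open>[X, V]\<close>, where \<open>X\<close> and \<open>Y\<close> are taken at time one. What remains is the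
  computation that proves the Leibniz identity of the Dorfman bracket: the three commutation relations of the Cartan operations
  cancel all terms.
\<close>

lemma path_bracket_leibniz:
  assumes a: "a \<in> sections (cotangent_paths M)" and b: "b \<in> sections (cotangent_paths M)"
    and c: "c \<in> sections (cotangent_paths M)"
  shows "path_bracket M a (path_bracket M b c) =
    (\<lambda>p t. gadd (path_bracket M (path_bracket M a b) c p t) (path_bracket M b (path_bracket M a c) p t))"
proof (intro ext)
  fix p t
  note A = path_sectionD[OF a]
  note B = path_sectionD[OF b]
  note C = path_sectionD[OF c]
  note ab = path_bracket_section[OF a b]
  note bc = path_bracket_section[OF b c]
  note ac = path_bracket_section[OF a c]
  show "path_bracket M a (path_bracket M b c) p t =
    gadd (path_bracket M (path_bracket M a b) c p t) (path_bracket M b (path_bracket M a c) p t)"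
  proof (cases "t \<in> {0..1}")
    case False
    then show ?thesis by (simp add: path_bracket_outside)
  next
    case t: True
    let ?X = "field_part a 1"
    let ?Y = "field_part b 1"
    let ?Z = "field_part c t"
    let ?V = "velocity (field_part c) t"
    let ?A = "integral_form (form_part a)"
    let ?B = "integral_form (form_part b)"
    let ?C = "form_part c t"
    have Z: "?Z \<in> vector_fields M" by (rule time_fieldD(1)[OF C(1) t])
    have V: "?V \<in> vector_fields M" by (rule time_fieldD(1)[OF velocity_time_field[OF C(1)] t])
    have \<gamma>: "?C \<in> one_forms M" by (rule time_formD(1)[OF C(2) t])
    have one: "(1::real) \<in> {0..1}" by simp
    have vel: "velocity (field_part (path_bracket M d c)) t = lie_bracket (field_part d 1) ?V"
      if d: "d \<in> sections (cotangent_paths M)" for d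
    proof
      fix q
      note D = path_sectionD(5)[OF d]
      have "velocity (field_part (path_bracket M d c)) t q = velocity (\<lambda>s. lie_bracket (field_part d 1) (field_part c s)) t q"
        by (rule velocity_cong[OF lie_bracket_time_field[OF D C(1)] t]) (simp add: fun_cong[OF path_bracket_field])
      also have "\<dots> = lie_bracket (field_part d 1) ?V q" by (rule velocity_lie_bracket[OF D C(1) t])
      finally show "velocity (field_part (path_bracket M d c)) t q = lie_bracket (field_part d 1) ?V q" .
    qed
    show ?thesis
    proof (rule gvec_eqI)
      fix f
      show "fst (path_bracket M a (path_bracket M b c) p t) f =
        fst (gadd (path_bracket M (path_bracket M a b) c p t) (path_bracket M b (path_bracket M a c) p t)) f"
        using lie_bracket_jacobi[OF A(5) B(5) Z, of p]
        by (simp add: fun_cong[OF path_bracket_field[OF t]] path_bracket_field[OF t] path_bracket_field[OF one])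
    next
      fix v
      have "snd (path_bracket M a (path_bracket M b c) p t) v =
        lie_derivative M ?X (\<lambda>q w. lie_derivative M ?Y ?C q w - interior_d M ?V ?B q w) p v
        - interior_d M (lie_bracket ?Y ?V) ?A p v"
        by (simp add: fun_cong[OF path_bracket_form[OF t]] path_bracket_form[OF t] vel[OF b])
      moreover have "snd (path_bracket M (path_bracket M a b) c p t) v =
        lie_derivative M (lie_bracket ?X ?Y) ?C p v
        - interior_d M ?V (\<lambda>q w. lie_derivative M ?X ?B q w - interior_d M ?Y ?A q w) p v"
        by (simp add: fun_cong[OF path_bracket_form[OF t]] path_bracket_field[OF one] path_bracket_integral_form[OF a b])
      moreover have "snd (path_bracket M b (path_bracket M a c) p t) v =
        lie_derivative M ?Y (\<lambda>q w. lie_derivative M ?X ?C q w - interior_d M ?V ?A q w) p v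
        - interior_d M (lie_bracket ?X ?V) ?B p v"
        by (simp add: fun_cong[OF path_bracket_form[OF t]] path_bracket_form[OF t] vel[OF a])
      ultimately show "snd (path_bracket M a (path_bracket M b c) p t) v =
        snd (gadd (path_bracket M (path_bracket M a b) c p t) (path_bracket M b (path_bracket M a c) p t)) v"
        using lie_derivative_diff[OF A(5) lie_derivative_one_form[OF B(5) \<gamma>] interior_d_one_form[OF V B(6)], of p v]
          lie_derivative_diff[OF B(5) lie_derivative_one_form[OF A(5) \<gamma>] interior_d_one_form[OF V A(6)], of p v]
          interior_d_diff[OF V lie_derivative_one_form[OF A(5) B(6)] interior_d_one_form[OF B(5) A(6)], of p v]
          lie_derivative_commutator[OF A(5) B(5) \<gamma>, of p v]
          lie_derivative_interior_d[OF A(5) V B(6), of p v] lie_derivative_interior_d[OF B(5) V A(6), of p v]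
          interior_d_interior_d[OF V B(5) A(6), of p v]
        by simp
    qed
  qed
qed

lemma path_bracket_lincomb_left:
  assumes a: "a \<in> sections (cotangent_paths M)" and b: "b \<in> sections (cotangent_paths M)"
    and c: "c \<in> sections (cotangent_paths M)"
  shows "path_bracket M (\<lambda>p t. gadd (gscale r (a p t)) (gscale s (b p t))) c =
    (\<lambda>p t. gadd (gscale r (path_bracket M a c p t)) (gscale s (path_bracket M b c p t)))"
proof (intro ext)
  fix p t
  note A = path_sectionD[OF a]
  note B = path_sectionD[OF b]
  note C = path_sectionD[OF c]
  let ?d = "\<lambda>p t. gadd (gscale r (a p t)) (gscale s (b p t))"
  show "path_bracket M ?d c p t = gadd (gscale r (path_bracket M a c p t)) (gscale s (path_bracket M b c p t))"
  proof (cases "t \<in> {0..1}")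
    case False
    then show ?thesis by (simp add: path_bracket_outside)
  next
    case t: True
    have Z: "field_part c t \<in> vector_fields M" by (rule time_fieldD(1)[OF C(1) t])
    have V: "velocity (field_part c) t \<in> vector_fields M" by (rule time_fieldD(1)[OF velocity_time_field[OF C(1)] t])
    have \<gamma>: "form_part c t \<in> one_forms M" by (rule time_formD(1)[OF C(2) t])
    have int: "(\<lambda>p. path_integral (\<lambda>t v. r * snd (a p t) v + s * snd (b p t) v)) = (\<lambda>p v. r * integral_form (form_part a) p v + s * integral_form (form_part b) p v)"
      using integral_form_lincomb[OF A(2) B(2), where g = "\<lambda>_. r" and h = "\<lambda>_. s"] by (simp add: fun_eq_iff)
    show ?thesis
    proof (rule gvec_eqI)
      fix f
      show "fst (path_bracket M ?d c p t) f = fst (gadd (gscale r (path_bracket M a c p t)) (gscale s (path_bracket M b c p t))) f"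
        using lie_bracket_lincomb_left[OF A(5) B(5) Z, of r s p] by (simp add: fun_cong[OF path_bracket_field[OF t]])
    next
      fix v
      show "snd (path_bracket M ?d c p t) v = snd (gadd (gscale r (path_bracket M a c p t)) (gscale s (path_bracket M b c p t))) v"
        using lie_derivative_lincomb_field[OF A(5) B(5) \<gamma>, of r s p v] interior_d_lincomb_form[OF V A(6) B(6), of r s p v]
        by (simp add: fun_cong[OF path_bracket_form[OF t]] int algebra_simps)
    qed
  qed
qed

text \<open>
  Additivity, homogeneity and the Leibniz rule of the bracket in its second argument are special cases of this formula
  with smooth coefficients.
\<close>

lemma path_bracket_lincomb_right:
  assumes a: "a \<in> sections (cotangent_paths M)" and b: "b \<in> sections (cotangent_paths M)"
    and c: "c \<in> sections (cotangent_paths M)" and g: "g \<in> Cinf M" and h: "h \<in> Cinf M"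
  shows "path_bracket M a (\<lambda>p t. gadd (gscale (g p) (b p t)) (gscale (h p) (c p t))) =
    (\<lambda>p t. gadd (gadd (gscale (g p) (path_bracket M a b p t)) (gscale (fst (a p 1) g) (b p t)))
      (gadd (gscale (h p) (path_bracket M a c p t)) (gscale (fst (a p 1) h) (c p t))))"
proof (intro ext)
  fix p t
  note A = path_sectionD[OF a]
  note B = path_sectionD[OF b]
  note C = path_sectionD[OF c]
  let ?d = "\<lambda>p t. gadd (gscale (g p) (b p t)) (gscale (h p) (c p t))"
  let ?r = "gadd (gadd (gscale (g p) (path_bracket M a b p t)) (gscale (fst (a p 1) g) (b p t)))
      (gadd (gscale (h p) (path_bracket M a c p t)) (gscale (fst (a p 1) h) (c p t)))"
  show "path_bracket M a ?d p t = ?r"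
  proof (cases "t \<in> {0..1}")
    case False
    then show ?thesis by (simp add: path_bracket_outside B(4) C(4))
  next
    case t: True
    have Y: "field_part b t \<in> vector_fields M" by (rule time_fieldD(1)[OF B(1) t])
    have Z: "field_part c t \<in> vector_fields M" by (rule time_fieldD(1)[OF C(1) t])
    have VY: "velocity (field_part b) t \<in> vector_fields M" by (rule time_fieldD(1)[OF velocity_time_field[OF B(1)] t])
    have VZ: "velocity (field_part c) t \<in> vector_fields M" by (rule time_fieldD(1)[OF velocity_time_field[OF C(1)] t])
    have \<beta>: "form_part b t \<in> one_forms M" by (rule time_formD(1)[OF B(2) t])
    have \<gamma>: "form_part c t \<in> one_forms M" by (rule time_formD(1)[OF C(2) t])
    have vel: "path_velocity (\<lambda>s f. g q * fst (b q s) f + h q * fst (c q s) f) t =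
        (\<lambda>f. g q * velocity (field_part b) t q f + h q * velocity (field_part c) t q f)" for q
      using velocity_lincomb[OF B(1) C(1) t, where g = g and h = h] by (simp add: fun_eq_iff)
    show ?thesis
    proof (rule gvec_eqI)
      fix f
      show "fst (path_bracket M a ?d p t) f = fst ?r f"
        using lie_bracket_lincomb_right[OF A(5) Y Z g h, of p] by (simp add: fun_cong[OF path_bracket_field[OF t]])
    next
      fix v
      show "snd (path_bracket M a ?d p t) v = snd ?r v"
        using lie_derivative_lincomb_form[OF A(5) \<beta> \<gamma> g h, of p v]
          ext_deriv_lincomb_left[OF A(6) vector_field_at[OF VY] vector_field_at[OF VZ], where r = "g p" and s = "h p" and v = v]
        by (simp add: fun_cong[OF path_bracket_form[OF t]] vel interior_d_def algebra_simps)
    qed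
  qed
qed

end


section \<open>Pullbacks of vector bundles and images of Leibniz algebroids\<close>

lemma vector_bundleD:
  assumes "vector_bundle M E"
  shows "Module.module reals_ring (fibre E m)"
    and "open U \<Longrightarrow> w \<in> lifts E U \<gamma> \<Longrightarrow> smooth_map_on M U \<gamma>"
    and "open U \<Longrightarrow> w \<in> lifts E U \<gamma> \<Longrightarrow> p \<in> U \<Longrightarrow> w p \<in> carrier (fibre E (\<gamma> p))"
    and "open U \<Longrightarrow> w \<in> lifts E U \<gamma> \<longleftrightarrow>
      (\<forall>p\<in>U. \<exists>V w'. open V \<and> p \<in> V \<and> V \<subseteq> U \<and> w' \<in> lifts E V \<gamma> \<and> (\<forall>q\<in>V. w q = w' q))"
    and "open U \<Longrightarrow> e \<in> carrier (fibre E m) \<Longrightarrow> (\<lambda>p. e) \<in> lifts E U (\<lambda>p. m)"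
    and "open U \<Longrightarrow> w \<in> lifts E U \<gamma> \<Longrightarrow> w' \<in> lifts E U \<gamma> \<Longrightarrow>
      (\<lambda>p. w p \<oplus>\<^bsub>fibre E (\<gamma> p)\<^esub> w' p) \<in> lifts E U \<gamma>"
    and "open U \<Longrightarrow> w \<in> lifts E U \<gamma> \<Longrightarrow> smooth_fun_on M U f \<Longrightarrow>
      (\<lambda>p. f p \<odot>\<^bsub>fibre E (\<gamma> p)\<^esub> w p) \<in> lifts E U \<gamma>"
    and "\<exists>U \<psi>. local_trivialization E m U \<psi>"
proof -
  note D1 = assms[unfolded vector_bundle_def]
  note D2 = D1[THEN conjunct2]
  note D3 = D2[THEN conjunct2]
  note D4 = D3[THEN conjunct2]
  note D5 = D4[THEN conjunct2]
  note D6 = D5[THEN conjunct2]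
  note D7 = D6[THEN conjunct2]
  show "Module.module reals_ring (fibre E m)" by (rule D1[THEN conjunct1, rule_format])
  show "open U \<Longrightarrow> w \<in> lifts E U \<gamma> \<Longrightarrow> smooth_map_on M U \<gamma>"
    by (rule D2[THEN conjunct1, rule_format, THEN conjunct1])
  show "open U \<Longrightarrow> w \<in> lifts E U \<gamma> \<Longrightarrow> p \<in> U \<Longrightarrow> w p \<in> carrier (fibre E (\<gamma> p))"
    by (rule D2[THEN conjunct1, rule_format, THEN conjunct2, rule_format])
  show "open U \<Longrightarrow> w \<in> lifts E U \<gamma> \<longleftrightarrow>
      (\<forall>p\<in>U. \<exists>V w'. open V \<and> p \<in> V \<and> V \<subseteq> U \<and> w' \<in> lifts E V \<gamma> \<and> (\<forall>q\<in>V. w q = w' q))"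
    using D3[THEN conjunct1, THEN spec, THEN spec, THEN spec, THEN mp] .
  show "open U \<Longrightarrow> e \<in> carrier (fibre E m) \<Longrightarrow> (\<lambda>p. e) \<in> lifts E U (\<lambda>p. m)"
    by (rule D4[THEN conjunct1, rule_format])
  show "open U \<Longrightarrow> w \<in> lifts E U \<gamma> \<Longrightarrow> w' \<in> lifts E U \<gamma> \<Longrightarrow>
      (\<lambda>p. w p \<oplus>\<^bsub>fibre E (\<gamma> p)\<^esub> w' p) \<in> lifts E U \<gamma>"
    by (rule D5[THEN conjunct1, rule_format])
  show "open U \<Longrightarrow> w \<in> lifts E U \<gamma> \<Longrightarrow> smooth_fun_on M U f \<Longrightarrow>
      (\<lambda>p. f p \<odot>\<^bsub>fibre E (\<gamma> p)\<^esub> w p) \<in> lifts E U \<gamma>"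
    by (rule D6[THEN conjunct1, rule_format])
  show "\<exists>U \<psi>. local_trivialization E m U \<psi>"
    by (rule D7[THEN spec])
qed

text \<open>
  Lifts are a sheaf, so only their values on the open set matter.
\<close>

lemma lifts_cong:
  assumes "vector_bundle M E" "open U" "\<And>p. p \<in> U \<Longrightarrow> w p = w' p"
  shows "w \<in> lifts E U \<gamma> \<longleftrightarrow> w' \<in> lifts E U \<gamma>"
proof -
  have "w' \<in> lifts E U \<gamma>" if "w \<in> lifts E U \<gamma>" "\<And>p. p \<in> U \<Longrightarrow> w p = w' p" for w w'
    by (rule vector_bundleD(4)[OF assms(1,2), THEN iffD2]) (use assms(2) that in fastforce)
  then show ?thesis using assms(3) by metis
qed

lemma linear_mapD:
  assumes "linear_map V W h"
  shows "x \<in> carrier V \<Longrightarrow> h x \<in> carrier W"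
    "x \<in> carrier V \<Longrightarrow> y \<in> carrier V \<Longrightarrow> h (x \<oplus>\<^bsub>V\<^esub> y) = h x \<oplus>\<^bsub>W\<^esub> h y"
    "x \<in> carrier V \<Longrightarrow> h (r \<odot>\<^bsub>V\<^esub> x) = r \<odot>\<^bsub>W\<^esub> h x"
  using assms by (simp_all add: linear_map_def)

lemma reals_ring_simps [simp]:
  "carrier reals_ring = UNIV" "x \<oplus>\<^bsub>reals_ring\<^esub> y = x + y" "x \<otimes>\<^bsub>reals_ring\<^esub> y = x * y"
  "\<zero>\<^bsub>reals_ring\<^esub> = 0" "\<one>\<^bsub>reals_ring\<^esub> = 1"
  by (simp_all add: reals_ring_def)

lemma reals_ring_cring: "cring reals_ring"
proof (rule cringI)
  show "abelian_group reals_ring"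
  proof (rule abelian_groupI)
    show "\<exists>y\<in>carrier reals_ring. y \<oplus>\<^bsub>reals_ring\<^esub> x = \<zero>\<^bsub>reals_ring\<^esub>" for x
      by (intro bexI[of _ "- x"]) auto
  qed auto
  show "comm_monoid reals_ring" by (rule comm_monoidI) auto
qed (auto simp: algebra_simps)

lemma module_realsI:
  fixes V :: "(real, 'v) module"
  assumes "\<And>x y. x \<in> carrier V \<Longrightarrow> y \<in> carrier V \<Longrightarrow> x \<oplus>\<^bsub>V\<^esub> y \<in> carrier V"
    and "\<zero>\<^bsub>V\<^esub> \<in> carrier V"
    and "\<And>r x. x \<in> carrier V \<Longrightarrow> r \<odot>\<^bsub>V\<^esub> x \<in> carrier V"
    and "\<And>x y z. x \<in> carrier V \<Longrightarrow> y \<in> carrier V \<Longrightarrow> z \<in> carrier V \<Longrightarrow> (x \<oplus>\<^bsub>V\<^esub> y) \<oplus>\<^bsub>V\<^esub> z = x \<oplus>\<^bsub>V\<^esub> (y \<oplus>\<^bsub>V\<^esub> z)"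
    and "\<And>x y. x \<in> carrier V \<Longrightarrow> y \<in> carrier V \<Longrightarrow> x \<oplus>\<^bsub>V\<^esub> y = y \<oplus>\<^bsub>V\<^esub> x"
    and "\<And>x. x \<in> carrier V \<Longrightarrow> \<zero>\<^bsub>V\<^esub> \<oplus>\<^bsub>V\<^esub> x = x"
    and "\<And>x. x \<in> carrier V \<Longrightarrow> (-1) \<odot>\<^bsub>V\<^esub> x \<oplus>\<^bsub>V\<^esub> x = \<zero>\<^bsub>V\<^esub>"
    and "\<And>r s x. x \<in> carrier V \<Longrightarrow> (r + s) \<odot>\<^bsub>V\<^esub> x = r \<odot>\<^bsub>V\<^esub> x \<oplus>\<^bsub>V\<^esub> s \<odot>\<^bsub>V\<^esub> x"
    and "\<And>r x y. x \<in> carrier V \<Longrightarrow> y \<in> carrier V \<Longrightarrow> r \<odot>\<^bsub>V\<^esub> (x \<oplus>\<^bsub>V\<^esub> y) = r \<odot>\<^bsub>V\<^esub> x \<oplus>\<^bsub>V\<^esub> r \<odot>\<^bsub>V\<^esub> y"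
    and "\<And>r s x. x \<in> carrier V \<Longrightarrow> (r * s) \<odot>\<^bsub>V\<^esub> x = r \<odot>\<^bsub>V\<^esub> (s \<odot>\<^bsub>V\<^esub> x)"
    and "\<And>x. x \<in> carrier V \<Longrightarrow> 1 \<odot>\<^bsub>V\<^esub> x = x"
  shows "Module.module reals_ring V"
proof (rule moduleI[OF reals_ring_cring])
  show "abelian_group V"
  proof (rule abelian_groupI)
    show "\<exists>y\<in>carrier V. y \<oplus>\<^bsub>V\<^esub> x = \<zero>\<^bsub>V\<^esub>" if "x \<in> carrier V" for x
      using assms(3,7)[OF that] by blast
  qed (use assms in auto)
qed (use assms in auto)

text \<open>
  An injective linear map reflects the axioms of a vector space.
\<close>

lemma module_pullback:
  fixes V :: "(real, 'v) module" and W :: "(real, 'w, 'x) module_scheme"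
  assumes W: "Module.module reals_ring W" and h: "linear_map V W h" "inj_on h (carrier V)"
    and cl: "\<And>x y. x \<in> carrier V \<Longrightarrow> y \<in> carrier V \<Longrightarrow> x \<oplus>\<^bsub>V\<^esub> y \<in> carrier V"
      "\<And>r x. x \<in> carrier V \<Longrightarrow> r \<odot>\<^bsub>V\<^esub> x \<in> carrier V"
    and zero: "\<zero>\<^bsub>V\<^esub> \<in> carrier V" "h \<zero>\<^bsub>V\<^esub> = \<zero>\<^bsub>W\<^esub>"
  shows "Module.module reals_ring V"
proof -
  interpret W: Module.module reals_ring W by (rule W)
  note H = linear_mapD[OF h(1)]
  note inj = inj_onD[OF h(2)]
  have neg: "(-1) \<odot>\<^bsub>W\<^esub> x \<oplus>\<^bsub>W\<^esub> x = \<zero>\<^bsub>W\<^esub>" if "x \<in> carrier W" for x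
    using W.smult_l_distr[of "-1" 1 x] that W.smult_l_null[of x] W.smult_one[of x] by simp
  show ?thesis
  proof (rule module_realsI)
    show "(-1) \<odot>\<^bsub>V\<^esub> x \<oplus>\<^bsub>V\<^esub> x = \<zero>\<^bsub>V\<^esub>" if "x \<in> carrier V" for x
      by (rule inj) (use that cl H zero neg in simp_all)
    show "(x \<oplus>\<^bsub>V\<^esub> y) \<oplus>\<^bsub>V\<^esub> z = x \<oplus>\<^bsub>V\<^esub> (y \<oplus>\<^bsub>V\<^esub> z)"
      if "x \<in> carrier V" "y \<in> carrier V" "z \<in> carrier V" for x y z
      by (rule inj) (use that cl H in \<open>simp_all add: W.a_assoc\<close>)
    show "x \<oplus>\<^bsub>V\<^esub> y = y \<oplus>\<^bsub>V\<^esub> x" if "x \<in> carrier V" "y \<in> carrier V" for x y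
      by (rule inj) (use that cl H in \<open>simp_all add: W.a_comm\<close>)
    show "\<zero>\<^bsub>V\<^esub> \<oplus>\<^bsub>V\<^esub> x = x" if "x \<in> carrier V" for x
      by (rule inj) (use that cl H zero in simp_all)
    show "(r + s) \<odot>\<^bsub>V\<^esub> x = r \<odot>\<^bsub>V\<^esub> x \<oplus>\<^bsub>V\<^esub> s \<odot>\<^bsub>V\<^esub> x" if "x \<in> carrier V" for r s x
      by (rule inj) (use that cl H W.smult_l_distr[of r s "h x"] in simp_all)
    show "r \<odot>\<^bsub>V\<^esub> (x \<oplus>\<^bsub>V\<^esub> y) = r \<odot>\<^bsub>V\<^esub> x \<oplus>\<^bsub>V\<^esub> r \<odot>\<^bsub>V\<^esub> y" if "x \<in> carrier V" "y \<in> carrier V" for r x y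
      by (rule inj) (use that cl H W.smult_r_distr[of r "h x" "h y"] in simp_all)
    show "(r * s) \<odot>\<^bsub>V\<^esub> x = r \<odot>\<^bsub>V\<^esub> (s \<odot>\<^bsub>V\<^esub> x)" if "x \<in> carrier V" for r s x
      by (rule inj) (use that cl H W.smult_assoc1[of r s "h x"] in simp_all)
    show "1 \<odot>\<^bsub>V\<^esub> x = x" if "x \<in> carrier V" for x
      by (rule inj) (use that cl H W.smult_one[of "h x"] in simp_all)
  qed (use cl zero in auto)
qed

text \<open>
  If the lifts of \<open>E\<close> are the maps that a fibrewise linear map \<open>\<sigma>\<close> carries to lifts of a vector bundle
  \<open>F\<close>, and \<open>F\<close> has local trivializations that restrict along \<open>\<sigma>\<close>, then \<open>E\<close> is a vector bundle as well. It is applied to the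
  inclusion of the Courant bundle into the bundle of cotangent paths and to the isomorphism from the quotient bundle to the
  Courant bundle.
\<close>

lemma vector_bundle_pullback:
  assumes F: "vector_bundle M F"
    and modl: "\<And>m. Module.module reals_ring (fibre E m)"
    and lin: "\<And>m. linear_map (fibre E m) (fibre F m) (\<sigma> m)"
    and lifts: "\<And>U \<gamma> w. open U \<Longrightarrow> w \<in> lifts E U \<gamma> \<longleftrightarrow>
      (\<forall>p\<in>U. w p \<in> carrier (fibre E (\<gamma> p))) \<and> (\<lambda>p. \<sigma> (\<gamma> p) (w p)) \<in> lifts F U \<gamma>"
    and triv: "\<And>m. \<exists>U \<psi> \<psi>'. local_trivialization F m U \<psi> \<and>
      (\<forall>p\<in>U. linear_iso (fibre E p) (fibre E m) (\<psi>' p) \<and>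
        (\<forall>x\<in>carrier (fibre E p). \<sigma> m (\<psi>' p x) = \<psi> p (\<sigma> p x)))"
  shows "vector_bundle M E"
proof -
  note FD = vector_bundleD[OF F]
  have add_cl: "x \<oplus>\<^bsub>fibre E m\<^esub> y \<in> carrier (fibre E m)" if "x \<in> carrier (fibre E m)" "y \<in> carrier (fibre E m)" for x y m
    using abelian_groupE(1)[OF Module.module.axioms(2)[OF modl] that] .
  have scale_cl: "r \<odot>\<^bsub>fibre E m\<^esub> x \<in> carrier (fibre E m)" if "x \<in> carrier (fibre E m)" for r x m
    using Module.module.smult_closed[OF modl, of r x m] that by simp
  have loc: "w \<in> lifts E U \<gamma> \<longleftrightarrow>
      (\<forall>p\<in>U. \<exists>V w'. open V \<and> p \<in> V \<and> V \<subseteq> U \<and> w' \<in> lifts E V \<gamma> \<and> (\<forall>q\<in>V. w q = w' q))" if U: "open U" for U \<gamma> w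
  proof
    assume "w \<in> lifts E U \<gamma>"
    then show "\<forall>p\<in>U. \<exists>V w'. open V \<and> p \<in> V \<and> V \<subseteq> U \<and> w' \<in> lifts E V \<gamma> \<and> (\<forall>q\<in>V. w q = w' q)"
      using U by (intro ballI exI[of _ U] exI[of _ w]) simp
  next
    assume R: "\<forall>p\<in>U. \<exists>V w'. open V \<and> p \<in> V \<and> V \<subseteq> U \<and> w' \<in> lifts E V \<gamma> \<and> (\<forall>q\<in>V. w q = w' q)"
    have "w p \<in> carrier (fibre E (\<gamma> p))" if "p \<in> U" for p
    proof -
      from bspec[OF R that] obtain V w' where V: "open V" "p \<in> V" "w' \<in> lifts E V \<gamma>" "\<forall>q\<in>V. w q = w' q"
        by (elim exE conjE)
      then show ?thesis using lifts[OF V(1)] by simp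
    qed
    moreover have "(\<lambda>p. \<sigma> (\<gamma> p) (w p)) \<in> lifts F U \<gamma>"
    proof (rule FD(4)[OF U, THEN iffD2], rule ballI)
      fix p assume "p \<in> U"
      from bspec[OF R this] obtain V w' where V: "open V" "p \<in> V" "V \<subseteq> U" "w' \<in> lifts E V \<gamma>" "\<forall>q\<in>V. w q = w' q"
        by (elim exE conjE)
      then show "\<exists>V w'. open V \<and> p \<in> V \<and> V \<subseteq> U \<and> w' \<in> lifts F V \<gamma> \<and> (\<forall>q\<in>V. \<sigma> (\<gamma> q) (w q) = w' q)"
        using lifts[OF V(1)] by (intro exI[of _ V] exI[of _ "\<lambda>p. \<sigma> (\<gamma> p) (w' p)"]) simp
    qed
    ultimately show "w \<in> lifts E U \<gamma>" by (intro iffD2[OF lifts[OF U]] conjI ballI)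
  qed
  have basic: "smooth_map_on M U \<gamma>" "\<forall>p\<in>U. w p \<in> carrier (fibre E (\<gamma> p))"
    if "open U" "w \<in> lifts E U \<gamma>" for U w \<gamma>
    using iffD1[OF lifts[OF that(1)] that(2)] FD(2)[OF that(1) iffD1[OF lifts[OF that(1)] that(2), THEN conjunct2]] by simp_all
  have const: "(\<lambda>p. e) \<in> lifts E U (\<lambda>p. m)" if "open U" "e \<in> carrier (fibre E m)" for U m e
    using lifts[OF that(1)] FD(5)[OF that(1) linear_mapD(1)[OF lin that(2)]] that(2) by simp
  have add: "(\<lambda>p. w p \<oplus>\<^bsub>fibre E (\<gamma> p)\<^esub> w' p) \<in> lifts E U \<gamma>"
    if U: "open U" and w: "w \<in> lifts E U \<gamma>" and w': "w' \<in> lifts E U \<gamma>" for U \<gamma> w w'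
  proof -
    have c: "\<And>p. p \<in> U \<Longrightarrow> w p \<in> carrier (fibre E (\<gamma> p))" "\<And>p. p \<in> U \<Longrightarrow> w' p \<in> carrier (fibre E (\<gamma> p))"
      using iffD1[OF lifts[OF U] w] iffD1[OF lifts[OF U] w'] by simp_all
    have "(\<lambda>p. \<sigma> (\<gamma> p) (w p) \<oplus>\<^bsub>fibre F (\<gamma> p)\<^esub> \<sigma> (\<gamma> p) (w' p)) \<in> lifts F U \<gamma>"
      by (rule FD(6)[OF U iffD1[OF lifts[OF U] w, THEN conjunct2] iffD1[OF lifts[OF U] w', THEN conjunct2]])
    then have "(\<lambda>p. \<sigma> (\<gamma> p) (w p \<oplus>\<^bsub>fibre E (\<gamma> p)\<^esub> w' p)) \<in> lifts F U \<gamma>"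
      by (rule lifts_cong[OF F U, THEN iffD1, rotated]) (simp add: linear_mapD(2)[OF lin] c)
    then show ?thesis using lifts[OF U] add_cl c by simp
  qed
  have scale: "(\<lambda>p. f p \<odot>\<^bsub>fibre E (\<gamma> p)\<^esub> w p) \<in> lifts E U \<gamma>"
    if U: "open U" and w: "w \<in> lifts E U \<gamma>" and f: "smooth_fun_on M U f" for U \<gamma> w f
  proof -
    have c: "\<And>p. p \<in> U \<Longrightarrow> w p \<in> carrier (fibre E (\<gamma> p))" using iffD1[OF lifts[OF U] w] by simp
    have "(\<lambda>p. f p \<odot>\<^bsub>fibre F (\<gamma> p)\<^esub> \<sigma> (\<gamma> p) (w p)) \<in> lifts F U \<gamma>"
      by (rule FD(7)[OF U iffD1[OF lifts[OF U] w, THEN conjunct2] f])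
    then have "(\<lambda>p. \<sigma> (\<gamma> p) (f p \<odot>\<^bsub>fibre E (\<gamma> p)\<^esub> w p)) \<in> lifts F U \<gamma>"
      by (rule lifts_cong[OF F U, THEN iffD1, rotated]) (simp add: linear_mapD(3)[OF lin] c)
    then show ?thesis using lifts[OF U] scale_cl c by simp
  qed
  have tr: "\<exists>U \<psi>. local_trivialization E m U \<psi>" for m
  proof -
    obtain U \<psi> \<psi>' where T: "local_trivialization F m U \<psi>"
      and iso: "\<And>p. p \<in> U \<Longrightarrow> linear_iso (fibre E p) (fibre E m) (\<psi>' p)"
      and comm: "\<And>p x. p \<in> U \<Longrightarrow> x \<in> carrier (fibre E p) \<Longrightarrow> \<sigma> m (\<psi>' p x) = \<psi> p (\<sigma> p x)"
      using triv[of m] by blast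
    have "w \<in> lifts E V (\<lambda>p. p) \<longleftrightarrow> (\<lambda>p. \<psi>' p (w p)) \<in> lifts E V (\<lambda>p. m)"
      if V: "open V" "V \<subseteq> U" and w: "\<forall>p\<in>V. w p \<in> carrier (fibre E p)" for V w
    proof -
      have c: "\<forall>p\<in>V. \<psi>' p (w p) \<in> carrier (fibre E m)"
        using iso w V(2) by (auto simp: linear_iso_def linear_map_def)
      have "w \<in> lifts E V (\<lambda>p. p) \<longleftrightarrow> (\<lambda>p. \<sigma> p (w p)) \<in> lifts F V (\<lambda>p. p)"
        using lifts[OF V(1)] w by simp
      also have "\<dots> \<longleftrightarrow> (\<lambda>p. \<psi> p (\<sigma> p (w p))) \<in> lifts F V (\<lambda>p. m)"
        using T V w linear_mapD(1)[OF lin] unfolding local_trivialization_def by simp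
      also have "\<dots> \<longleftrightarrow> (\<lambda>p. \<sigma> m (\<psi>' p (w p))) \<in> lifts F V (\<lambda>p. m)"
        by (rule lifts_cong[OF F V(1)]) (use comm V(2) w in auto)
      also have "\<dots> \<longleftrightarrow> (\<lambda>p. \<psi>' p (w p)) \<in> lifts E V (\<lambda>p. m)"
        using lifts[OF V(1), of "\<lambda>p. \<psi>' p (w p)" "\<lambda>p. m"] c by simp
      finally show ?thesis .
    qed
    then have "local_trivialization E m U \<psi>'"
      using T iso unfolding local_trivialization_def by simp
    then show ?thesis by blast
  qed
  show ?thesis
    unfolding vector_bundle_def
    by (intro conjI allI impI) (rule modl basic loc const add scale tr; assumption)+
qed

context mfd
begin

text \<open>
  The identities of a Leibniz algebroid pass to the image of a morphism that is surjective on sections.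
  Both the quotient algebroid and the Courant algebroid are such images of the algebroid of cotangent paths.
\<close>

lemma leibniz_algebroid_image:
  assumes E: "leibniz_algebroid M E" and F: "vector_bundle M F" and anch_F: "smooth_anchor M F"
    and lin: "\<And>m. linear_map (fibre E m) (fibre F m) (\<pi> m)"
    and sec: "\<And>a. a \<in> sections E \<Longrightarrow> (\<lambda>p. \<pi> p (a p)) \<in> sections F"
    and surj: "\<And>s. s \<in> sections F \<Longrightarrow> \<exists>a\<in>sections E. s = (\<lambda>p. \<pi> p (a p))"
    and anch: "\<And>m x. x \<in> carrier (fibre E m) \<Longrightarrow> anchor F m (\<pi> m x) = anchor E m x"
    and br: "\<And>a b. a \<in> sections E \<Longrightarrow> b \<in> sections E \<Longrightarrow>
      bracket F (\<lambda>p. \<pi> p (a p)) (\<lambda>p. \<pi> p (b p)) = (\<lambda>p. \<pi> p (bracket E a b p))"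
  shows "leibniz_algebroid M F"
proof -
  note D1 = E[unfolded leibniz_algebroid_def]
  note D2 = D1[THEN conjunct2]
  note D3 = D2[THEN conjunct2]
  note D4 = D3[THEN conjunct2]
  note D5 = D4[THEN conjunct2]
  note D6 = D5[THEN conjunct2]
  note VE = D1[THEN conjunct1]
  note br_cl = D3[THEN conjunct1, rule_format]
  note add_l = D4[THEN conjunct1, rule_format, THEN conjunct1]
  note add_r = D4[THEN conjunct1, rule_format, THEN conjunct2]
  note scale_l = D5[THEN conjunct1, rule_format, THEN conjunct1]
  note scale_r = D5[THEN conjunct1, rule_format, THEN conjunct2]
  note leib = D6[THEN conjunct1, rule_format]
  note rule = D6[THEN conjunct2, rule_format]
  have mem: "a p \<in> carrier (fibre E p)" if "a \<in> sections E" for a p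
    using vector_bundleD(3)[OF VE open_UNIV that[unfolded sections_def], of p] by simp
  have add_s: "(\<lambda>p. a p \<oplus>\<^bsub>fibre E p\<^esub> b p) \<in> sections E" if "a \<in> sections E" "b \<in> sections E" for a b
    using vector_bundleD(6)[OF VE open_UNIV that[unfolded sections_def]] by (simp add: sections_def)
  have scale_s: "(\<lambda>p. f p \<odot>\<^bsub>fibre E p\<^esub> a p) \<in> sections E" if "a \<in> sections E" "f \<in> Cinf M" for a f
    using vector_bundleD(7)[OF VE open_UNIV that(1)[unfolded sections_def]] that(2) by (simp add: sections_def Cinf_def)
  have scale_c: "(\<lambda>p. r \<odot>\<^bsub>fibre E p\<^esub> a p) \<in> sections E" if "a \<in> sections E" for a r
    by (rule scale_s[OF that Cinf_const])
  have padd: "(\<lambda>p. \<pi> p (a p \<oplus>\<^bsub>fibre E p\<^esub> b p)) = (\<lambda>p. \<pi> p (a p) \<oplus>\<^bsub>fibre F p\<^esub> \<pi> p (b p))"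
    if "a \<in> sections E" "b \<in> sections E" for a b
    using linear_mapD(2)[OF lin mem[OF that(1)] mem[OF that(2)]] by simp
  have pscale: "(\<lambda>p. \<pi> p (f p \<odot>\<^bsub>fibre E p\<^esub> a p)) = (\<lambda>p. f p \<odot>\<^bsub>fibre F p\<^esub> \<pi> p (a p))"
    if "a \<in> sections E" for a f
    using linear_mapD(3)[OF lin mem[OF that]] by simp
  have cl: "bracket F a b \<in> sections F" if "a \<in> sections F" "b \<in> sections F" for a b
  proof -
    note h = that
    obtain a' b' where a': "a' \<in> sections E" "a = (\<lambda>p. \<pi> p (a' p))" and b': "b' \<in> sections E" "b = (\<lambda>p. \<pi> p (b' p))"
      using surj[OF h(1)] surj[OF h(2)] by blast
    show ?thesis unfolding a'(2) b'(2) br[OF a'(1) b'(1)] by (rule sec[OF br_cl[OF a'(1) b'(1)]])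
  qed
  have add: "bracket F (\<lambda>p. a p \<oplus>\<^bsub>fibre F p\<^esub> b p) c = (\<lambda>p. bracket F a c p \<oplus>\<^bsub>fibre F p\<^esub> bracket F b c p) \<and>
      bracket F a (\<lambda>p. b p \<oplus>\<^bsub>fibre F p\<^esub> c p) = (\<lambda>p. bracket F a b p \<oplus>\<^bsub>fibre F p\<^esub> bracket F a c p)"
    if "a \<in> sections F" "b \<in> sections F" "c \<in> sections F" for a b c
  proof -
    note h = that
    obtain a' b' c' where a': "a' \<in> sections E" "a = (\<lambda>p. \<pi> p (a' p))" and b': "b' \<in> sections E" "b = (\<lambda>p. \<pi> p (b' p))"
      and c': "c' \<in> sections E" "c = (\<lambda>p. \<pi> p (c' p))"
      using surj[OF h(1)] surj[OF h(2)] surj[OF h(3)] by blast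
    show ?thesis
      unfolding a'(2) b'(2) c'(2) padd[OF a'(1) b'(1), symmetric] padd[OF b'(1) c'(1), symmetric]
        br[OF add_s[OF a'(1) b'(1)] c'(1)] br[OF a'(1) add_s[OF b'(1) c'(1)]]
        br[OF a'(1) b'(1)] br[OF a'(1) c'(1)] br[OF b'(1) c'(1)]
        add_l[OF a'(1) b'(1) c'(1)] add_r[OF a'(1) b'(1) c'(1)]
        padd[OF br_cl[OF a'(1) c'(1)] br_cl[OF b'(1) c'(1)]] padd[OF br_cl[OF a'(1) b'(1)] br_cl[OF a'(1) c'(1)]]
      by simp
  qed
  have scale: "bracket F (\<lambda>p. r \<odot>\<^bsub>fibre F p\<^esub> a p) b = (\<lambda>p. r \<odot>\<^bsub>fibre F p\<^esub> bracket F a b p) \<and>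
      bracket F a (\<lambda>p. r \<odot>\<^bsub>fibre F p\<^esub> b p) = (\<lambda>p. r \<odot>\<^bsub>fibre F p\<^esub> bracket F a b p)"
    if "a \<in> sections F" "b \<in> sections F" for r a b
  proof -
    note h = that
    obtain a' b' where a': "a' \<in> sections E" "a = (\<lambda>p. \<pi> p (a' p))" and b': "b' \<in> sections E" "b = (\<lambda>p. \<pi> p (b' p))"
      using surj[OF h(1)] surj[OF h(2)] by blast
    show ?thesis
      unfolding a'(2) b'(2) pscale[OF a'(1), of "\<lambda>_. r", symmetric] pscale[OF b'(1), of "\<lambda>_. r", symmetric]
        br[OF scale_c[OF a'(1)] b'(1)] br[OF a'(1) scale_c[OF b'(1)]] br[OF a'(1) b'(1)]
        scale_l[OF a'(1) b'(1)] scale_r[OF a'(1) b'(1)] pscale[OF br_cl[OF a'(1) b'(1)], of "\<lambda>_. r"]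
      by simp
  qed
  have lb: "bracket F a (bracket F b c) = (\<lambda>p. bracket F (bracket F a b) c p \<oplus>\<^bsub>fibre F p\<^esub> bracket F b (bracket F a c) p)"
    if "a \<in> sections F" "b \<in> sections F" "c \<in> sections F" for a b c
  proof -
    note h = that
    obtain a' b' c' where a': "a' \<in> sections E" "a = (\<lambda>p. \<pi> p (a' p))" and b': "b' \<in> sections E" "b = (\<lambda>p. \<pi> p (b' p))"
      and c': "c' \<in> sections E" "c = (\<lambda>p. \<pi> p (c' p))"
      using surj[OF h(1)] surj[OF h(2)] surj[OF h(3)] by blast
    note ab = br_cl[OF a'(1) b'(1)] and bc = br_cl[OF b'(1) c'(1)] and ac = br_cl[OF a'(1) c'(1)]
    show ?thesis
      unfolding a'(2) b'(2) c'(2) br[OF a'(1) b'(1)] br[OF b'(1) c'(1)] br[OF a'(1) c'(1)]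
        br[OF a'(1) bc] br[OF ab c'(1)] br[OF b'(1) ac]
        leib[OF a'(1) b'(1) c'(1)] padd[OF br_cl[OF ab c'(1)] br_cl[OF b'(1) ac]] ..
  qed
  have rl: "bracket F a (\<lambda>p. f p \<odot>\<^bsub>fibre F p\<^esub> b p) = (\<lambda>p. (f p \<odot>\<^bsub>fibre F p\<^esub> bracket F a b p) \<oplus>\<^bsub>fibre F p\<^esub>
                 (anchor F p (a p) f \<odot>\<^bsub>fibre F p\<^esub> b p))"
    if "a \<in> sections F" "b \<in> sections F" "f \<in> Cinf M" for a b f
  proof -
    note h = that
    obtain a' b' where a': "a' \<in> sections E" "a = (\<lambda>p. \<pi> p (a' p))" and b': "b' \<in> sections E" "b = (\<lambda>p. \<pi> p (b' p))"
      using surj[OF h(1)] surj[OF h(2)] by blast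
    have an: "(\<lambda>p. anchor E p (a' p) f) \<in> Cinf M"
      using D2[THEN conjunct1, unfolded smooth_anchor_def, THEN conjunct2, rule_format,
          OF open_UNIV a'(1)[unfolded sections_def] that(3)] by (rule CinfI)
    show ?thesis
      unfolding a'(2) b'(2) pscale[OF b'(1), of f, symmetric] br[OF a'(1) scale_s[OF b'(1) that(3)]]
        br[OF a'(1) b'(1)] rule[OF a'(1) b'(1) that(3)]
        padd[OF scale_s[OF br_cl[OF a'(1) b'(1)] that(3)] scale_s[OF b'(1) an]]
        pscale[OF br_cl[OF a'(1) b'(1)], of f, symmetric] anch[OF mem[OF a'(1)]]
      by (simp add: linear_mapD(3)[OF lin mem[OF b'(1)]] linear_mapD(3)[OF lin mem[OF br_cl[OF a'(1) b'(1)]]])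
  qed
  show ?thesis
    unfolding leibniz_algebroid_def
    by (intro conjI F anch_F; intro allI ballI) (rule cl add scale lb rl; assumption)+
qed

end


section \<open>The algebroid of cotangent paths\<close>

lemma path_fibre_simps [simp]:
  "\<zero>\<^bsub>path_fibre M m\<^esub> = (\<lambda>t. gzero)" "x \<oplus>\<^bsub>path_fibre M m\<^esub> y = (\<lambda>t. gadd (x t) (y t))"
  "r \<odot>\<^bsub>path_fibre M m\<^esub> x = (\<lambda>t. gscale r (x t))"
  by (simp_all add: path_fibre_def)

lemma courant_fibre_simps [simp]:
  "carrier (courant_fibre M m) = tangent_space M m \<times> cotangent_space M m"
  "\<zero>\<^bsub>courant_fibre M m\<^esub> = gzero" "x \<oplus>\<^bsub>courant_fibre M m\<^esub> y = gadd x y"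
  "r \<odot>\<^bsub>courant_fibre M m\<^esub> x = gscale r x"
  by (simp_all add: courant_fibre_def)

lemma cotangent_paths_simps [simp]:
  "fibre (cotangent_paths M) = path_fibre M" "anchor (cotangent_paths M) m x = fst (x 1)"
  "bracket (cotangent_paths M) = path_bracket M"
  by (simp_all add: cotangent_paths_def)

lemma courant_algebroid_simps [simp]:
  "fibre (courant_algebroid M) = courant_fibre M" "anchor (courant_algebroid M) m x = fst x"
  "bracket (courant_algebroid M) = dorfman_bracket M"
  by (simp_all add: courant_algebroid_def)

lemma path_lifts_iff:
  "w \<in> lifts (cotangent_paths M) U \<gamma> \<longleftrightarrow> smooth_map_on M U \<gamma> \<and>
     (\<forall>p\<in>U. w p \<in> carrier (path_fibre M (\<gamma> p))) \<and>
     (\<forall>f\<in>Cinf M. smooth_family_on M U (\<lambda>p t. fst (w p t) f)) \<and>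
     (\<forall>Y\<in>vector_fields M. smooth_family_on M U (\<lambda>p t. snd (w p t) (Y (\<gamma> p))))"
  by (simp add: cotangent_paths_def)

lemma courant_lifts_iff:
  "w \<in> lifts (courant_algebroid M) U \<gamma> \<longleftrightarrow> smooth_map_on M U \<gamma> \<and>
     (\<forall>p\<in>U. w p \<in> carrier (courant_fibre M (\<gamma> p))) \<and>
     (\<forall>f\<in>Cinf M. smooth_fun_on M U (\<lambda>p. fst (w p) f)) \<and>
     (\<forall>Y\<in>vector_fields M. smooth_fun_on M U (\<lambda>p. snd (w p) (Y (\<gamma> p))))"
  by (simp add: courant_algebroid_def)

lemma path_fibre_iff:
  "x \<in> carrier (path_fibre M m) \<longleftrightarrow> (\<forall>t. t \<notin> {0..1} \<longrightarrow> x t = gzero) \<and>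
     (\<forall>t\<in>{0..1}. fst (x t) \<in> tangent_space M m \<and> snd (x t) \<in> cotangent_space M m) \<and>
     (\<forall>f\<in>Cinf M. smooth_on UNIV {0..1} (\<lambda>t. fst (x t) f)) \<and>
     (\<forall>v\<in>tangent_space M m. smooth_on UNIV {0..1} (\<lambda>t. snd (x t) v)) \<and>
     fst (x 0) = (\<lambda>f. 0)"
  unfolding path_fibre_def by simp

text \<open>
  A linear right inverse of \<open>ev1_int\<close>: the vector \<open>X\<close> becomes the path \<open>t X\<close>, which starts at zero as required, and
  the covector becomes a constant path.
\<close>

definition split_path :: "'m gvec \<Rightarrow> 'm gpath" where
  "split_path c t = (if t \<in> {0..1} then (\<lambda>f. t * fst c f, snd c) else gzero)"

lemma split_path_lincomb: "split_path (gadd c d) = (\<lambda>t. gadd (split_path c t) (split_path d t))"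
  "split_path (gscale r c) = (\<lambda>t. gscale r (split_path c t))"
  by (auto simp: split_path_def prod_eq_iff fun_eq_iff algebra_simps)

lemma ev1_split_path: "ev1_int m (split_path c) = c"
proof -
  have "integral {0..1} (\<lambda>t. snd (split_path c t) v) = snd c v" for v
  proof -
    have "integral {0..1} (\<lambda>t. snd (split_path c t) v) = integral {0..1} (\<lambda>t::real. snd c v)"
      by (rule integral_cong) (simp add: split_path_def)
    then show ?thesis by simp
  qed
  then show ?thesis by (simp add: ev1_int_def path_integral_def prod_eq_iff fun_eq_iff) (simp add: split_path_def)
qed

text \<open>
  Transport from the fibre at \<open>p\<close> to the fibre at \<open>q\<close>: vectors keep their components in the frame and covectors
  their values on it. The set \<open>T\<close> stands for the tangent space at \<open>q\<close>, outside which covectors vanish. Paths are transported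
  pointwise in time, so that transport commutes with evaluation and integration; hence it trivializes the bundle of cotangent
  paths, the Courant bundle and the kernel at the same time.
\<close>

definition frame_transport ::
  "'e set \<Rightarrow> ('e \<Rightarrow> 'm \<Rightarrow> real) \<Rightarrow> ('e \<Rightarrow> 'm \<Rightarrow> 'm tvec) \<Rightarrow> 'm tvec set \<Rightarrow> 'm \<Rightarrow> 'm \<Rightarrow> 'm gvec \<Rightarrow> 'm gvec" where
  "frame_transport B x E T p q y =
    (\<lambda>f. \<Sum>b\<in>B. fst y (x b) * E b q f, \<lambda>v. if v \<in> T then snd y (\<lambda>f. \<Sum>b\<in>B. v (x b) * E b p f) else 0)"

lemma frame_transport_lincomb:
  "frame_transport B x E T p q (gadd y z) = gadd (frame_transport B x E T p q y) (frame_transport B x E T p q z)"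
  "frame_transport B x E T p q (gscale r y) = gscale r (frame_transport B x E T p q y)"
  "frame_transport B x E T p q gzero = gzero"
  by (auto simp: frame_transport_def prod_eq_iff fun_eq_iff algebra_simps sum.distrib sum_distrib_left)

lemma frame_transport_ev1:
  "ev1_int q (\<lambda>t. frame_transport B x E T p q (y t)) = frame_transport B x E T p q (ev1_int p y)"
  by (auto simp: ev1_int_def frame_transport_def path_integral_def prod_eq_iff fun_eq_iff)

lemma frame_transport_split_path:
  "(\<lambda>t. frame_transport B x E T p q (split_path c t)) = split_path (frame_transport B x E T p q c)"
proof
  fix t
  show "frame_transport B x E T p q (split_path c t) = split_path (frame_transport B x E T p q c) t"
  proof (cases "t \<in> {0..1}")
    case True
    then show ?thesis
      by (simp add: split_path_def frame_transport_def prod_eq_iff fun_eq_iff sum_distrib_left mult_ac)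
  next
    case False
    then have "split_path d t = gzero" for d :: "'a gvec" unfolding split_path_def by (rule if_not_P)
    then show ?thesis by (simp add: frame_transport_lincomb)
  qed
qed

context mfd
begin

lemma cotangent_space_add:
  "\<alpha> \<in> cotangent_space M m \<Longrightarrow> \<beta> \<in> cotangent_space M m \<Longrightarrow> (\<lambda>v. \<alpha> v + \<beta> v) \<in> cotangent_space M m"
  using cotangent_space_lincomb[of \<alpha> m \<beta> 1 1] by simp

lemma cotangent_space_scale: "\<alpha> \<in> cotangent_space M m \<Longrightarrow> (\<lambda>v. r * \<alpha> v) \<in> cotangent_space M m"
  using cotangent_space_lincomb[of \<alpha> m \<alpha> r 0] by simp

lemma path_fibre_lincomb:
  assumes "x \<in> carrier (path_fibre M m)" "y \<in> carrier (path_fibre M m)"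
  shows "(\<lambda>t. gadd (gscale r (x t)) (gscale s (y t))) \<in> carrier (path_fibre M m)"
  using assms tangent_space_lincomb cotangent_space_lincomb unfolding path_fibre_iff
  by (auto intro!: smooth_on_add smooth_on_mult smooth_on_const thick_unit)

lemma path_fibre_add:
  "x \<in> carrier (path_fibre M m) \<Longrightarrow> y \<in> carrier (path_fibre M m) \<Longrightarrow> (\<lambda>t. gadd (x t) (y t)) \<in> carrier (path_fibre M m)"
  using path_fibre_lincomb[of x m y 1 1] by simp

lemma path_fibre_scale:
  "x \<in> carrier (path_fibre M m) \<Longrightarrow> (\<lambda>t. gscale r (x t)) \<in> carrier (path_fibre M m)"
  using path_fibre_lincomb[of x m x r 0] by simp

lemma path_fibre_zero: "(\<lambda>t. gzero) \<in> carrier (path_fibre M m)"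
  using tangent_space_zero cotangent_space_zero by (auto simp: path_fibre_iff intro: smooth_on_const thick_unit)

lemma path_fibre_module: "Module.module reals_ring (path_fibre M m)"
  by (rule module_realsI)
    (auto simp: path_fibre_add path_fibre_scale path_fibre_zero fun_eq_iff prod_eq_iff algebra_simps)

lemma courant_fibre_module: "Module.module reals_ring (courant_fibre M m)"
  by (rule module_realsI)
    (simp_all add: mem_Times_iff prod_eq_iff fun_eq_iff algebra_simps tangent_space_zero cotangent_space_zero
      tangent_space_add cotangent_space_add tangent_space_scale cotangent_space_scale)

lemma split_path_carrier:
  assumes "c \<in> carrier (courant_fibre M m)"
  shows "split_path c \<in> carrier (path_fibre M m)"
  unfolding path_fibre_iff
proof (intro conjI ballI allI impI)
  have id: "smooth_on UNIV {0..1} (\<lambda>t::real. t)"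
    by (rule smooth_on_bounded_linear[OF thick_unit bounded_linear_ident])
  show "smooth_on UNIV {0..1} (\<lambda>t. fst (split_path c t) f)" for f
    by (rule iffD1[OF smooth_on_cong smooth_on_mult[OF thick_unit id smooth_on_const[OF thick_unit, of "fst c f"]]])
      (simp add: split_path_def)
  show "smooth_on UNIV {0..1} (\<lambda>t. snd (split_path c t) v)" for v
    by (rule iffD1[OF smooth_on_cong smooth_on_const[OF thick_unit, of "snd c v"]]) (simp add: split_path_def)
qed (use assms in \<open>auto simp: split_path_def tangent_space_scale\<close>)

lemma smooth_map_local:
  assumes "open U" "\<And>p. p \<in> U \<Longrightarrow> \<exists>V. open V \<and> p \<in> V \<and> smooth_map_on M V \<gamma>"
  shows "smooth_map_on M U \<gamma>"
  unfolding smooth_map_on_def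
proof (rule ballI, rule smooth_fun_local[OF assms(1)])
  fix f p assume "f \<in> Cinf M" "p \<in> U"
  then show "\<exists>N. open N \<and> p \<in> N \<and> smooth_fun_on M N (f \<circ> \<gamma>)"
    using assms(2)[of p] unfolding smooth_map_on_def by blast
qed

lemma smooth_map_id: "open V \<Longrightarrow> smooth_map_on M V (\<lambda>p. p)"
  by (auto simp: smooth_map_on_def o_def intro: CinfD)

lemma smooth_map_const: "open V \<Longrightarrow> smooth_map_on M V (\<lambda>p. m)"
  by (auto simp: smooth_map_on_def o_def intro: smooth_fun_constant)

lemma path_lifts_local:
  assumes U: "open U"
  shows "w \<in> lifts (cotangent_paths M) U \<gamma> \<longleftrightarrow>
      (\<forall>p\<in>U. \<exists>V w'. open V \<and> p \<in> V \<and> V \<subseteq> U \<and> w' \<in> lifts (cotangent_paths M) V \<gamma> \<and> (\<forall>q\<in>V. w q = w' q))"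
proof
  assume "w \<in> lifts (cotangent_paths M) U \<gamma>"
  then show "\<forall>p\<in>U. \<exists>V w'. open V \<and> p \<in> V \<and> V \<subseteq> U \<and> w' \<in> lifts (cotangent_paths M) V \<gamma> \<and> (\<forall>q\<in>V. w q = w' q)"
    using U by (intro ballI exI[of _ U] exI[of _ w]) simp
next
  assume R: "\<forall>p\<in>U. \<exists>V w'. open V \<and> p \<in> V \<and> V \<subseteq> U \<and> w' \<in> lifts (cotangent_paths M) V \<gamma> \<and> (\<forall>q\<in>V. w q = w' q)"
  have loc: "\<exists>V. open V \<and> p \<in> V \<and> w \<in> lifts (cotangent_paths M) V \<gamma>" if "p \<in> U" for p
  proof -
    from bspec[OF R that] obtain V w' where V: "open V" "p \<in> V" "w' \<in> lifts (cotangent_paths M) V \<gamma>" "\<forall>q\<in>V. w q = w' q"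
      by (elim exE conjE)
    have "smooth_family_on M V (\<lambda>p t. fst (w p t) f) \<longleftrightarrow> smooth_family_on M V (\<lambda>p t. fst (w' p t) f)"
      "smooth_family_on M V (\<lambda>p t. snd (w p t) (Y (\<gamma> p))) \<longleftrightarrow> smooth_family_on M V (\<lambda>p t. snd (w' p t) (Y (\<gamma> p)))" for f Y
      by (rule family_cong, simp add: V(4))+
    then have "w \<in> lifts (cotangent_paths M) V \<gamma>" using V(3,4) unfolding path_lifts_iff by simp
    then show ?thesis using V(1,2) by blast
  qed
  have map: "smooth_map_on M U \<gamma>"
  proof (rule smooth_map_local[OF U])
    fix p assume "p \<in> U"
    from loc[OF this] obtain V where V: "open V" "p \<in> V" "w \<in> lifts (cotangent_paths M) V \<gamma>" by (elim exE conjE)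
    then show "\<exists>V. open V \<and> p \<in> V \<and> smooth_map_on M V \<gamma>"
      by (intro exI[of _ V]) (simp add: path_lifts_iff)
  qed
  have mem: "w p \<in> carrier (path_fibre M (\<gamma> p))" if "p \<in> U" for p
  proof -
    from loc[OF that] obtain V where V: "open V" "p \<in> V" "w \<in> lifts (cotangent_paths M) V \<gamma>" by (elim exE conjE)
    then show ?thesis by (simp add: path_lifts_iff)
  qed
  have vec: "smooth_family_on M U (\<lambda>p t. fst (w p t) f)" if "f \<in> Cinf M" for f
  proof (rule family_local[OF U])
    fix p assume "p \<in> U"
    from loc[OF this] obtain V where V: "open V" "p \<in> V" "w \<in> lifts (cotangent_paths M) V \<gamma>" by (elim exE conjE)
    then show "\<exists>V. open V \<and> p \<in> V \<and> smooth_family_on M V (\<lambda>p t. fst (w p t) f)"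
      using that by (intro exI[of _ V]) (simp add: path_lifts_iff)
  qed
  have cov: "smooth_family_on M U (\<lambda>p t. snd (w p t) (Y (\<gamma> p)))" if "Y \<in> vector_fields M" for Y
  proof (rule family_local[OF U])
    fix p assume "p \<in> U"
    from loc[OF this] obtain V where V: "open V" "p \<in> V" "w \<in> lifts (cotangent_paths M) V \<gamma>" by (elim exE conjE)
    then show "\<exists>V. open V \<and> p \<in> V \<and> smooth_family_on M V (\<lambda>p t. snd (w p t) (Y (\<gamma> p)))"
      using that by (intro exI[of _ V]) (simp add: path_lifts_iff)
  qed
  show "w \<in> lifts (cotangent_paths M) U \<gamma>" using map mem vec cov by (simp add: path_lifts_iff)
qed

context
  fixes U c B N x E
  assumes frame: "chart_frame U c B N x E"
begin

abbreviation "ft \<equiv> \<lambda>p q. frame_transport B x E (tangent_space M q) p q"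

lemma frame_vec: "q \<in> N \<Longrightarrow> (\<lambda>f. \<Sum>b\<in>B. r b * E b q f) \<in> tangent_space M q"
  by (intro tangent_space_sum vector_field_at chart_frameD(8)[OF frame])

lemma frame_coord:
  assumes "q \<in> N" "a \<in> B"
  shows "(\<Sum>b\<in>B. r b * E b q (x a)) = r a"
proof -
  have "(\<Sum>b\<in>B. r b * E b q (x a)) = (\<Sum>b\<in>B. if b = a then r b else 0)"
    by (rule sum.cong) (simp_all add: chart_frameD(10)[OF frame assms(1) _ assms(2)])
  then show ?thesis using assms(2) chart_frameD(5)[OF frame] by simp
qed

lemma frame_expand: "p \<in> N \<Longrightarrow> v \<in> tangent_space M p \<Longrightarrow> (\<lambda>f. \<Sum>b\<in>B. v (x b) * E b p f) = v"
  using chart_frameD(11)[OF frame] by simp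

lemma ft_carrier:
  assumes pq: "p \<in> N" "q \<in> N" and y: "snd y \<in> cotangent_space M p"
  shows "fst (ft p q y) \<in> tangent_space M q" "snd (ft p q y) \<in> cotangent_space M q"
proof -
  show "fst (ft p q y) \<in> tangent_space M q" by (simp add: frame_transport_def frame_vec pq)
  show "snd (ft p q y) \<in> cotangent_space M q"
  proof (rule cotangentI)
    fix X Y r s assume X: "X \<in> vector_fields M" and Y: "Y \<in> vector_fields M"
    note Xq = vector_field_at[OF X, of q] and Yq = vector_field_at[OF Y, of q]
    have "(\<lambda>f. \<Sum>b\<in>B. (r * X q (x b) + s * Y q (x b)) * E b p f) =
        (\<lambda>f. r * (\<Sum>b\<in>B. X q (x b) * E b p f) + s * (\<Sum>b\<in>B. Y q (x b) * E b p f))"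
      by (simp add: sum_distrib_left sum.distrib[symmetric] algebra_simps)
    then show "snd (ft p q y) (\<lambda>f. r * X q f + s * Y q f) = r * snd (ft p q y) (X q) + s * snd (ft p q y) (Y q)"
      using cotangent_linear[OF y frame_vec[OF pq(1)] frame_vec[OF pq(1)]]
      by (simp add: frame_transport_def Xq Yq tangent_space_lincomb)
  qed (simp add: frame_transport_def)
qed

lemma ft_inverse:
  assumes pq: "p \<in> N" "q \<in> N" and y: "fst y \<in> tangent_space M p" "snd y \<in> cotangent_space M p"
  shows "ft q p (ft p q y) = y"
proof (rule gvec_eqI)
  fix f
  show "fst (ft q p (ft p q y)) f = fst y f"
    using fun_cong[OF frame_expand[OF pq(1) y(1)], of f] by (simp add: frame_transport_def frame_coord pq(2))
next
  fix v
  show "snd (ft q p (ft p q y)) v = snd y v"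
  proof (cases "v \<in> tangent_space M p")
    case True
    then show ?thesis
      using frame_expand[OF pq(1) True] by (simp add: frame_transport_def frame_coord frame_vec pq(2))
  next
    case False
    then show ?thesis using cotangent_outside[OF y(2) False] by (simp add: frame_transport_def)
  qed
qed

lemma ft_linear_iso:
  assumes pq: "p \<in> N" "q \<in> N"
  shows "linear_iso (courant_fibre M p) (courant_fibre M q) (ft p q)"
proof -
  have map: "ft p q ` carrier (courant_fibre M p) \<subseteq> carrier (courant_fibre M q)" if "p \<in> N" "q \<in> N" for p q
    by (rule image_subsetI) (simp add: mem_Times_iff ft_carrier[OF that])
  have inv: "\<forall>y\<in>carrier (courant_fibre M p). ft q p (ft p q y) = y" if "p \<in> N" "q \<in> N" for p q
    by (simp add: mem_Times_iff ft_inverse[OF that] Ball_def)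
  have "bij_betw (ft p q) (carrier (courant_fibre M p)) (carrier (courant_fibre M q))"
    by (rule bij_betw_byWitness[where f' = "ft q p", OF inv[OF pq] inv[OF pq(2,1)] map[OF pq] map[OF pq(2,1)]])
  then show ?thesis using ft_carrier[OF pq]
    by (auto simp: linear_iso_def linear_map_def frame_transport_lincomb mem_Times_iff)
qed

lemma path_ft_carrier:
  assumes pq: "p \<in> N" "q \<in> N" and y: "y \<in> carrier (path_fibre M p)"
  shows "(\<lambda>t. ft p q (y t)) \<in> carrier (path_fibre M q)"
  unfolding path_fibre_iff
proof (intro conjI ballI allI impI)
  note Y = y[unfolded path_fibre_iff]
  show "smooth_on UNIV {0..1} (\<lambda>t. fst (ft p q (y t)) f)" for f
    using Y chart_frameD(7)[OF frame] unfolding frame_transport_def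
    by (auto intro!: smooth_on_sum smooth_on_mult smooth_on_const thick_unit)
  show "smooth_on UNIV {0..1} (\<lambda>t. snd (ft p q (y t)) v)" if "v \<in> tangent_space M q" for v
    using Y that frame_vec[OF pq(1)] by (simp add: frame_transport_def)
  show "ft p q (y t) = gzero" if "t \<notin> {0..1}" for t
    using Y that frame_transport_lincomb(3)[of B x E "tangent_space M q" p q] by simp
  show "fst (ft p q (y t)) \<in> tangent_space M q" "snd (ft p q (y t)) \<in> cotangent_space M q" if "t \<in> {0..1}" for t
    by (rule ft_carrier[OF pq]; use Y that in blast)+
  show "fst (ft p q (y 0)) = (\<lambda>f. 0)" using Y by (simp add: frame_transport_def)
qed

lemma path_ft_inverse:
  assumes pq: "p \<in> N" "q \<in> N" and y: "y \<in> carrier (path_fibre M p)"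
  shows "(\<lambda>t. ft q p (ft p q (y t))) = y"
proof
  fix t
  note Y = y[unfolded path_fibre_iff]
  show "ft q p (ft p q (y t)) = y t"
  proof (cases "t \<in> {0..1}")
    case True
    then show ?thesis using Y by (intro ft_inverse pq) blast+
  next
    case False
    then show ?thesis using Y by (simp add: frame_transport_lincomb)
  qed
qed

lemma path_ft_linear_iso:
  assumes pq: "p \<in> N" "q \<in> N"
  shows "linear_iso (path_fibre M p) (path_fibre M q) (\<lambda>y t. ft p q (y t))"
proof -
  have "bij_betw (\<lambda>y t. ft p q (y t)) (carrier (path_fibre M p)) (carrier (path_fibre M q))"
    by (rule bij_betw_byWitness[where f' = "\<lambda>y t. ft q p (y t)"])
      (use pq in \<open>auto simp: path_ft_inverse path_ft_carrier\<close>)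
  then show ?thesis using path_ft_carrier[OF pq]
    by (auto simp: linear_iso_def linear_map_def frame_transport_lincomb)
qed

text \<open>
  Both sides say that the components in the frame, the functions \<open>X\<^sub>t (x b)\<close> and \<open>\<alpha>\<^sub>t (E b)\<close>, are smooth families.
\<close>

lemma path_ft_lifts:
  assumes V: "open V" "V \<subseteq> N" and m: "m \<in> N" and w: "\<And>p. p \<in> V \<Longrightarrow> w p \<in> carrier (path_fibre M p)"
  shows "w \<in> lifts (cotangent_paths M) V (\<lambda>p. p) \<longleftrightarrow> (\<lambda>p t. ft p m (w p t)) \<in> lifts (cotangent_paths M) V (\<lambda>p. m)"
proof -
  note xC = chart_frameD(7)[OF frame] and EV = chart_frameD(8)[OF frame]
  have wT: "fst (w p t) \<in> tangent_space M p" "snd (w p t) \<in> cotangent_space M p" if "p \<in> V" "t \<in> {0..1}" for p t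
    using w[OF that(1)] that(2) by (auto simp: path_fibre_iff)
  have vec: "(\<forall>f\<in>Cinf M. smooth_family_on M V (\<lambda>p t. fst (w p t) f)) \<longleftrightarrow>
      (\<forall>f\<in>Cinf M. smooth_family_on M V (\<lambda>p t. fst (ft p m (w p t)) f))" (is "?L \<longleftrightarrow> ?R")
  proof
    assume ?L
    then show ?R using xC V(1) by (auto simp: frame_transport_def intro!: family_sum family_mult family_constant)
  next
    assume R: ?R
    \<comment> \<open>The transported vector has the same values on the coordinate functions.\<close>
    have coord: "smooth_family_on M V (\<lambda>p t. fst (w p t) (x b))" if b: "b \<in> B" for b
      using bspec[OF R xC[OF b]] by (simp add: frame_transport_def frame_coord[OF m b])
    show ?L
    proof
      fix f assume f: "f \<in> Cinf M"
      have "smooth_family_on M V (\<lambda>p t. \<Sum>b\<in>B. fst (w p t) (x b) * E b p f)"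
        by (intro family_sum family_mult V(1) coord Cinf_family vector_field_smooth[OF EV f])
      then show "smooth_family_on M V (\<lambda>p t. fst (w p t) f)"
        by (rule iffD1[OF family_cong, rotated]) (use fun_cong[OF frame_expand] wT V(2) in blast)
    qed
  qed
  have cov: "(\<forall>Y\<in>vector_fields M. smooth_family_on M V (\<lambda>p t. snd (w p t) (Y p))) \<longleftrightarrow>
      (\<forall>Y\<in>vector_fields M. smooth_family_on M V (\<lambda>p t. snd (ft p m (w p t)) (Y m)))" (is "?L \<longleftrightarrow> ?R")
  proof
    assume L: ?L
    show ?R
    proof
      fix Y assume Y: "Y \<in> vector_fields M"
      have "smooth_family_on M V (\<lambda>p t. \<Sum>b\<in>B. Y m (x b) * snd (w p t) (E b p))"
        by (intro family_sum family_mult family_constant V(1) bspec[OF L EV])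
      then show "smooth_family_on M V (\<lambda>p t. snd (ft p m (w p t)) (Y m))"
      proof (rule iffD1[OF family_cong, rotated])
        fix p t assume p: "p \<in> V" and t: "t \<in> {0..1::real}"
        show "(\<Sum>b\<in>B. Y m (x b) * snd (w p t) (E b p)) = snd (ft p m (w p t)) (Y m)"
          using cotangent_sum[OF wT(2)[OF p t] vector_field_at[OF EV], of B "\<lambda>b. b" "\<lambda>b. Y m (x b)"] vector_field_at[OF Y, of m]
          by (simp add: frame_transport_def)
      qed
    qed
  next
    assume R: ?R
    \<comment> \<open>Transport carries \<open>E b p\<close> to \<open>E b m\<close>, so the hypothesis for \<open>Y = E b\<close> is smoothness of a component.\<close>
    have comp: "smooth_family_on M V (\<lambda>p t. snd (w p t) (E b p))" if b: "b \<in> B" for b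
    proof (rule iffD1[OF family_cong bspec[OF R EV[OF b]]])
      fix p t assume p: "p \<in> V" and t: "t \<in> {0..1::real}"
      have "(\<lambda>f. \<Sum>a\<in>B. E b m (x a) * E a p f) = E b p"
      proof
        fix f
        have "(\<Sum>a\<in>B. E b m (x a) * E a p f) = (\<Sum>a\<in>B. if b = a then E a p f else 0)"
          by (rule sum.cong) (simp_all add: chart_frameD(10)[OF frame m b])
        then show "(\<Sum>a\<in>B. E b m (x a) * E a p f) = E b p f" using b chart_frameD(5)[OF frame] by simp
      qed
      then show "snd (ft p m (w p t)) (E b m) = snd (w p t) (E b p)"
        using vector_field_at[OF EV[OF b], of m] by (simp add: frame_transport_def)
    qed
    show ?L
    proof
      fix Y assume Y: "Y \<in> vector_fields M"
      have "smooth_family_on M V (\<lambda>p t. \<Sum>b\<in>B. Y p (x b) * snd (w p t) (E b p))"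
        by (intro family_sum family_mult V(1) comp Cinf_family vector_field_smooth[OF Y xC])
      then show "smooth_family_on M V (\<lambda>p t. snd (w p t) (Y p))"
      proof (rule iffD1[OF family_cong, rotated])
        fix p t assume p: "p \<in> V" and t: "t \<in> {0..1::real}"
        have "p \<in> N" using p V(2) by auto
        from frame_expand[OF this vector_field_at[OF Y]]
        show "(\<Sum>b\<in>B. Y p (x b) * snd (w p t) (E b p)) = snd (w p t) (Y p)"
          using cotangent_sum[OF wT(2)[OF p t] vector_field_at[OF EV], of B "\<lambda>b. b" "\<lambda>b. Y p (x b)"] by simp
      qed
    qed
  qed
  have "(\<lambda>t. ft p m (w p t)) \<in> carrier (path_fibre M m)" if "p \<in> V" for p
    by (rule path_ft_carrier[OF _ m w[OF that]]) (use that V(2) in auto)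
  then show ?thesis
    unfolding path_lifts_iff vec cov using smooth_map_id[OF V(1)] smooth_map_const[OF V(1)] w by simp
qed

lemma path_local_trivialization:
  assumes m: "m \<in> N"
  shows "local_trivialization (cotangent_paths M) m N (\<lambda>p y t. ft p m (y t))"
  unfolding local_trivialization_def cotangent_paths_simps
  using m chart_frameD(3)[OF frame] path_ft_linear_iso[OF _ m] path_ft_lifts[OF _ _ m] by simp

end

lemma path_vector_bundle: "vector_bundle M (cotangent_paths M)"
proof -
  have basic: "smooth_map_on M U \<gamma>" "\<forall>p\<in>U. w p \<in> carrier (fibre (cotangent_paths M) (\<gamma> p))"
    if "open U" "w \<in> lifts (cotangent_paths M) U \<gamma>" for U w \<gamma>
    using that by (simp_all add: path_lifts_iff)
  have const: "(\<lambda>p. e) \<in> lifts (cotangent_paths M) U (\<lambda>p. m)"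
    if U: "open U" and e: "e \<in> carrier (fibre (cotangent_paths M) m)" for U m e
    using e U vector_field_at unfolding path_lifts_iff cotangent_paths_simps path_fibre_iff
    by (auto intro!: smooth_map_const family_path)
  have add: "(\<lambda>p. w p \<oplus>\<^bsub>fibre (cotangent_paths M) (\<gamma> p)\<^esub> w' p) \<in> lifts (cotangent_paths M) U \<gamma>"
    if U: "open U" and w: "w \<in> lifts (cotangent_paths M) U \<gamma>" "w' \<in> lifts (cotangent_paths M) U \<gamma>" for U \<gamma> w w'
    using w unfolding path_lifts_iff by (simp add: path_fibre_add family_add[OF U])
  have scale: "(\<lambda>p. f p \<odot>\<^bsub>fibre (cotangent_paths M) (\<gamma> p)\<^esub> w p) \<in> lifts (cotangent_paths M) U \<gamma>"
    if U: "open U" and w: "w \<in> lifts (cotangent_paths M) U \<gamma>" and f: "smooth_fun_on M U f" for U \<gamma> w f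
    using w unfolding path_lifts_iff by (simp add: path_fibre_scale family_mult[OF U family_const[OF U f]])
  have triv: "\<exists>U \<psi>. local_trivialization (cotangent_paths M) m U \<psi>" for m
  proof -
    obtain U c B N x E where fr: "chart_frame U c B N x E" "m \<in> N" using chart_frame_exists by blast
    show ?thesis using path_local_trivialization[OF fr] by blast
  qed
  have modl: "Module.module reals_ring (fibre (cotangent_paths M) m)" for m by (simp add: path_fibre_module)
  show ?thesis
    unfolding vector_bundle_def
    by (intro conjI allI impI) (rule modl basic path_lifts_local const add scale triv; assumption)+
qed

text \<open>
  Smoothness in the Courant bundle is smoothness of the associated paths; in one direction \<open>t X\<close> is evaluated at
  \<open>t = 1\<close>.
\<close>

lemma courant_lifts_split:
  assumes U: "open U"
  shows "w \<in> lifts (courant_algebroid M) U \<gamma> \<longleftrightarrow>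
    (\<forall>p\<in>U. w p \<in> carrier (fibre (courant_algebroid M) (\<gamma> p))) \<and> (\<lambda>p. split_path (w p)) \<in> lifts (cotangent_paths M) U \<gamma>"
proof -
  have "smooth_fun_on M U (\<lambda>p. fst (w p) f) \<longleftrightarrow> smooth_family_on M U (\<lambda>p t. fst (split_path (w p) t) f)" for f
  proof
    assume "smooth_fun_on M U (\<lambda>p. fst (w p) f)"
    from family_mult[OF U family_time[OF U] family_const[OF U this]]
    show "smooth_family_on M U (\<lambda>p t. fst (split_path (w p) t) f)"
      by (rule iffD1[OF family_cong, rotated]) (simp add: split_path_def)
  next
    assume "smooth_family_on M U (\<lambda>p t. fst (split_path (w p) t) f)"
    from family_at[OF U _ this, of 1] show "smooth_fun_on M U (\<lambda>p. fst (w p) f)" by (simp add: split_path_def)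
  qed
  moreover have "smooth_fun_on M U (\<lambda>p. snd (w p) (Y (\<gamma> p))) \<longleftrightarrow> smooth_family_on M U (\<lambda>p t. snd (split_path (w p) t) (Y (\<gamma> p)))" for Y
  proof -
    have "smooth_family_on M U (\<lambda>p t. snd (split_path (w p) t) (Y (\<gamma> p))) \<longleftrightarrow> smooth_family_on M U (\<lambda>p t. snd (w p) (Y (\<gamma> p)))"
      by (rule family_cong) (simp add: split_path_def)
    then show ?thesis using smooth_fun_iff_family[OF U, of "\<lambda>p. snd (w p) (Y (\<gamma> p))"] by simp
  qed
  ultimately show ?thesis
    using split_path_carrier[of "w _"] unfolding courant_lifts_iff path_lifts_iff courant_algebroid_simps by blast
qed

lemma courant_vector_bundle: "vector_bundle M (courant_algebroid M)"
proof (rule vector_bundle_pullback[OF path_vector_bundle _ _ courant_lifts_split])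
  show "Module.module reals_ring (fibre (courant_algebroid M) m)" for m by (simp add: courant_fibre_module)
  show "linear_map (fibre (courant_algebroid M) m) (fibre (cotangent_paths M) m) split_path" for m
    using split_path_carrier[of _ m] by (auto simp: linear_map_def split_path_lincomb)
  show "\<exists>U \<psi> \<psi>'. local_trivialization (cotangent_paths M) m U \<psi> \<and>
      (\<forall>p\<in>U. linear_iso (fibre (courant_algebroid M) p) (fibre (courant_algebroid M) m) (\<psi>' p) \<and>
        (\<forall>x\<in>carrier (fibre (courant_algebroid M) p). split_path (\<psi>' p x) = \<psi> p (split_path x)))" for m
  proof -
    obtain U c B N x E where fr: "chart_frame U c B N x E" "m \<in> N" using chart_frame_exists by blast
    show ?thesis
      using path_local_trivialization[OF fr] ft_linear_iso[OF fr(1) _ fr(2)]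
      by (intro exI[of _ N] exI[of _ "\<lambda>p y t. frame_transport B x E (tangent_space M m) p m (y t)"]
          exI[of _ "\<lambda>p. frame_transport B x E (tangent_space M m) p m"])
        (simp add: frame_transport_split_path)
  qed
qed

lemma path_smooth_anchor: "smooth_anchor M (cotangent_paths M)"
proof -
  have "smooth_fun_on M U (\<lambda>p. fst (w p 1) f)"
    if "open U" "w \<in> lifts (cotangent_paths M) U \<gamma>" "f \<in> Cinf M" for U w \<gamma> f
    using that by (intro family_at) (auto simp: path_lifts_iff)
  then show ?thesis unfolding smooth_anchor_def by (auto simp: path_fibre_iff)
qed

lemma courant_smooth_anchor: "smooth_anchor M (courant_algebroid M)"
  unfolding smooth_anchor_def by (auto simp: courant_lifts_iff)

lemma path_leibniz_algebroid: "leibniz_algebroid M (cotangent_paths M)"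
proof -
  let ?P = "cotangent_paths M"
  have add: "bracket ?P (\<lambda>p. a p \<oplus>\<^bsub>fibre ?P p\<^esub> b p) c = (\<lambda>p. bracket ?P a c p \<oplus>\<^bsub>fibre ?P p\<^esub> bracket ?P b c p) \<and>
      bracket ?P a (\<lambda>p. b p \<oplus>\<^bsub>fibre ?P p\<^esub> c p) = (\<lambda>p. bracket ?P a b p \<oplus>\<^bsub>fibre ?P p\<^esub> bracket ?P a c p)"
    if "a \<in> sections ?P" "b \<in> sections ?P" "c \<in> sections ?P" for a b c
    using path_bracket_lincomb_left[OF that, of 1 1] path_bracket_lincomb_right[OF that Cinf_const Cinf_const, of 1 1]
      tangent_const[OF vector_field_at[OF path_sectionD(5)[OF that(1)]]] by simp
  have scale: "bracket ?P (\<lambda>p. r \<odot>\<^bsub>fibre ?P p\<^esub> a p) b = (\<lambda>p. r \<odot>\<^bsub>fibre ?P p\<^esub> bracket ?P a b p) \<and>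
      bracket ?P a (\<lambda>p. r \<odot>\<^bsub>fibre ?P p\<^esub> b p) = (\<lambda>p. r \<odot>\<^bsub>fibre ?P p\<^esub> bracket ?P a b p)"
    if "a \<in> sections ?P" "b \<in> sections ?P" for r a b
    using path_bracket_lincomb_left[OF that(1,1,2), of r 0] path_bracket_lincomb_right[OF that that(2) Cinf_const Cinf_const, of r 0]
      tangent_const[OF vector_field_at[OF path_sectionD(5)[OF that(1)]]] by simp
  have lb: "bracket ?P a (bracket ?P b c) = (\<lambda>p. bracket ?P (bracket ?P a b) c p \<oplus>\<^bsub>fibre ?P p\<^esub> bracket ?P b (bracket ?P a c) p)"
    if "a \<in> sections ?P" "b \<in> sections ?P" "c \<in> sections ?P" for a b c
    using path_bracket_leibniz[OF that] by simp
  have rl: "bracket ?P a (\<lambda>p. f p \<odot>\<^bsub>fibre ?P p\<^esub> b p) = (\<lambda>p. (f p \<odot>\<^bsub>fibre ?P p\<^esub> bracket ?P a b p) \<oplus>\<^bsub>fibre ?P p\<^esub>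
                 (anchor ?P p (a p) f \<odot>\<^bsub>fibre ?P p\<^esub> b p))"
    if "a \<in> sections ?P" "b \<in> sections ?P" "f \<in> Cinf M" for a b f
    using path_bracket_lincomb_right[OF that(1,2,2,3) Cinf_const, of 0]
      tangent_const[OF vector_field_at[OF path_sectionD(5)[OF that(1)]]] by simp
  have cl: "bracket ?P a b \<in> sections ?P" if "a \<in> sections ?P" "b \<in> sections ?P" for a b
    using path_bracket_section[OF that] by simp
  show ?thesis
    unfolding leibniz_algebroid_def
    by (intro conjI path_vector_bundle path_smooth_anchor; intro allI ballI) (rule cl add scale lb rl; assumption)+
qed

end


section \<open>The quotient by the kernel paths\<close>

lemma linear_iso_comp:
  "linear_iso V W g \<Longrightarrow> linear_iso W Z h \<Longrightarrow> linear_iso V Z (\<lambda>x. h (g x))"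
  unfolding linear_iso_def linear_map_def using bij_betw_trans[of g "carrier V" "carrier W" h "carrier Z"]
  by (simp add: o_def)

lemma linear_iso_inv:
  assumes h: "linear_iso V W h"
    and cl: "\<And>x y. x \<in> carrier V \<Longrightarrow> y \<in> carrier V \<Longrightarrow> x \<oplus>\<^bsub>V\<^esub> y \<in> carrier V"
      "\<And>r x. x \<in> carrier V \<Longrightarrow> r \<odot>\<^bsub>V\<^esub> x \<in> carrier V"
  shows "linear_iso W V (inv_into (carrier V) h)"
proof -
  let ?g = "inv_into (carrier V) h"
  have lin: "linear_map V W h" and bij: "bij_betw h (carrier V) (carrier W)" using h by (auto simp: linear_iso_def)
  have gh: "?g (h x) = x" if "x \<in> carrier V" for x using bij_betw_inv_into_left[OF bij that] .
  have hg: "h (?g y) = y" "?g y \<in> carrier V" if "y \<in> carrier W" for y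
    using bij_betw_inv_into_right[OF bij that] bij_betwE[OF bij_betw_inv_into[OF bij]] that by auto
  have "?g (x \<oplus>\<^bsub>W\<^esub> y) = ?g x \<oplus>\<^bsub>V\<^esub> ?g y" if "x \<in> carrier W" "y \<in> carrier W" for x y
    using gh[OF cl(1)[OF hg(2)[OF that(1)] hg(2)[OF that(2)]]]
      linear_mapD(2)[OF lin hg(2)[OF that(1)] hg(2)[OF that(2)]] hg(1) that by simp
  moreover have "?g (r \<odot>\<^bsub>W\<^esub> x) = r \<odot>\<^bsub>V\<^esub> ?g x" if "x \<in> carrier W" for r x
    using gh[OF cl(2)[OF hg(2)[OF that]]] linear_mapD(3)[OF lin hg(2)[OF that]] hg(1)[OF that] by simp
  ultimately show ?thesis
    using hg(2) bij_betw_inv_into[OF bij] by (auto simp: linear_iso_def linear_map_def)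
qed

text \<open>
  The fibres of \<open>ev1_int\<close>. By \<open>path_class_coset\<close> they are the cosets of the kernel paths, so that the quotient
  bundle can be handled without cosets.
\<close>

definition path_class :: "('m, 'e::euclidean_space) manifold \<Rightarrow> 'm \<Rightarrow> 'm gvec \<Rightarrow> 'm gpath set" where
  "path_class M m c = {x \<in> carrier (path_fibre M m). ev1_int m x = c}"

lemma kernel_paths_eq: "kernel_paths M m = path_class M m gzero"
  by (auto simp: kernel_paths_def path_class_def ev1_int_def gzero_def)

context mfd
begin

abbreviation "path_quotient \<equiv> quotient_algebroid (cotangent_paths M) (kernel_paths M)"

lemma path_pairing_integrable:
  assumes "x \<in> carrier (path_fibre M m)"
  shows "(\<lambda>t. snd (x t) v) integrable_on {0..1}"
proof (cases "v \<in> tangent_space M m")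
  case True
  then have "smooth_on UNIV {0..1} (\<lambda>t. snd (x t) v)" using assms unfolding path_fibre_iff by blast
  then show ?thesis by (intro integrable_continuous_real smooth_on_continuous)
next
  case False
  have "snd (x t) v = 0" if "t \<in> {0..1}" for t
    by (rule cotangent_outside[OF _ False]) (use assms that in \<open>auto simp: path_fibre_iff\<close>)
  then show ?thesis by (intro integrable_eq[OF integrable_0]) simp
qed

lemma ev1_lincomb:
  assumes "x \<in> carrier (path_fibre M m)" "y \<in> carrier (path_fibre M m)"
  shows "ev1_int m (\<lambda>t. gadd (gscale r (x t)) (gscale s (y t))) = gadd (gscale r (ev1_int m x)) (gscale s (ev1_int m y))"
  using path_pairing_integrable[OF assms(1)] path_pairing_integrable[OF assms(2)]
  by (simp add: ev1_int_def path_integral_def prod_eq_iff fun_eq_iff integral_add integrable_on_mult_right)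

lemma ev1_add:
  "x \<in> carrier (path_fibre M m) \<Longrightarrow> y \<in> carrier (path_fibre M m) \<Longrightarrow>
    ev1_int m (\<lambda>t. gadd (x t) (y t)) = gadd (ev1_int m x) (ev1_int m y)"
  using ev1_lincomb[of x m y 1 1] by simp

lemma ev1_scale:
  "x \<in> carrier (path_fibre M m) \<Longrightarrow> ev1_int m (\<lambda>t. gscale r (x t)) = gscale r (ev1_int m x)"
  using ev1_lincomb[of x m x r 0] by simp

lemma ev1_carrier:
  assumes x: "x \<in> carrier (path_fibre M m)"
  shows "ev1_int m x \<in> carrier (courant_fibre M m)"
proof -
  note X = x[unfolded path_fibre_iff]
  have C: "snd (x t) \<in> cotangent_space M m" if "t \<in> {0..1}" for t using X that by blast
  have "path_integral (\<lambda>t. snd (x t)) \<in> cotangent_space M m"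
  proof (rule cotangentI)
    fix v assume out: "v \<notin> tangent_space M m"
    have "integral {0..1} (\<lambda>t. snd (x t) v) = integral {0..1} (\<lambda>t::real. 0)"
      by (rule integral_cong) (rule cotangent_outside[OF C out])
    then show "path_integral (\<lambda>t. snd (x t)) v = 0" by (simp add: path_integral_def)
  next
    fix Y Z r s assume Y: "Y \<in> vector_fields M" and Z: "Z \<in> vector_fields M"
    have "integral {0..1} (\<lambda>t. snd (x t) (\<lambda>f. r * Y m f + s * Z m f)) =
        integral {0..1} (\<lambda>t. r * snd (x t) (Y m) + s * snd (x t) (Z m))"
      by (rule integral_cong) (rule cotangent_linear[OF C vector_field_at[OF Y] vector_field_at[OF Z]])
    then show "path_integral (\<lambda>t. snd (x t)) (\<lambda>f. r * Y m f + s * Z m f) =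
        r * path_integral (\<lambda>t. snd (x t)) (Y m) + s * path_integral (\<lambda>t. snd (x t)) (Z m)"
      using path_pairing_integrable[OF x] by (simp add: path_integral_def integral_add integrable_on_mult_right)
  qed
  then show ?thesis using X by (simp add: ev1_int_def)
qed

lemma path_class_coset:
  assumes x: "x \<in> carrier (path_fibre M m)"
  shows "kernel_paths M m +>\<^bsub>path_fibre M m\<^esub> x = path_class M m (ev1_int m x)"
proof
  show "kernel_paths M m +>\<^bsub>path_fibre M m\<^esub> x \<subseteq> path_class M m (ev1_int m x)"
    using x by (auto simp: a_r_coset_def' kernel_paths_eq path_class_def path_fibre_add ev1_add)
  show "path_class M m (ev1_int m x) \<subseteq> kernel_paths M m +>\<^bsub>path_fibre M m\<^esub> x"
  proof
    fix y assume "y \<in> path_class M m (ev1_int m x)"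
    then have y: "y \<in> carrier (path_fibre M m)" "ev1_int m y = ev1_int m x" by (auto simp: path_class_def)
    let ?h = "\<lambda>t. gadd (gscale 1 (y t)) (gscale (-1) (x t))"
    have "?h \<in> kernel_paths M m"
      using path_fibre_lincomb[OF y(1) x, of 1 "-1"] ev1_lincomb[OF y(1) x, of 1 "-1"] y(2)
      by (simp add: kernel_paths_eq path_class_def prod_eq_iff)
    moreover have "y = (\<lambda>t. gadd (?h t) (x t))" by (simp add: fun_eq_iff prod_eq_iff)
    ultimately show "y \<in> kernel_paths M m +>\<^bsub>path_fibre M m\<^esub> x" unfolding a_r_coset_def' by auto
  qed
qed

lemma split_path_class: "c \<in> carrier (courant_fibre M m) \<Longrightarrow> split_path c \<in> path_class M m c"
  using split_path_carrier[of c m] by (simp add: path_class_def ev1_split_path)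

lemma induced_map_class:
  assumes "c \<in> carrier (courant_fibre M m)"
  shows "induced_map ev1_int m (path_class M m c) = c"
proof -
  have "ev1_int m ` path_class M m c = {c}"
    using split_path_class[OF assms] by (force simp: path_class_def)
  then show ?thesis by (simp add: induced_map_def)
qed

lemma anchor_class:
  assumes "c \<in> carrier (courant_fibre M m)"
  shows "anchor path_quotient m (path_class M m c) = fst c"
proof -
  have "(\<lambda>x. fst (x 1)) ` path_class M m c = (\<lambda>x. fst c) ` path_class M m c"
    by (rule image_cong) (auto simp: path_class_def ev1_int_def)
  then have "(\<lambda>x. fst (x 1)) ` path_class M m c = {fst c}"
    using image_constant[OF split_path_class[OF assms]] by simp
  then show ?thesis by (simp add: quotient_algebroid_def)
qed

lemma quotient_fibre_eq: "fibre path_quotient m = quotient_fibre (path_fibre M m) (kernel_paths M m)"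
  by (simp add: quotient_algebroid_def)

text \<open>
  Every element of the Courant fibre is attained by \<open>ev1_int\<close>, namely at \<open>split_path\<close>.
\<close>

lemma quotient_carrier: "carrier (fibre path_quotient m) = path_class M m ` carrier (courant_fibre M m)"
proof -
  have "carrier (fibre path_quotient m) = (\<lambda>x. path_class M m (ev1_int m x)) ` carrier (path_fibre M m)"
    unfolding quotient_fibre_eq quotient_fibre_def partial_object.simps A_RCOSETS_def'
    using path_class_coset[of _ m] by auto
  also have "\<dots> = path_class M m ` carrier (courant_fibre M m)"
  proof
    show "(\<lambda>x. path_class M m (ev1_int m x)) ` carrier (path_fibre M m) \<subseteq> path_class M m ` carrier (courant_fibre M m)"
      using ev1_carrier[of _ m] by blast
    show "path_class M m ` carrier (courant_fibre M m) \<subseteq> (\<lambda>x. path_class M m (ev1_int m x)) ` carrier (path_fibre M m)"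
    proof (rule image_subsetI)
      fix c assume "c \<in> carrier (courant_fibre M m)"
      from split_path_carrier[OF this]
      show "path_class M m c \<in> (\<lambda>x. path_class M m (ev1_int m x)) ` carrier (path_fibre M m)"
        by (rule rev_image_eqI) (simp add: ev1_split_path)
    qed
  qed
  finally show ?thesis .
qed

lemma class_of_induced_map:
  "C \<in> carrier (fibre path_quotient m) \<Longrightarrow> induced_map ev1_int m C \<in> carrier (courant_fibre M m)"
  "C \<in> carrier (fibre path_quotient m) \<Longrightarrow> path_class M m (induced_map ev1_int m C) = C"
  unfolding quotient_carrier using induced_map_class[of _ m] by auto

lemma quotient_add:
  assumes c: "c \<in> carrier (courant_fibre M m)" and d: "d \<in> carrier (courant_fibre M m)"
  shows "path_class M m c \<oplus>\<^bsub>fibre path_quotient m\<^esub> path_class M m d = path_class M m (gadd c d)"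
proof -
  have "path_class M m c <+>\<^bsub>path_fibre M m\<^esub> path_class M m d = path_class M m (gadd c d)"
  proof
    show "path_class M m c <+>\<^bsub>path_fibre M m\<^esub> path_class M m d \<subseteq> path_class M m (gadd c d)"
      by (auto simp: set_add_def' path_class_def path_fibre_add ev1_add)
    show "path_class M m (gadd c d) \<subseteq> path_class M m c <+>\<^bsub>path_fibre M m\<^esub> path_class M m d"
    proof
      fix y assume "y \<in> path_class M m (gadd c d)"
      then have y: "y \<in> carrier (path_fibre M m)" "ev1_int m y = gadd c d" by (auto simp: path_class_def)
      \<comment> \<open>Splitting off the canonical representative of \<open>c\<close> leaves a representative of \<open>d\<close>.\<close>
      let ?h = "\<lambda>t. gadd (gscale 1 (y t)) (gscale (-1) (split_path c t))"
      have "?h \<in> path_class M m d"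
        using path_fibre_lincomb[OF y(1) split_path_carrier[OF c], of 1 "-1"]
          ev1_lincomb[OF y(1) split_path_carrier[OF c], of 1 "-1"] y(2)
        by (simp add: path_class_def ev1_split_path prod_eq_iff)
      moreover have "y = (\<lambda>t. gadd (split_path c t) (?h t))" by (simp add: fun_eq_iff prod_eq_iff)
      ultimately show "y \<in> path_class M m c <+>\<^bsub>path_fibre M m\<^esub> path_class M m d"
        using split_path_class[OF c] unfolding set_add_def' path_fibre_simps by blast
    qed
  qed
  then show ?thesis by (simp add: quotient_fibre_eq quotient_fibre_def)
qed

lemma quotient_scale:
  assumes c: "c \<in> carrier (courant_fibre M m)"
  shows "r \<odot>\<^bsub>fibre path_quotient m\<^esub> path_class M m c = path_class M m (gscale r c)"
proof -
  have "kernel_paths M m +>\<^bsub>path_fibre M m\<^esub> (\<lambda>t. gscale r (x t)) = path_class M m (gscale r c)"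
    if "x \<in> path_class M m c" for x
    using that path_class_coset[OF path_fibre_scale[of x m r]] by (simp add: path_class_def ev1_scale)
  then have "(\<Union>x\<in>path_class M m c. kernel_paths M m +>\<^bsub>path_fibre M m\<^esub> (\<lambda>t. gscale r (x t))) = path_class M m (gscale r c)"
    using split_path_class[OF c] by auto
  then show ?thesis by (simp add: quotient_fibre_eq quotient_fibre_def)
qed

lemma courant_carrier_closed:
  "c \<in> carrier (courant_fibre M m) \<Longrightarrow> d \<in> carrier (courant_fibre M m) \<Longrightarrow> gadd c d \<in> carrier (courant_fibre M m)"
  "c \<in> carrier (courant_fibre M m) \<Longrightarrow> gscale r c \<in> carrier (courant_fibre M m)"
  "gzero \<in> carrier (courant_fibre M m)"
  by (simp_all add: mem_Times_iff tangent_space_add cotangent_space_add tangent_space_scale cotangent_space_scale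
      tangent_space_zero cotangent_space_zero)

lemma quotient_closed:
  "C \<in> carrier (fibre path_quotient m) \<Longrightarrow> D \<in> carrier (fibre path_quotient m) \<Longrightarrow> C \<oplus>\<^bsub>fibre path_quotient m\<^esub> D \<in> carrier (fibre path_quotient m)"
  "C \<in> carrier (fibre path_quotient m) \<Longrightarrow> r \<odot>\<^bsub>fibre path_quotient m\<^esub> C \<in> carrier (fibre path_quotient m)"
  unfolding quotient_carrier using courant_carrier_closed(1,2)[of _ m] quotient_add[of _ m] quotient_scale[of _ m] by auto

lemma induced_map_linear_iso: "linear_iso (fibre path_quotient m) (courant_fibre M m) (induced_map ev1_int m)"
proof -
  have add: "induced_map ev1_int m (C \<oplus>\<^bsub>fibre path_quotient m\<^esub> D) = gadd (induced_map ev1_int m C) (induced_map ev1_int m D)"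
    if "C \<in> carrier (fibre path_quotient m)" "D \<in> carrier (fibre path_quotient m)" for C D
  proof -
    note h = that
    obtain c d where c: "c \<in> carrier (courant_fibre M m)" "C = path_class M m c"
      and d: "d \<in> carrier (courant_fibre M m)" "D = path_class M m d"
      using h unfolding quotient_carrier by blast
    show ?thesis
      unfolding c(2) d(2) quotient_add[OF c(1) d(1)] induced_map_class[OF c(1)] induced_map_class[OF d(1)]
      by (rule induced_map_class[OF courant_carrier_closed(1)[OF c(1) d(1)]])
  qed
  have scale: "induced_map ev1_int m (r \<odot>\<^bsub>fibre path_quotient m\<^esub> C) = gscale r (induced_map ev1_int m C)"
    if "C \<in> carrier (fibre path_quotient m)" for C r
  proof -
    obtain c where c: "c \<in> carrier (courant_fibre M m)" "C = path_class M m c"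
      using \<open>C \<in> _\<close> unfolding quotient_carrier by blast
    show ?thesis
      unfolding c(2) quotient_scale[OF c(1)] induced_map_class[OF c(1)]
      by (rule induced_map_class[OF courant_carrier_closed(2)[OF c(1)]])
  qed
  have "bij_betw (induced_map ev1_int m) (carrier (fibre path_quotient m)) (carrier (courant_fibre M m))"
  proof (rule bij_betw_byWitness[where f' = "path_class M m"])
    show "\<forall>C\<in>carrier (fibre path_quotient m). path_class M m (induced_map ev1_int m C) = C"
      using class_of_induced_map(2) by blast
    show "\<forall>c\<in>carrier (courant_fibre M m). induced_map ev1_int m (path_class M m c) = c"
      using induced_map_class by blast
    show "induced_map ev1_int m ` carrier (fibre path_quotient m) \<subseteq> carrier (courant_fibre M m)"
      using class_of_induced_map(1) by blast
    show "path_class M m ` carrier (courant_fibre M m) \<subseteq> carrier (fibre path_quotient m)"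
      by (simp add: quotient_carrier)
  qed
  then show ?thesis
    using add scale class_of_induced_map(1) by (simp add: linear_iso_def linear_map_def)
qed

lemma quotient_module: "Module.module reals_ring (fibre path_quotient m)"
proof (rule module_pullback[OF courant_fibre_module[of m]])
  have zero: "\<zero>\<^bsub>fibre path_quotient m\<^esub> = path_class M m gzero"
    by (simp add: quotient_fibre_eq quotient_fibre_def kernel_paths_eq)
  show "linear_map (fibre path_quotient m) (courant_fibre M m) (induced_map ev1_int m)"
    "inj_on (induced_map ev1_int m) (carrier (fibre path_quotient m))"
    using induced_map_linear_iso[of m] by (auto simp: linear_iso_def bij_betw_def)
  show "\<zero>\<^bsub>fibre path_quotient m\<^esub> \<in> carrier (fibre path_quotient m)"
    unfolding zero quotient_carrier by (rule imageI[OF courant_carrier_closed(3)])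
  show "induced_map ev1_int m \<zero>\<^bsub>fibre path_quotient m\<^esub> = \<zero>\<^bsub>courant_fibre M m\<^esub>"
    unfolding zero using induced_map_class[OF courant_carrier_closed(3)] by simp
qed (rule quotient_closed; assumption)+

lemma ev1_lifts:
  assumes U: "open U" and w: "w \<in> lifts (cotangent_paths M) U \<gamma>"
  shows "(\<lambda>p. ev1_int (\<gamma> p) (w p)) \<in> lifts (courant_algebroid M) U \<gamma>"
proof -
  note W = w[unfolded path_lifts_iff]
  have one: "(1::real) \<in> {0..1}" by simp
  have "smooth_fun_on M U (\<lambda>p. fst (w p 1) f)" if "f \<in> Cinf M" for f
    by (rule family_at[OF U one]) (use W that in blast)
  moreover have "smooth_fun_on M U (\<lambda>p. integral {0..1} (\<lambda>t. snd (w p t) (Y (\<gamma> p))))" if "Y \<in> vector_fields M" for Y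
    by (rule family_integral[OF U]) (use W that in blast)
  moreover have "ev1_int (\<gamma> p) (w p) \<in> carrier (courant_fibre M (\<gamma> p))" if "p \<in> U" for p
    by (rule ev1_carrier) (use W that in blast)
  ultimately show ?thesis using W by (simp add: courant_lifts_iff ev1_int_def path_integral_def)
qed

text \<open>
  Lifts of the quotient are classes of local lifts of paths. From the right to the left, composing the Courant lift
  with \<open>split_path\<close> gives a lift to paths on all of \<open>U\<close>.
\<close>

lemma quotient_lifts_iff:
  assumes U: "open U"
  shows "w \<in> lifts path_quotient U \<gamma> \<longleftrightarrow> (\<forall>p\<in>U. w p \<in> carrier (fibre path_quotient (\<gamma> p))) \<and>
    (\<lambda>p. induced_map ev1_int (\<gamma> p) (w p)) \<in> lifts (courant_algebroid M) U \<gamma>"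
proof -
  have "w \<in> lifts path_quotient U \<gamma> \<longleftrightarrow> (\<forall>p\<in>U. \<exists>V w'. open V \<and> p \<in> V \<and> V \<subseteq> U \<and> w' \<in> lifts (cotangent_paths M) V \<gamma> \<and>
      (\<forall>q\<in>V. w q = kernel_paths M (\<gamma> q) +>\<^bsub>path_fibre M (\<gamma> q)\<^esub> w' q))" (is "_ \<longleftrightarrow> ?L")
    by (simp add: quotient_algebroid_def)
  also have "\<dots> \<longleftrightarrow> (\<forall>p\<in>U. w p \<in> carrier (fibre path_quotient (\<gamma> p))) \<and>
    (\<lambda>p. induced_map ev1_int (\<gamma> p) (w p)) \<in> lifts (courant_algebroid M) U \<gamma>" (is "_ \<longleftrightarrow> ?R")
  proof
    assume L: ?L
    have loc: "\<exists>V w'. open V \<and> p \<in> V \<and> V \<subseteq> U \<and> w' \<in> lifts (cotangent_paths M) V \<gamma> \<and>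
      (\<forall>q\<in>V. ev1_int (\<gamma> q) (w' q) \<in> carrier (courant_fibre M (\<gamma> q)) \<and> w q = path_class M (\<gamma> q) (ev1_int (\<gamma> q) (w' q)))"
      if "p \<in> U" for p
    proof -
      from bspec[OF L that] obtain V w' where V: "open V" "p \<in> V" "V \<subseteq> U" "w' \<in> lifts (cotangent_paths M) V \<gamma>"
        "\<forall>q\<in>V. w q = kernel_paths M (\<gamma> q) +>\<^bsub>path_fibre M (\<gamma> q)\<^esub> w' q"
        by (elim exE conjE)
      have mem: "w' q \<in> carrier (path_fibre M (\<gamma> q))" if "q \<in> V" for q
        using V(4) that unfolding path_lifts_iff by blast
      show ?thesis
        using V(1-4) bspec[OF V(5)] path_class_coset[OF mem] ev1_carrier[OF mem]
        by (intro exI[of _ V] exI[of _ w']) simp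
    qed
    have "w p \<in> carrier (fibre path_quotient (\<gamma> p))" if "p \<in> U" for p
    proof -
      from loc[OF that] obtain V w' where "p \<in> V"
        "\<forall>q\<in>V. ev1_int (\<gamma> q) (w' q) \<in> carrier (courant_fibre M (\<gamma> q)) \<and> w q = path_class M (\<gamma> q) (ev1_int (\<gamma> q) (w' q))"
        by (elim exE conjE)
      then show ?thesis unfolding quotient_carrier by blast
    qed
    moreover have "(\<lambda>p. induced_map ev1_int (\<gamma> p) (w p)) \<in> lifts (courant_algebroid M) U \<gamma>"
    proof (rule iffD2[OF vector_bundleD(4)[OF courant_vector_bundle U]], rule ballI)
      fix p assume "p \<in> U"
      from loc[OF this] obtain V w' where V: "open V" "p \<in> V" "V \<subseteq> U" "w' \<in> lifts (cotangent_paths M) V \<gamma>"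
        and eq: "\<forall>q\<in>V. ev1_int (\<gamma> q) (w' q) \<in> carrier (courant_fibre M (\<gamma> q)) \<and> w q = path_class M (\<gamma> q) (ev1_int (\<gamma> q) (w' q))"
        by (elim exE conjE)
      have "induced_map ev1_int (\<gamma> q) (w q) = ev1_int (\<gamma> q) (w' q)" if "q \<in> V" for q
        using bspec[OF eq that] induced_map_class by metis
      then show "\<exists>V w'. open V \<and> p \<in> V \<and> V \<subseteq> U \<and> w' \<in> lifts (courant_algebroid M) V \<gamma> \<and>
          (\<forall>q\<in>V. induced_map ev1_int (\<gamma> q) (w q) = w' q)"
        using V ev1_lifts[OF V(1,4)] by (intro exI[of _ V] exI[of _ "\<lambda>p. ev1_int (\<gamma> p) (w' p)"]) simp
    qed
    ultimately show ?R by blast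
  next
    assume R: ?R
    let ?s = "\<lambda>p. induced_map ev1_int (\<gamma> p) (w p)"
    have split: "(\<lambda>p. split_path (?s p)) \<in> lifts (cotangent_paths M) U \<gamma>"
      using courant_lifts_split[OF U, of ?s \<gamma>] R by blast
    have "w q = kernel_paths M (\<gamma> q) +>\<^bsub>path_fibre M (\<gamma> q)\<^esub> split_path (?s q)" if "q \<in> U" for q
      using path_class_coset[OF split_path_carrier[OF class_of_induced_map(1)], of "w q" "\<gamma> q"]
        class_of_induced_map(2)[of "w q" "\<gamma> q"] R that by (simp add: ev1_split_path)
    then show ?L using U split by (intro ballI exI[of _ U] exI[of _ "\<lambda>p. split_path (?s p)"]) simp
  qed
  finally show ?thesis .
qed

lemma quotient_vector_bundle: "vector_bundle M path_quotient"
proof (rule vector_bundle_pullback[where \<sigma> = "induced_map ev1_int", OF courant_vector_bundle quotient_module _ quotient_lifts_iff])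
  show "linear_map (fibre path_quotient m) (fibre (courant_algebroid M) m) (induced_map ev1_int m)" for m
    using induced_map_linear_iso[of m] by (simp add: linear_iso_def)
  show "\<exists>U \<psi> \<psi>'. local_trivialization (courant_algebroid M) m U \<psi> \<and>
      (\<forall>p\<in>U. linear_iso (fibre path_quotient p) (fibre path_quotient m) (\<psi>' p) \<and>
        (\<forall>x\<in>carrier (fibre path_quotient p). induced_map ev1_int m (\<psi>' p x) = \<psi> p (induced_map ev1_int p x)))" for m
  proof -
    obtain U \<psi> where T: "local_trivialization (courant_algebroid M) m U \<psi>"
      using vector_bundleD(8)[OF courant_vector_bundle, of m] by blast
    have iso: "linear_iso (courant_fibre M p) (courant_fibre M m) (\<psi> p)" if "p \<in> U" for p
      using T that by (simp add: local_trivialization_def)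
    let ?\<psi> = "\<lambda>p x. inv_into (carrier (fibre path_quotient m)) (induced_map ev1_int m) (\<psi> p (induced_map ev1_int p x))"
    have "linear_iso (fibre path_quotient p) (fibre path_quotient m) (?\<psi> p)" if "p \<in> U" for p
      by (rule linear_iso_comp[OF linear_iso_comp[OF induced_map_linear_iso iso[OF that]]
            linear_iso_inv[OF induced_map_linear_iso quotient_closed]])
    moreover have "induced_map ev1_int m (?\<psi> p x) = \<psi> p (induced_map ev1_int p x)"
      if "p \<in> U" "x \<in> carrier (fibre path_quotient p)" for p x
    proof (rule bij_betw_inv_into_right)
      show "bij_betw (induced_map ev1_int m) (carrier (fibre path_quotient m)) (carrier (courant_fibre M m))"
        using induced_map_linear_iso[of m] by (simp add: linear_iso_def)
      show "\<psi> p (induced_map ev1_int p x) \<in> carrier (courant_fibre M m)"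
        using linear_mapD(1)[OF conjunct1[OF iso[OF that(1), unfolded linear_iso_def]] class_of_induced_map(1)[OF that(2)]] .
    qed
    ultimately show ?thesis using T by (intro exI[of _ U] exI[of _ \<psi>] exI[of _ ?\<psi>]) simp
  qed
qed

lemma quotient_anchor:
  "C \<in> carrier (fibre path_quotient m) \<Longrightarrow> anchor path_quotient m C = fst (induced_map ev1_int m C)"
  using anchor_class[OF class_of_induced_map(1), of C m] class_of_induced_map(2)[of C m] by simp

lemma quotient_smooth_anchor: "smooth_anchor M path_quotient"
proof -
  have T: "anchor path_quotient m C \<in> tangent_space M m" if "C \<in> carrier (fibre path_quotient m)" for m C
    using class_of_induced_map(1)[OF that] by (simp add: quotient_anchor[OF that] mem_Times_iff)
  have add: "anchor path_quotient m (C \<oplus>\<^bsub>fibre path_quotient m\<^esub> D) = (\<lambda>f. anchor path_quotient m C f + anchor path_quotient m D f)"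
    if "C \<in> carrier (fibre path_quotient m)" "D \<in> carrier (fibre path_quotient m)" for m C D
    using linear_mapD(2)[OF conjunct1[OF induced_map_linear_iso[unfolded linear_iso_def]] that]
    by (simp add: quotient_anchor quotient_closed(1) that)
  have scale: "anchor path_quotient m (r \<odot>\<^bsub>fibre path_quotient m\<^esub> C) = (\<lambda>f. r * anchor path_quotient m C f)"
    if "C \<in> carrier (fibre path_quotient m)" for m C r
    using linear_mapD(3)[OF conjunct1[OF induced_map_linear_iso[unfolded linear_iso_def]] that]
    by (simp add: quotient_anchor quotient_closed(2) that)
  have smooth: "smooth_fun_on M U (\<lambda>p. anchor path_quotient (\<gamma> p) (w p) f)"
    if U: "open U" and w: "w \<in> lifts path_quotient U \<gamma>" and f: "f \<in> Cinf M" for U \<gamma> w f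
  proof -
    note W = iffD1[OF quotient_lifts_iff[OF U] w]
    have "smooth_fun_on M U (\<lambda>p. fst (induced_map ev1_int (\<gamma> p) (w p)) f)"
      using W f unfolding courant_lifts_iff by blast
    then show ?thesis
      by (rule iffD1[OF smooth_fun_cong[OF U], rotated]) (use W in \<open>simp add: quotient_anchor\<close>)
  qed
  show ?thesis
    unfolding smooth_anchor_def
    by (intro conjI allI ballI impI) (rule T add scale smooth; assumption)+
qed

lemma ev1_sections: "a \<in> sections (cotangent_paths M) \<Longrightarrow> (\<lambda>p. ev1_int p (a p)) \<in> sections (courant_algebroid M)"
  using ev1_lifts[OF open_UNIV, of a "\<lambda>p. p"] by (simp add: sections_def)

lemma split_sections:
  "s \<in> sections (courant_algebroid M) \<Longrightarrow> (\<lambda>p. split_path (s p)) \<in> sections (cotangent_paths M)"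
  using courant_lifts_split[OF open_UNIV, of s "\<lambda>p. p"] by (simp add: sections_def)

lemma path_section_carrier: "a \<in> sections (cotangent_paths M) \<Longrightarrow> a p \<in> carrier (path_fibre M p)"
  by (simp add: sections_def path_lifts_iff)

text \<open>
  The Leibniz identity of the Dorfman bracket is inherited from cotangent paths.
\<close>

lemma courant_leibniz_algebroid: "leibniz_algebroid M (courant_algebroid M)"
proof (rule leibniz_algebroid_image[where \<pi> = ev1_int, OF path_leibniz_algebroid courant_vector_bundle courant_smooth_anchor _ ev1_sections])
  show "linear_map (fibre (cotangent_paths M) m) (fibre (courant_algebroid M) m) (ev1_int m)" for m
    using ev1_carrier[of _ m] by (simp add: linear_map_def ev1_add ev1_scale)
  show "\<exists>a\<in>sections (cotangent_paths M). s = (\<lambda>p. ev1_int p (a p))" if "s \<in> sections (courant_algebroid M)" for s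
    using split_sections[OF that] by (intro bexI[of _ "\<lambda>p. split_path (s p)"]) (simp_all add: ev1_split_path)
  show "bracket (courant_algebroid M) (\<lambda>p. ev1_int p (a p)) (\<lambda>p. ev1_int p (b p)) =
      (\<lambda>p. ev1_int p (bracket (cotangent_paths M) a b p))"
    if "a \<in> sections (cotangent_paths M)" "b \<in> sections (cotangent_paths M)" for a b
    using ev1_path_bracket[OF that] by (simp add: fun_eq_iff)
  show "anchor (courant_algebroid M) m (ev1_int m x) = anchor (cotangent_paths M) m x" for m x
    by (simp add: ev1_int_def)
qed

lemma class_section:
  assumes "a \<in> sections (cotangent_paths M)"
  shows "(\<lambda>p. path_class M p (ev1_int p (a p))) \<in> sections path_quotient"
  using ev1_sections[OF assms] ev1_carrier[OF path_section_carrier[OF assms]]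
  unfolding sections_def by (simp add: quotient_lifts_iff induced_map_class quotient_carrier)

text \<open>
  Representatives of the same section of the quotient have the same image under \<open>ev1_int\<close>, and by
  \<open>ev1_path_bracket\<close> this image determines the class of the bracket; so the set of candidates for the value of the bracket is
  a singleton.
\<close>

lemma quotient_bracket:
  assumes a: "a \<in> sections (cotangent_paths M)" and b: "b \<in> sections (cotangent_paths M)"
  shows "bracket path_quotient (\<lambda>p. path_class M p (ev1_int p (a p))) (\<lambda>p. path_class M p (ev1_int p (b p))) =
    (\<lambda>p. path_class M p (ev1_int p (path_bracket M a b p)))"
proof
  fix m
  let ?P = "sections (cotangent_paths M)"
  have coset: "kernel_paths M p +>\<^bsub>path_fibre M p\<^esub> d p = path_class M p (ev1_int p (d p))" if "d \<in> ?P" for d p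
    by (rule path_class_coset[OF path_section_carrier[OF that]])
  have ev: "(\<lambda>p. ev1_int p (d p)) = (\<lambda>p. ev1_int p (e p))"
    if d: "d \<in> ?P" and e: "e \<in> ?P"
      and eq: "(\<lambda>p. path_class M p (ev1_int p (d p))) = (\<lambda>p. kernel_paths M p +>\<^bsub>path_fibre M p\<^esub> e p)" for d e
  proof
    fix p
    have "induced_map ev1_int p (path_class M p (ev1_int p (d p))) = induced_map ev1_int p (path_class M p (ev1_int p (e p)))"
      using fun_cong[OF eq, of p] unfolding coset[OF e] by (rule arg_cong)
    then show "ev1_int p (d p) = ev1_int p (e p)"
      unfolding induced_map_class[OF ev1_carrier[OF path_section_carrier[OF d]]]
        induced_map_class[OF ev1_carrier[OF path_section_carrier[OF e]]] .
  qed
  have "{kernel_paths M m +>\<^bsub>path_fibre M m\<^esub> path_bracket M a' b' m | a' b'. a' \<in> ?P \<and> b' \<in> ?P \<and>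
      (\<lambda>p. path_class M p (ev1_int p (a p))) = (\<lambda>p. kernel_paths M p +>\<^bsub>path_fibre M p\<^esub> a' p) \<and>
      (\<lambda>p. path_class M p (ev1_int p (b p))) = (\<lambda>p. kernel_paths M p +>\<^bsub>path_fibre M p\<^esub> b' p)} =
    {path_class M m (ev1_int m (path_bracket M a b m))}" (is "?S = {?c}")
  proof
    have "kernel_paths M m +>\<^bsub>path_fibre M m\<^esub> path_bracket M a' b' m = ?c"
      if a': "a' \<in> ?P" and b': "b' \<in> ?P"
        and ea: "(\<lambda>p. path_class M p (ev1_int p (a p))) = (\<lambda>p. kernel_paths M p +>\<^bsub>path_fibre M p\<^esub> a' p)"
        and eb: "(\<lambda>p. path_class M p (ev1_int p (b p))) = (\<lambda>p. kernel_paths M p +>\<^bsub>path_fibre M p\<^esub> b' p)" for a' b'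
      unfolding coset[OF path_bracket_section[OF a' b']] ev1_path_bracket[OF a' b'] ev1_path_bracket[OF a b]
        ev[OF a a' ea] ev[OF b b' eb] ..
    then show "?S \<subseteq> {?c}" by blast
    have "?c = kernel_paths M m +>\<^bsub>path_fibre M m\<^esub> path_bracket M a b m"
      by (rule coset[OF path_bracket_section[OF a b], symmetric])
    moreover have "(\<lambda>p. path_class M p (ev1_int p (d p))) = (\<lambda>p. kernel_paths M p +>\<^bsub>path_fibre M p\<^esub> d p)"
      if "d \<in> ?P" for d
      by (rule ext) (rule coset[OF that, symmetric])
    ultimately show "{?c} \<subseteq> ?S" using a b by blast
  qed
  then show "bracket path_quotient (\<lambda>p. path_class M p (ev1_int p (a p))) (\<lambda>p. path_class M p (ev1_int p (b p))) m =
    path_class M m (ev1_int m (path_bracket M a b m))"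
    by (simp add: quotient_algebroid_def)
qed

lemma quotient_section_lift:
  assumes "\<sigma> \<in> sections path_quotient"
  shows "\<exists>a\<in>sections (cotangent_paths M). \<sigma> = (\<lambda>p. path_class M p (ev1_int p (a p)))"
proof -
  note S = iffD1[OF quotient_lifts_iff[OF open_UNIV] assms[unfolded sections_def]]
  have "(\<lambda>p. split_path (induced_map ev1_int p (\<sigma> p))) \<in> sections (cotangent_paths M)"
    using split_sections[of "\<lambda>p. induced_map ev1_int p (\<sigma> p)"] S by (simp add: sections_def)
  then show ?thesis
    using S class_of_induced_map(2)
    by (intro bexI[of _ "\<lambda>p. split_path (induced_map ev1_int p (\<sigma> p))"]) (simp_all add: ev1_split_path)
qed

lemma quotient_leibniz_algebroid: "leibniz_algebroid M path_quotient"
proof (rule leibniz_algebroid_image[where \<pi> = "\<lambda>m x. path_class M m (ev1_int m x)",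
      OF path_leibniz_algebroid quotient_vector_bundle quotient_smooth_anchor _ class_section quotient_section_lift])
  show "linear_map (fibre (cotangent_paths M) m) (fibre path_quotient m) (\<lambda>x. path_class M m (ev1_int m x))" for m
    using ev1_carrier[of _ m]
    by (simp add: linear_map_def quotient_carrier ev1_add ev1_scale quotient_add quotient_scale)
  show "anchor path_quotient m (path_class M m (ev1_int m x)) = anchor (cotangent_paths M) m x"
    if "x \<in> carrier (fibre (cotangent_paths M) m)" for m x
    using anchor_class[OF ev1_carrier, of x m] that by (simp add: ev1_int_def)
  show "bracket path_quotient (\<lambda>p. path_class M p (ev1_int p (a p))) (\<lambda>p. path_class M p (ev1_int p (b p))) =
    (\<lambda>p. path_class M p (ev1_int p (bracket (cotangent_paths M) a b p)))"
    if "a \<in> sections (cotangent_paths M)" "b \<in> sections (cotangent_paths M)" for a b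
    using quotient_bracket[OF that] by simp
qed

lemma induced_map_leibniz_iso:
  "leibniz_algebroid_iso M path_quotient (courant_algebroid M) (induced_map ev1_int)"
  unfolding leibniz_algebroid_iso_def
proof (intro conjI allI ballI impI quotient_leibniz_algebroid courant_leibniz_algebroid)
  show "linear_iso (fibre path_quotient m) (fibre (courant_algebroid M) m) (induced_map ev1_int m)" for m
    using induced_map_linear_iso by simp
  show "w \<in> lifts path_quotient U \<gamma> \<longleftrightarrow> (\<lambda>p. induced_map ev1_int (\<gamma> p) (w p)) \<in> lifts (courant_algebroid M) U \<gamma>"
    if "open U" "\<forall>p\<in>U. w p \<in> carrier (fibre path_quotient (\<gamma> p))" for U w \<gamma>
    using quotient_lifts_iff[OF that(1), of w \<gamma>] that(2) by simp
  show "anchor (courant_algebroid M) m (induced_map ev1_int m C) = anchor path_quotient m C"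
    if "C \<in> carrier (fibre path_quotient m)" for m C
    using quotient_anchor[OF that] by simp
  fix \<sigma> \<tau> assume "\<sigma> \<in> sections path_quotient" "\<tau> \<in> sections path_quotient"
  then obtain a b where a: "a \<in> sections (cotangent_paths M)" "\<sigma> = (\<lambda>p. path_class M p (ev1_int p (a p)))"
    and b: "b \<in> sections (cotangent_paths M)" "\<tau> = (\<lambda>p. path_class M p (ev1_int p (b p)))"
    using quotient_section_lift by meson
  have im: "induced_map ev1_int p (path_class M p (ev1_int p (d p))) = ev1_int p (d p)"
    if "d \<in> sections (cotangent_paths M)" for d p
    by (rule induced_map_class[OF ev1_carrier[OF path_section_carrier[OF that]]])
  show "bracket (courant_algebroid M) (\<lambda>p. induced_map ev1_int p (\<sigma> p)) (\<lambda>p. induced_map ev1_int p (\<tau> p)) =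
      (\<lambda>p. induced_map ev1_int p (bracket path_quotient \<sigma> \<tau> p))"
    unfolding a(2) b(2) quotient_bracket[OF a(1) b(1)] im[OF a(1)] im[OF b(1)] im[OF path_bracket_section[OF a(1) b(1)]]
    using ev1_path_bracket[OF a(1) b(1)] by (simp add: fun_eq_iff)
qed


section \<open>The ideal of kernel paths\<close>

lemma dorfman_bracket_zero:
  assumes Y: "Y \<in> vector_fields M" and \<beta>: "\<beta> \<in> one_forms M"
  shows "dorfman_bracket M (\<lambda>p. gzero) (\<lambda>p. (Y p, \<beta> p)) m = gzero"
    and "dorfman_bracket M (\<lambda>p. (Y p, \<beta> p)) (\<lambda>p. gzero) m = gzero"
proof -
  note Ym = vector_field_at[OF Y, of m]
  have "lie_bracket (\<lambda>p f. 0) Y m = (\<lambda>f. 0)" "lie_bracket Y (\<lambda>p f. 0) m = (\<lambda>f. 0)"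
    by (simp_all add: lie_bracket_def tangent_const[OF Ym])
  moreover have "lie_derivative M (\<lambda>p f. 0) \<beta> m v = 0" for v
    using lie_derivative_lincomb_field[OF Y Y \<beta>, of 0 0 m v] by simp
  moreover have "lie_derivative M Y (\<lambda>p v. 0) m v = 0" for v
    using lie_derivative_lincomb_form[OF Y \<beta> \<beta> Cinf_const Cinf_const, of 0 0 m v] by (simp add: tangent_const[OF Ym])
  moreover have "interior_d M (\<lambda>p f. 0) \<beta> m v = 0" for v
    using ext_deriv_lincomb_left[OF \<beta> Ym Ym, of 0 0 v] by (simp add: interior_d_def)
  moreover have "interior_d M Y (\<lambda>p v. 0) m v = 0" for v
    using interior_d_lincomb_form[OF Y \<beta> \<beta>, of 0 0 m v] by simp
  ultimately show "dorfman_bracket M (\<lambda>p. gzero) (\<lambda>p. (Y p, \<beta> p)) m = gzero"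
    "dorfman_bracket M (\<lambda>p. (Y p, \<beta> p)) (\<lambda>p. gzero) m = gzero"
    by (simp_all add: dorfman_bracket_def gzero_def fun_eq_iff Let_def)
qed

lemma kernel_sections_iff:
  "a \<in> sub_sections (cotangent_paths M) (kernel_paths M) \<longleftrightarrow>
    a \<in> sections (cotangent_paths M) \<and> (\<forall>p. ev1_int p (a p) = gzero)"
  using path_section_carrier[of a] by (auto simp: sub_sections_def kernel_paths_eq path_class_def)

text \<open>
  The image under \<open>ev1_int\<close> is the Dorfman bracket with the zero section, which vanishes.
\<close>

lemma kernel_bracket:
  assumes a: "a \<in> sections (cotangent_paths M)" and b: "b \<in> sub_sections (cotangent_paths M) (kernel_paths M)"
  shows "path_bracket M a b \<in> sub_sections (cotangent_paths M) (kernel_paths M)"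
    and "path_bracket M b a \<in> sub_sections (cotangent_paths M) (kernel_paths M)"
proof -
  have b': "b \<in> sections (cotangent_paths M)" "\<And>p. ev1_int p (b p) = gzero" using b by (auto simp: kernel_sections_iff)
  have "(\<lambda>p. ev1_int p (a p)) = (\<lambda>p. (field_part a 1 p, integral_form (form_part a) p))"
    by (simp add: ev1_int_def)
  note zero = dorfman_bracket_zero[OF path_sectionD(5,6)[OF a], folded this]
  show "path_bracket M a b \<in> sub_sections (cotangent_paths M) (kernel_paths M)"
    using path_bracket_section[OF a b'(1)] ev1_path_bracket[OF a b'(1)] zero(2) by (simp add: kernel_sections_iff b'(2))
  show "path_bracket M b a \<in> sub_sections (cotangent_paths M) (kernel_paths M)"
    using path_bracket_section[OF b'(1) a] ev1_path_bracket[OF b'(1) a] zero(1) by (simp add: kernel_sections_iff b'(2))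
qed

lemma kernel_submodule: "submodule (kernel_paths M m) reals_ring (path_fibre M m)"
proof -
  interpret V: Module.module reals_ring "path_fibre M m" by (rule path_fibre_module)
  show ?thesis
  proof (rule V.submoduleI)
    show "kernel_paths M m \<subseteq> carrier (path_fibre M m)" by (auto simp: kernel_paths_def)
    show "\<zero>\<^bsub>path_fibre M m\<^esub> \<in> kernel_paths M m"
      using ev1_scale[OF path_fibre_zero, of m 0] path_fibre_zero by (simp add: kernel_paths_eq path_class_def)
    show scale: "r \<odot>\<^bsub>path_fibre M m\<^esub> x \<in> kernel_paths M m" if "x \<in> kernel_paths M m" for r x
      using that by (simp add: kernel_paths_eq path_class_def path_fibre_scale ev1_scale)
    show "\<ominus>\<^bsub>path_fibre M m\<^esub> x \<in> kernel_paths M m" if x: "x \<in> kernel_paths M m" for x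
    proof -
      have x': "x \<in> carrier (path_fibre M m)" using x by (simp add: kernel_paths_def)
      have "\<ominus>\<^bsub>path_fibre M m\<^esub> x = (-1) \<odot>\<^bsub>path_fibre M m\<^esub> x"
        by (rule V.minus_equality[OF _ x']) (use path_fibre_scale[OF x'] in \<open>simp_all add: fun_eq_iff prod_eq_iff\<close>)
      then show ?thesis using scale[OF x] by simp
    qed
    show "x \<oplus>\<^bsub>path_fibre M m\<^esub> y \<in> kernel_paths M m" if "x \<in> kernel_paths M m" "y \<in> kernel_paths M m" for x y
      using that by (simp add: kernel_paths_eq path_class_def path_fibre_add ev1_add)
  qed
qed

text \<open>
  Frame transport commutes with \<open>ev1_int\<close>, hence it preserves the kernel in both directions.
\<close>

lemma kernel_subbundle: "subbundle (cotangent_paths M) (kernel_paths M)"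
proof -
  have "\<exists>U \<psi>. local_trivialization (cotangent_paths M) m U \<psi> \<and> (\<forall>p\<in>U. \<psi> p ` kernel_paths M p = kernel_paths M m)" for m
  proof -
    obtain U c B N x E where fr: "chart_frame U c B N x E" "m \<in> N" using chart_frame_exists by blast
    let ?ft = "\<lambda>p q. frame_transport B x E (tangent_space M q) p q"
    have ker: "(\<lambda>t. ?ft p q (y t)) \<in> kernel_paths M q" if "p \<in> N" "q \<in> N" "y \<in> kernel_paths M p" for p q y
      using path_ft_carrier[OF fr(1) that(1,2), of y] that(3)
      by (simp add: kernel_paths_eq path_class_def frame_transport_ev1 frame_transport_lincomb)
    have "(\<lambda>y t. ?ft p m (y t)) ` kernel_paths M p = kernel_paths M m" if p: "p \<in> N" for p
    proof
      show "(\<lambda>y t. ?ft p m (y t)) ` kernel_paths M p \<subseteq> kernel_paths M m" using ker[OF p fr(2)] by blast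
      show "kernel_paths M m \<subseteq> (\<lambda>y t. ?ft p m (y t)) ` kernel_paths M p"
      proof
        fix y assume y: "y \<in> kernel_paths M m"
        then have "y = (\<lambda>t. ?ft p m (?ft m p (y t)))"
          using path_ft_inverse[OF fr(1) fr(2) p, of y] by (simp add: kernel_paths_def)
        then show "y \<in> (\<lambda>y t. ?ft p m (y t)) ` kernel_paths M p"
          using ker[OF fr(2) p y] by (rule image_eqI)
      qed
    qed
    then show ?thesis using path_local_trivialization[OF fr] by blast
  qed
  then show ?thesis by (simp add: subbundle_def kernel_submodule)
qed

lemma kernel_leibniz_ideal: "leibniz_ideal (cotangent_paths M) (kernel_paths M)"
proof -
  have "sub_sections (cotangent_paths M) (kernel_paths M) \<subseteq> sections (cotangent_paths M)"
    by (auto simp: sub_sections_def)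
  then show ?thesis
    using kernel_subbundle kernel_bracket
    by (auto simp: leibniz_ideal_def leibniz_subalgebroid_def kernel_paths_def)
qed

end

theorem proposition3p7:
  fixes M :: "('m::{t2_space,second_countable_topology}, 'e::euclidean_space) manifold"
  assumes "smooth_manifold M"
    and "compact (UNIV :: 'm set)"
  shows "leibniz_algebroid M (cotangent_paths M) \<and>
    leibniz_ideal (cotangent_paths M) (kernel_paths M) \<and>
    (\<forall>m. \<forall>x \<in> carrier (fibre (cotangent_paths M) m).
       induced_map ev1_int m (coset (cotangent_paths M) (kernel_paths M) m x) = ev1_int m x) \<and>
    leibniz_algebroid_iso M
      (quotient_algebroid (cotangent_paths M) (kernel_paths M))
      (courant_algebroid M)
      (induced_map ev1_int)"
proof -
  interpret mfd M by unfold_locales (rule assms(1))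
  have "induced_map ev1_int m (coset (cotangent_paths M) (kernel_paths M) m x) = ev1_int m x"
    if "x \<in> carrier (fibre (cotangent_paths M) m)" for m x
    using path_class_coset[of x m] induced_map_class[OF ev1_carrier[of x m]] that by simp
  then show ?thesis
    using path_leibniz_algebroid kernel_leibniz_ideal induced_map_leibniz_iso by blast
qed

end
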